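(* Let $0<\epsilon<1$, and suppose that - $n/6\ge\max\{r_1,r_2,r'\}$; - $m_1\ge r_1'(n-r_1)$; - $m_2\ge r_2'(n-r_2)$; - $m_1+m_2\ge r_1'(n-r_1)+r_2'(n-r_2)+r'(n-r')$. Suppose also that every column of $\mathbf{\Omega}$ has at least $l$ nonzero entries, where $$l>\max\Big\{9\log\tfrac{n}{\epsilon}+3\max\{\log\tfrac{3r_1'}{\epsilon},\log\tfrac{3r_2'}{\epsilon},\log\tfrac{3r'}{\epsilon}\}+6,\;2r_1,\;2r_2\Big\}.$$ Then, with probability at least $1-\epsilon$ (over the random sampling pattern), $\mathbf{U}$ is finitely completable.
   Context: Setup: Let $n,m_1,m_2$ be positive integers and $r,r_1,r_2$ integers with $1\le r_1,r_2\le r\le \min\{n,r_1+r_2\}$. The matrix $\mathbf{U}=[\mathbf{U}_1|\mathbf{U}_2]\in\mathbb{R}^{n\times(m_1+m_2)}$ is generic (outside a Lebesgue-null set), with views $\mathbf{U}_1\in\mathbb{R}^{n\times m_1}$ and $\mathbf{U}_2\in\mathbb{R}^{n\times m_2}$, and satisfies $\mathrm{rank}(\mathbf{U}_1)=r_1$, $\mathrm{rank}(\mathbf{U}_2)=r_2$, $\mathrm{rank}(\mathbf{U})=r$. Set $r_1'=r-r_2$, $r_2'=r-r_1$, $r'=r_1+r_2-r$. Sampling pattern: $\mathbf{\Omega}\in\{0,1\}^{n\times(m_1+m_2)}$ marks the observed entries. Within each column, the locations of the observed entries are chosen uniformly at random, independently across columns. Completions: a completion is any matrix that agrees with $\mathbf{U}$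 on the observed entries and satisfies the three rank constraints. $\mathbf{U}$ is finitely completable if it has only finitely many completions. *)

theory Defs
  imports "HOL-Probability.Probability" "Jordan_Normal_Form.DL_Rank"
begin

abbreviation mrank :: "nat \<Rightarrow> real mat \<Rightarrow> nat" where
  "mrank n A \<equiv> vec_space.rank n A"

definition view1 :: "nat \<Rightarrow> nat \<Rightarrow> real mat \<Rightarrow> real mat" where
  "view1 n m1 U = mat n m1 (\<lambda>(i,j). U $$ (i,j))"

definition view2 :: "nat \<Rightarrow> nat \<Rightarrow> nat \<Rightarrow> real mat \<Rightarrow> real mat" where
  "view2 n m1 m2 U = mat n m2 (\<lambda>(i,j). U $$ (i, m1 + j))"

definition completions ::
  "nat \<Rightarrow> nat \<Rightarrow> nat \<Rightarrow> nat \<Rightarrow> nat \<Rightarrow> nat \<Rightarrow> real mat \<Rightarrow> (nat \<Rightarrow> nat set) \<Rightarrow> real mat set" where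
  "completions n m1 m2 r1 r2 r U \<Omega> =
     {V. V \<in> carrier_mat n (m1 + m2) \<and>
         (\<forall>j < m1 + m2. \<forall>i \<in> \<Omega> j. i < n \<longrightarrow> V $$ (i,j) = U $$ (i,j)) \<and>
         mrank n (view1 n m1 V) = r1 \<and> mrank n (view2 n m1 m2 V) = r2 \<and> mrank n V = r}"

definition finitely_completable ::
  "nat \<Rightarrow> nat \<Rightarrow> nat \<Rightarrow> nat \<Rightarrow> nat \<Rightarrow> nat \<Rightarrow> real mat \<Rightarrow> (nat \<Rightarrow> nat set) \<Rightarrow> bool" where
  "finitely_completable n m1 m2 r1 r2 r U \<Omega> \<longleftrightarrow> finite (completions n m1 m2 r1 r2 r U \<Omega>)"

definition sampling :: "nat \<Rightarrow> nat \<Rightarrow> (nat \<Rightarrow> nat) \<Rightarrow> (nat \<Rightarrow> nat set) pmf" where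
  "sampling n m k = Pi_pmf {..<m} {} (\<lambda>j. pmf_of_set {S. S \<subseteq> {..<n} \<and> card S = k j})"

text \<open>Generic model.  With r' = r1+r2-r, r1' = r-r2, r2' = r-r1, a matrix U with the
  given rank structure is U = [U1|U2], U1 = [A0|A1] X1, U2 = [A0|A2] X2, where
  A0 (n x r'), A1 (n x r1'), A2 (n x r2'), X1 (r1 x m1), X2 (r2 x m2).  The parameters are
  collected in a real function on a finite index set; tags 0..4 identify the blocks.\<close>
definition param_index :: "nat \<Rightarrow> nat \<Rightarrow> nat \<Rightarrow> nat \<Rightarrow> nat \<Rightarrow> nat \<Rightarrow> (nat \<times> nat \<times> nat) set" where
  "param_index n m1 m2 r1 r2 r =
     {0} \<times> {..<n} \<times> {..<r1 + r2 - r} \<union>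
     {1} \<times> {..<n} \<times> {..<r - r2} \<union>
     {2} \<times> {..<n} \<times> {..<r - r1} \<union>
     {3} \<times> {..<r1} \<times> {..<m1} \<union>
     {4} \<times> {..<r2} \<times> {..<m2}"

definition param_measure :: "nat \<Rightarrow> nat \<Rightarrow> nat \<Rightarrow> nat \<Rightarrow> nat \<Rightarrow> nat \<Rightarrow> (nat \<times> nat \<times> nat \<Rightarrow> real) measure" where
  "param_measure n m1 m2 r1 r2 r = PiM (param_index n m1 m2 r1 r2 r) (\<lambda>_. lborel)"

definition param_matrix :: "nat \<Rightarrow> nat \<Rightarrow> nat \<Rightarrow> nat \<Rightarrow> nat \<Rightarrow> nat \<Rightarrow> (nat \<times> nat \<times> nat \<Rightarrow> real) \<Rightarrow> real mat" where
  "param_matrix n m1 m2 r1 r2 r p =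
     (let r' = r1 + r2 - r;
          B1 = mat n r1 (\<lambda>(i,k). if k < r' then p (0,i,k) else p (1,i,k - r'));
          B2 = mat n r2 (\<lambda>(i,k). if k < r' then p (0,i,k) else p (2,i,k - r'));
          X1 = mat r1 m1 (\<lambda>(k,j). p (3,k,j));
          X2 = mat r2 m2 (\<lambda>(k,j). p (4,k,j));
          U1 = B1 * X1; U2 = B2 * X2
      in mat n (m1 + m2) (\<lambda>(i,j). if j < m1 then U1 $$ (i,j) else U2 $$ (i, j - m1)))"

end

theory Submission
  imports Defs "Jordan_Normal_Form.Char_Poly"
begin

text \<open>One of the two views, say the first, contains at least half of the columns that the hypothesis
  allots to the intersection of the two column spaces. By Hall's theorem half of the columns of a
  group suffice with high probability (each column has more than twice as many observed entries as
  the rank, so it can be used two or three times): the first view alone then determines its column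
  space to first order, and the second view determines the rest. Hence the Jacobian of the map from
  normalised factorisations to observed entries is injective at a suitable point. If so, counting
  monomials shows that every entry of a completion satisfies a nonzero polynomial equation whose
  coefficients are polynomials in the observed entries; for generic \<open>U\<close> not all of these coefficients
  vanish, so each entry takes finitely many values.\<close>

section \<open>Linear algebra over finite index sets\<close>

text \<open>An injective Jacobian is a local statement at one point, whereas all completions of a
  generic \<open>U\<close> count, also those far from that point. The implicit function theorem
  would only show that solutions near it are isolated. A polynomial relation between an entry and
  the observed entries, in contrast, holds identically on all factorisations with the same pivot
  rows and so bounds all of them at once. Because the ranks of a completion are prescribed exactly,
  each completion has such a factorisation for one of finitely many choices of pivot rows. Unions
  over these choices, over the entries and over the finitely many sampling patterns keep the
  exceptional set of \<open>U\<close> null and independent of the sample. The special point may be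
  chosen separately for each choice of pivot rows. Its coefficients are taken to be unit vectors, so
  that a group of columns concerns a single basis vector, and its bases have to satisfy several open
  conditions together; each is realised on its own and they are joined along lines.\<close>

lemma underdetermined_kernel:
  fixes T :: "'j \<Rightarrow> 'i \<Rightarrow> real"
  assumes "finite J" "finite I" "card J < card I"
  shows "\<exists>z. (\<exists>i\<in>I. z i \<noteq> 0) \<and> (\<forall>j\<in>J. (\<Sum>i\<in>I. T j i * z i) = 0)"
  using assms
proof (induction J arbitrary: I T rule: finite_induct)
  case empty
  then have "I \<noteq> {}" by auto
  then show ?case by (intro exI[of _ "\<lambda>_. 1"]) auto
next
  case (insert j J)
  show ?case
  proof (cases "\<forall>i\<in>I. T j i = 0")
    case True
    have "card J < card I" using insert by simp
    then obtain z where "\<exists>i\<in>I. z i \<noteq> 0" "\<forall>j\<in>J. (\<Sum>i\<in>I. T j i * z i) = 0"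
      using insert.IH[OF \<open>finite I\<close>, of T] by blast
    then show ?thesis using True by (intro exI[of _ z]) auto
  next
    case False
    then obtain i0 where i0: "i0 \<in> I" "T j i0 \<noteq> 0" by blast
    define I' where "I' = I - {i0}"
    \<comment> \<open>Equation \<open>j\<close> is solved for the unknown \<open>i0\<close> and
      substituted into the others; \<open>c\<close> below is the value that it forces on this
      unknown.\<close>
    define T' where "T' = (\<lambda>j' i. T j' i - T j' i0 * T j i / T j i0)"
    have I: "I = insert i0 I'" "i0 \<notin> I'" "finite I'" using i0 insert by (auto simp: I'_def)
    have "card J < card I'" using insert I by simp
    then obtain z where z: "\<exists>i\<in>I'. z i \<noteq> 0" "\<forall>j\<in>J. (\<Sum>i\<in>I'. T' j i * z i) = 0"
      using insert.IH[OF \<open>finite I'\<close>, of T'] by blast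
    define c where "c = - (\<Sum>i\<in>I'. T j i * z i) / T j i0"
    define w where "w = (\<lambda>i. if i = i0 then c else z i)"
    have sum_w: "(\<Sum>i\<in>I. T k i * w i) = T k i0 * c + (\<Sum>i\<in>I'. T k i * z i)" for k
      using I unfolding I(1) by (simp add: w_def) (intro sum.cong, auto)
    have "(\<Sum>i\<in>I. T k i * w i) = 0" if "k \<in> insert j J" for k
    proof (cases "k = j")
      case True
      then show ?thesis unfolding sum_w using i0 by (simp add: c_def)
    next
      case False
      with that have "k \<in> J" by simp
      with z(2) have "(\<Sum>i\<in>I'. T k i * z i) - (\<Sum>i\<in>I'. T k i0 * T j i / T j i0 * z i) = 0"
        by (simp add: T'_def left_diff_distrib sum_subtractf)
      moreover have "(\<Sum>i\<in>I'. T k i0 * T j i / T j i0 * z i) = - T k i0 * c"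
        using i0(2) by (simp add: c_def sum_distrib_left sum_divide_distrib sum_negf mult.assoc)
      ultimately show ?thesis unfolding sum_w by simp
    qed
    moreover have "\<exists>i\<in>I. w i \<noteq> 0" using z(1) I by (auto simp: w_def)
    ultimately show ?thesis by blast
  qed
qed

text \<open>Applied to the coordinate functions \<open>\<lambda>z. z i\<close>, this turns an
  injective system into an explicit left inverse. Only the number of functionals is finite; the
  space of the \<open>z\<close> may be infinite-dimensional.\<close>

lemma functional_in_span:
  fixes T :: "'j \<Rightarrow> ('i \<Rightarrow> real) \<Rightarrow> real" and \<phi> :: "('i \<Rightarrow> real) \<Rightarrow> real"
  assumes "finite J"
    and "\<And>j a z b w. j \<in> J \<Longrightarrow> T j (\<lambda>i. a * z i + b * w i) = a * T j z + b * T j w"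
    and "\<And>a z b w. \<phi> (\<lambda>i. a * z i + b * w i) = a * \<phi> z + b * \<phi> w"
    and "\<And>z. (\<And>j. j \<in> J \<Longrightarrow> T j z = 0) \<Longrightarrow> \<phi> z = 0"
  shows "\<exists>g. \<forall>z. \<phi> z = (\<Sum>j\<in>J. g j * T j z)"
  using assms
proof (induction J arbitrary: \<phi> rule: finite_induct)
  case empty
  then show ?case by auto
next
  case (insert j J)
  show ?case
  proof (cases "\<forall>z. (\<forall>k\<in>J. T k z = 0) \<longrightarrow> T j z = 0")
    case True
    have "\<exists>g. \<forall>z. \<phi> z = (\<Sum>k\<in>J. g k * T k z)"
    proof (rule insert.IH)
      show "T k (\<lambda>i. a * z i + b * w i) = a * T k z + b * T k w" if "k \<in> J" for k a z b w
        using insert.prems(1) that by blast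
      show "\<phi> z = 0" if "\<And>k. k \<in> J \<Longrightarrow> T k z = 0" for z
        using insert.prems(3) that True by blast
    qed (rule insert.prems(2))
    then obtain g where g: "\<forall>z. \<phi> z = (\<Sum>k\<in>J. g k * T k z)" by blast
    have "\<phi> z = (\<Sum>k\<in>insert j J. (g(j := 0)) k * T k z)" for z
      using g insert.hyps by simp (intro sum.cong, auto)
    then show ?thesis by blast
  next
    case False
    then obtain h where h: "\<forall>k\<in>J. T k h = 0" "T j h \<noteq> 0" by blast
    \<comment> \<open>\<open>h\<close> lies in the common kernel of the functionals in
      \<open>J\<close>, so the coefficient of \<open>T j\<close> can be read off at
      \<open>h\<close>; subtracting that multiple of \<open>T j\<close> leaves a functional that
      vanishes on this kernel.\<close>
    define c where "c = \<phi> h / T j h"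
    have lin: "T k (\<lambda>i. a * z i + b * w i) = a * T k z + b * T k w" if "k \<in> insert j J" for k a z b w
      using insert.prems(1) that by blast
    have "\<exists>g. \<forall>z. \<phi> z - c * T j z = (\<Sum>k\<in>J. g k * T k z)"
    proof (rule insert.IH)
      show "T k (\<lambda>i. a * z i + b * w i) = a * T k z + b * T k w" if "k \<in> J" for k a z b w
        using lin that by blast
      show "\<phi> (\<lambda>i. a * z i + b * w i) - c * T j (\<lambda>i. a * z i + b * w i)
            = a * (\<phi> z - c * T j z) + b * (\<phi> w - c * T j w)" for a z b w
        using insert.prems(2)[of a z b w] lin[of j a z b w] by (simp add: algebra_simps)
      fix z assume z: "\<And>k. k \<in> J \<Longrightarrow> T k z = 0"
      define w where "w = (\<lambda>i. 1 * z i + (- T j z / T j h) * h i)"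
      have "T k w = T k z - T j z / T j h * T k h" if "k \<in> insert j J" for k
        using lin[OF that, of 1 z "- T j z / T j h" h] by (simp add: w_def)
      then have "T k w = 0" if "k \<in> insert j J" for k
        using that h z by auto
      then have "\<phi> w = 0" using insert.prems(3) by blast
      moreover have "\<phi> w = \<phi> z + (- T j z / T j h) * \<phi> h"
        using insert.prems(2)[of 1 z "- T j z / T j h" h] by (simp add: w_def)
      ultimately show "\<phi> z - c * T j z = 0" by (simp add: c_def field_simps)
    qed
    then obtain g where g: "\<forall>z. \<phi> z - c * T j z = (\<Sum>k\<in>J. g k * T k z)" by blast
    have "\<phi> z = (\<Sum>k\<in>insert j J. (g(j := c)) k * T k z)" for z
    proof -
      have "(\<Sum>k\<in>J. (g(j := c)) k * T k z) = (\<Sum>k\<in>J. g k * T k z)"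
        using insert.hyps by (intro sum.cong) auto
      then show ?thesis using g[rule_format, of z] insert.hyps by simp
    qed
    then show ?thesis by blast
  qed
qed

text \<open>After an enumeration of \<open>I\<close> these numbers are roots of a characteristic
  polynomial, which is monic and hence nonzero.\<close>

lemma finite_real_eigenvalues:
  fixes K :: "'i \<Rightarrow> 'i \<Rightarrow> real"
  assumes "finite I"
  shows "finite {c. \<exists>z. (\<exists>i\<in>I. z i \<noteq> 0) \<and> (\<forall>i\<in>I. (\<Sum>k\<in>I. K i k * z k) = c * z i)}"
proof -
  obtain \<sigma> where \<sigma>: "bij_betw \<sigma> {0..<card I} I"
    using ex_bij_betw_nat_finite[OF assms] by blast
  define M where "M = mat (card I) (card I) (\<lambda>(a, b). K (\<sigma> a) (\<sigma> b))"
  have M: "M \<in> carrier_mat (card I) (card I)" by (simp add: M_def)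
  have "eigenvalue M c"
    if z: "\<exists>i\<in>I. z i \<noteq> 0" "\<forall>i\<in>I. (\<Sum>k\<in>I. K i k * z k) = c * z i" for c z
  proof -
    define v where "v = vec (card I) (\<lambda>a. z (\<sigma> a))"
    obtain i where i: "i \<in> I" "z i \<noteq> 0" using z(1) by blast
    then obtain a where a: "a < card I" "\<sigma> a = i"
      using \<sigma> unfolding bij_betw_def by (metis atLeastLessThan_iff imageE)
    have "v \<noteq> 0\<^sub>v (card I)"
      using a i by (auto simp: v_def vec_eq_iff)
    moreover have "M *\<^sub>v v = c \<cdot>\<^sub>v v"
    proof (rule eq_vecI)
      fix b assume "b < dim_vec (c \<cdot>\<^sub>v v)"
      then have b: "b < card I" by (simp add: v_def)
      then have "\<sigma> b \<in> I" using \<sigma> unfolding bij_betw_def by auto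
      have "(M *\<^sub>v v) $ b = (\<Sum>a\<in>{0..<card I}. K (\<sigma> b) (\<sigma> a) * z (\<sigma> a))"
        using b by (simp add: M_def v_def scalar_prod_def)
      also have "\<dots> = (\<Sum>k\<in>I. K (\<sigma> b) k * z k)"
        using sum.reindex_bij_betw[OF \<sigma>, of "\<lambda>k. K (\<sigma> b) k * z k"] by simp
      also have "\<dots> = c * z (\<sigma> b)" using z(2) \<open>\<sigma> b \<in> I\<close> by blast
      finally show "(M *\<^sub>v v) $ b = (c \<cdot>\<^sub>v v) $ b" using b by (simp add: v_def)
    qed (simp add: M_def v_def)
    ultimately show ?thesis
      unfolding eigenvalue_def eigenvector_def by (intro exI[of _ v]) (auto simp: v_def M_def)
  qed
  then have "{c. \<exists>z. (\<exists>i\<in>I. z i \<noteq> 0) \<and> (\<forall>i\<in>I. (\<Sum>k\<in>I. K i k * z k) = c * z i)}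
      \<subseteq> {c. poly (char_poly M) c = 0}"
    using eigenvalue_root_char_poly[OF M] by blast
  moreover have "char_poly M \<noteq> 0" using degree_monic_char_poly[OF M] by auto
  ultimately show ?thesis using poly_roots_finite finite_subset by blast
qed

lemma functional_eq_sum_units:
  fixes T :: "('i \<Rightarrow> real) \<Rightarrow> real"
  assumes "finite I"
    and lin: "\<And>a z b w. T (\<lambda>i. a * z i + b * w i) = a * T z + b * T w"
    and local: "\<And>z w. (\<And>i. i \<in> I \<Longrightarrow> z i = w i) \<Longrightarrow> T z = T w"
  shows "T z = (\<Sum>i\<in>I. T (\<lambda>k. if k = i then 1 else 0) * z i)"
proof -
  have zero: "T (\<lambda>_. 0) = 0" using lin[of 0 z 0 z] by simp
  have "T (\<lambda>k. if k \<in> A then z k else 0) = (\<Sum>i\<in>A. T (\<lambda>k. if k = i then 1 else 0) * z i)"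
    if "finite A" for A
    using that
  proof (induction A rule: finite_induct)
    case empty
    show ?case using zero by simp
  next
    case (insert i A)
    have "(\<lambda>k. if k \<in> insert i A then z k else 0)
        = (\<lambda>k. z i * (if k = i then 1 else 0) + 1 * (if k \<in> A then z k else 0))"
      using insert.hyps by auto
    moreover have "T (\<lambda>k. z i * (if k = i then 1 else 0) + 1 * (if k \<in> A then z k else 0))
        = z i * T (\<lambda>k. if k = i then 1 else 0) + 1 * T (\<lambda>k. if k \<in> A then z k else 0)"
      by (rule lin)
    ultimately show ?case using insert by simp
  qed
  from this[OF assms(1)] show ?thesis
    using local[of "\<lambda>k. if k \<in> I then z k else 0" z] by simp
qed

section \<open>Conditions that fail at only finitely many points of a line\<close>

definition line :: "('a \<Rightarrow> real) \<Rightarrow> ('a \<Rightarrow> real) \<Rightarrow> real \<Rightarrow> 'a \<Rightarrow> real" where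
  "line x y t = (\<lambda>i. (1 - t) * x i + t * y i)"

text \<open>A substitute for Zariski openness that only needs polynomials in one variable.\<close>

definition line_open :: "(('a \<Rightarrow> real) \<Rightarrow> bool) \<Rightarrow> bool" where
  "line_open P \<longleftrightarrow> (\<forall>x y. P x \<longrightarrow> finite {t. \<not> P (line x y t)})"

lemma line_swap: "line x y t = line y x (1 - t)"
  by (auto simp: line_def algebra_simps)

lemma line_openD: "line_open P \<Longrightarrow> P x \<Longrightarrow> finite {t. \<not> P (line x y t)}"
  by (simp add: line_open_def)

lemma line_openD':
  assumes "line_open P" "P y" shows "finite {t. \<not> P (line x y t)}"
proof -
  have "{t. \<not> P (line x y t)} = (\<lambda>t. 1 - t) ` {t. \<not> P (line y x t)}"
  proof (intro equalityI subsetI)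
    fix t assume "t \<in> {t. \<not> P (line x y t)}"
    then show "t \<in> (\<lambda>t. 1 - t) ` {t. \<not> P (line y x t)}"
      using line_swap[of x y t] by (intro image_eqI[of _ _ "1 - t"]) auto
  next
    fix t assume "t \<in> (\<lambda>t. 1 - t) ` {t. \<not> P (line y x t)}"
    then show "t \<in> {t. \<not> P (line x y t)}" using line_swap[of x y t] by auto
  qed
  then show ?thesis using line_openD[OF assms] by simp
qed

lemma line_open_True: "line_open (\<lambda>_. True)"
  by (simp add: line_open_def)

lemma line_open_conj:
  assumes "line_open P" "line_open Q" shows "line_open (\<lambda>x. P x \<and> Q x)"
  unfolding line_open_def
proof (intro allI impI)
  fix x y assume "P x \<and> Q x"
  then have "finite ({t. \<not> P (line x y t)} \<union> {t. \<not> Q (line x y t)})"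
    using assms by (simp add: line_open_def)
  then show "finite {t. \<not> (P (line x y t) \<and> Q (line x y t))}"
    by (rule rev_finite_subset) auto
qed

text \<open>On the line from a point good for \<open>P\<close> to a point good for \<open>Q\<close>,
  each condition excludes only finitely many parameters. This takes the place of the irreducibility
  of an affine space when open conditions are intersected.\<close>

lemma line_open_common_point:
  assumes "line_open P" "line_open Q" "P x" "Q y" "x \<in> L" "y \<in> L"
    and L: "\<And>x y t. x \<in> L \<Longrightarrow> y \<in> L \<Longrightarrow> line x y t \<in> L"
  shows "\<exists>z\<in>L. P z \<and> Q z"
proof -
  have "finite ({t. \<not> P (line x y t)} \<union> {t. \<not> Q (line x y t)})"
    using line_openD[OF assms(1,3)] line_openD'[OF assms(2,4)] by simp
  then obtain t where "t \<notin> {t. \<not> P (line x y t)} \<union> {t. \<not> Q (line x y t)}"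
    using ex_new_if_finite[OF infinite_UNIV_char_0] by blast
  then show ?thesis using L[OF assms(5,6)] by blast
qed

lemma line_open_Ball:
  assumes "finite C" "\<And>c. c \<in> C \<Longrightarrow> line_open (P c)"
  shows "line_open (\<lambda>x. \<forall>c\<in>C. P c x)"
  using assms
proof (induction C rule: finite_induct)
  case empty
  then show ?case by (simp add: line_open_True)
next
  case (insert c C)
  then show ?case using line_open_conj[of "P c" "\<lambda>x. \<forall>c\<in>C. P c x"] by auto
qed

lemma line_open_Ball_common_point:
  assumes "finite C" "\<And>c. c \<in> C \<Longrightarrow> line_open (P c)"
    and "\<And>c. c \<in> C \<Longrightarrow> \<exists>x\<in>L. P c x" "L \<noteq> {}"
    and L: "\<And>x y t. x \<in> L \<Longrightarrow> y \<in> L \<Longrightarrow> line x y t \<in> L"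
  shows "\<exists>z\<in>L. \<forall>c\<in>C. P c z"
  using assms(1-4)
proof (induction C rule: finite_induct)
  case empty
  then show ?case by blast
next
  case (insert c C)
  then obtain x y where "x \<in> L" "P c x" "y \<in> L" "\<forall>c\<in>C. P c y" by blast
  then have "\<exists>z\<in>L. P c z \<and> (\<forall>c\<in>C. P c z)"
    using line_open_common_point[of "P c" "\<lambda>x. \<forall>c\<in>C. P c x" x y L] L
      insert.prems(1) line_open_Ball[OF insert.hyps(1), of P] by blast
  then show ?case by blast
qed

text \<open>With a left inverse \<open>G\<close> of \<open>T x\<close>, a kernel vector of \<open>T\<close> at time \<open>t\<close> is an eigenvector of
  \<open>G (T y - T x)\<close> for the eigenvalue \<open>-1/t\<close>.\<close>

lemma line_open_injective:
  fixes T :: "('a \<Rightarrow> real) \<Rightarrow> ('i \<Rightarrow> real) \<Rightarrow> 'j \<Rightarrow> real"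
  assumes fin: "finite I" "finite J"
    and lin: "\<And>x a z b w j. j \<in> J \<Longrightarrow> T x (\<lambda>i. a * z i + b * w i) j = a * T x z j + b * T x w j"
    and local: "\<And>x z w j. j \<in> J \<Longrightarrow> (\<And>i. i \<in> I \<Longrightarrow> z i = w i) \<Longrightarrow> T x z j = T x w j"
    and affine: "\<And>x y t z j. j \<in> J \<Longrightarrow> T (line x y t) z j = (1 - t) * T x z j + t * T y z j"
  shows "line_open (\<lambda>x. \<forall>z. (\<forall>j\<in>J. T x z j = 0) \<longrightarrow> (\<forall>i\<in>I. z i = 0))"
  unfolding line_open_def
proof (intro allI impI)
  fix x y assume inj: "\<forall>z. (\<forall>j\<in>J. T x z j = 0) \<longrightarrow> (\<forall>i\<in>I. z i = 0)"
  have "\<exists>g. \<forall>z. z i = (\<Sum>j\<in>J. g j * T x z j)" if "i \<in> I" for i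
  proof (rule functional_in_span[of J "\<lambda>j z. T x z j" "\<lambda>z. z i"])
    show "z i = 0" if "\<And>j. j \<in> J \<Longrightarrow> T x z j = 0" for z
      using inj that \<open>i \<in> I\<close> by blast
  qed (use fin lin in blast)+
  then obtain G where G: "\<And>i z. i \<in> I \<Longrightarrow> z i = (\<Sum>j\<in>J. G i j * T x z j)" by metis
  define U where "U = (\<lambda>i z. \<Sum>j\<in>J. G i j * (T y z j - T x z j))"
  define K where "K = (\<lambda>i k. U i (\<lambda>l. if l = k then 1 else 0))"
  have K: "U i z = (\<Sum>k\<in>I. K i k * z k)" for i z
    unfolding K_def
  proof (rule functional_eq_sum_units[OF fin(1)])
    show "U i (\<lambda>k. a * z k + b * w k) = a * U i z + b * U i w" for a z b w
      unfolding U_def sum_distrib_left sum.distrib[symmetric]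
    proof (intro sum.cong refl)
      fix j assume "j \<in> J"
      show "G i j * (T y (\<lambda>k. a * z k + b * w k) j - T x (\<lambda>k. a * z k + b * w k) j)
        = a * (G i j * (T y z j - T x z j)) + b * (G i j * (T y w j - T x w j))"
        unfolding lin[OF \<open>j \<in> J\<close>] by (simp add: algebra_simps)
    qed
    show "U i z = U i w" if "\<And>i. i \<in> I \<Longrightarrow> z i = w i" for z w
    proof -
      have "T v z j = T v w j" if "j \<in> J" for v j
        using local[OF that, of z w v] \<open>\<And>i. i \<in> I \<Longrightarrow> z i = w i\<close> by blast
      then show ?thesis unfolding U_def by (intro sum.cong refl) simp
    qed
  qed
  define S where "S = {c. \<exists>z. (\<exists>i\<in>I. z i \<noteq> 0) \<and> (\<forall>i\<in>I. (\<Sum>k\<in>I. K i k * z k) = c * z i)}"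
  have "t \<in> insert 0 ((\<lambda>c. - 1 / c) ` S)"
    if bad: "\<not> (\<forall>z. (\<forall>j\<in>J. T (line x y t) z j = 0) \<longrightarrow> (\<forall>i\<in>I. z i = 0))" for t
  proof (cases "t = 0")
    case False
    obtain z i where z: "\<forall>j\<in>J. T (line x y t) z j = 0" "i \<in> I" "z i \<noteq> 0" using bad by blast
    have "U k z = (- 1 / t) * z k" if "k \<in> I" for k
    proof -
      have "t * (T y z j - T x z j) = - T x z j" if "j \<in> J" for j
        using z(1) that affine[OF that, of x y t z] by (auto simp: algebra_simps)
      then have "T y z j - T x z j = (- 1 / t) * T x z j" if "j \<in> J" for j
        using that False by (simp add: field_simps)
      then have "U k z = (\<Sum>j\<in>J. (- 1 / t) * (G k j * T x z j))"
        unfolding U_def by (intro sum.cong) auto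
      also have "\<dots> = (- 1 / t) * (\<Sum>j\<in>J. G k j * T x z j)" by (simp only: sum_distrib_left)
      finally show ?thesis using G[OF that, of z] by simp
    qed
    then have "- 1 / t \<in> S" using z(2,3) unfolding S_def K by blast
    then show ?thesis using False by (auto simp: image_iff intro!: bexI[of _ "- 1 / t"])
  qed auto
  then have "{t. \<not> (\<forall>z. (\<forall>j\<in>J. T (line x y t) z j = 0) \<longrightarrow> (\<forall>i\<in>I. z i = 0))}
      \<subseteq> insert 0 ((\<lambda>c. - 1 / c) ` S)" by blast
  moreover have "finite S" unfolding S_def by (rule finite_real_eigenvalues[OF fin(1)])
  ultimately show "finite {t. \<not> (\<forall>z. (\<forall>j\<in>J. T (line x y t) z j = 0) \<longrightarrow> (\<forall>i\<in>I. z i = 0))}"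
    by (meson finite_imageI finite_insert finite_subset)
qed

section \<open>Polynomial functions in several variables\<close>

text \<open>Exponents are extensional functions, so that every monomial is encoded exactly once;
  both the counting of monomials and their independence rely on this.\<close>

definition exps :: "'a set \<Rightarrow> nat \<Rightarrow> ('a \<Rightarrow> nat) set" where
  "exps I d = PiE I (\<lambda>_. {..d})"

definition monom_fun :: "'a set \<Rightarrow> ('a \<Rightarrow> nat) \<Rightarrow> ('a \<Rightarrow> real) \<Rightarrow> real" where
  "monom_fun I e x = (\<Prod>i\<in>I. x i ^ e i)"

text \<open>\<open>d\<close> bounds the degree in each variable separately.\<close>

definition mpoly_deg :: "'a set \<Rightarrow> nat \<Rightarrow> (('a \<Rightarrow> real) \<Rightarrow> real) \<Rightarrow> bool" where
  "mpoly_deg I d f \<longleftrightarrow> (\<exists>b. \<forall>x. f x = (\<Sum>e\<in>exps I d. b e * monom_fun I e x))"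

definition mpoly :: "'a set \<Rightarrow> (('a \<Rightarrow> real) \<Rightarrow> real) \<Rightarrow> bool" where
  "mpoly I f \<longleftrightarrow> (\<exists>d. mpoly_deg I d f)"

lemma finite_exps: "finite I \<Longrightarrow> finite (exps I d)"
  by (simp add: exps_def finite_PiE)

lemma card_exps: "finite I \<Longrightarrow> card (exps I d) = Suc d ^ card I"
  by (simp add: exps_def card_PiE)

lemma exps_mono: "d \<le> d' \<Longrightarrow> exps I d \<subseteq> exps I d'"
  unfolding exps_def by (rule PiE_mono) auto

lemma mpoly_deg_mono:
  assumes "finite I" "mpoly_deg I d f" "d \<le> d'" shows "mpoly_deg I d' f"
proof -
  obtain b where b: "\<And>x. f x = (\<Sum>e\<in>exps I d. b e * monom_fun I e x)"
    using assms(2) by (auto simp: mpoly_deg_def)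
  have "f x = (\<Sum>e\<in>exps I d'. (if e \<in> exps I d then b e else 0) * monom_fun I e x)" for x
    unfolding b using exps_mono[OF assms(3), of I] finite_exps[OF assms(1), of d']
    by (intro sum.mono_neutral_cong_left) auto
  then show ?thesis unfolding mpoly_deg_def
    by (intro exI[of _ "\<lambda>e. if e \<in> exps I d then b e else 0"]) simp
qed

lemma mpoly_deg_add:
  assumes "mpoly_deg I d f" "mpoly_deg I d g" shows "mpoly_deg I d (\<lambda>x. f x + g x)"
proof -
  obtain b c where "\<And>x. f x = (\<Sum>e\<in>exps I d. b e * monom_fun I e x)"
      "\<And>x. g x = (\<Sum>e\<in>exps I d. c e * monom_fun I e x)"
    using assms by (auto simp: mpoly_deg_def)
  then have "f x + g x = (\<Sum>e\<in>exps I d. (b e + c e) * monom_fun I e x)" for x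
    by (simp add: distrib_right sum.distrib)
  then show ?thesis unfolding mpoly_deg_def by (intro exI[of _ "\<lambda>e. b e + c e"]) simp
qed

lemma mpoly_deg_cmult:
  assumes "mpoly_deg I d f" shows "mpoly_deg I d (\<lambda>x. c * f x)"
proof -
  obtain b where "\<And>x. f x = (\<Sum>e\<in>exps I d. b e * monom_fun I e x)"
    using assms by (auto simp: mpoly_deg_def)
  then have "c * f x = (\<Sum>e\<in>exps I d. (c * b e) * monom_fun I e x)" for x
    by (simp add: sum_distrib_left mult.assoc)
  then show ?thesis unfolding mpoly_deg_def by (intro exI[of _ "\<lambda>e. c * b e"]) simp
qed

lemma mpoly_deg_monom:
  assumes "finite I" "e \<in> exps I d" shows "mpoly_deg I d (monom_fun I e)"
  unfolding mpoly_deg_def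
proof (intro exI allI)
  fix x :: "'a \<Rightarrow> real"
  show "monom_fun I e x = (\<Sum>e'\<in>exps I d. (if e' = e then 1 else 0) * monom_fun I e' x)"
    using assms finite_exps[OF assms(1), of d]
    by (simp add: if_distrib[where f = "\<lambda>c. c * _"] sum.delta cong: if_cong)
qed

lemma mpoly_deg_const:
  assumes "finite I" shows "mpoly_deg I d (\<lambda>_. c)"
proof -
  have "(\<lambda>i\<in>I. 0) \<in> exps I d" by (auto simp: exps_def)
  from mpoly_deg_cmult[OF mpoly_deg_monom[OF assms this], of c]
  show ?thesis by (simp add: monom_fun_def)
qed

lemma mpoly_deg_var:
  assumes "finite I" "i \<in> I" "1 \<le> d" shows "mpoly_deg I d (\<lambda>x. x i)"
proof -
  have "(\<lambda>k\<in>I. if k = i then 1 else 0) \<in> exps I d" using assms by (auto simp: exps_def)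
  note mpoly_deg_monom[OF assms(1) this]
  moreover have "monom_fun I (\<lambda>k\<in>I. if k = i then 1 else 0) = (\<lambda>x. x i)"
  proof
    fix x :: "'a \<Rightarrow> real"
    have "monom_fun I (\<lambda>k\<in>I. if k = i then 1 else 0) x = (\<Prod>k\<in>I. if k = i then x k else 1)"
      unfolding monom_fun_def by (intro prod.cong) auto
    then show "monom_fun I (\<lambda>k\<in>I. if k = i then 1 else 0) x = x i" using assms by (simp add: prod.delta)
  qed
  ultimately show ?thesis by simp
qed

lemma mpoly_deg_sum:
  assumes "finite I" "finite S" "\<And>s. s \<in> S \<Longrightarrow> mpoly_deg I d (f s)"
  shows "mpoly_deg I d (\<lambda>x. \<Sum>s\<in>S. f s x)"
  using assms(2,3)
  by (induction S rule: finite_induct) (auto simp: mpoly_deg_const[OF assms(1)] intro!: mpoly_deg_add)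

lemma mpoly_deg_mult:
  assumes "finite I" "mpoly_deg I d f" "mpoly_deg I d' g"
  shows "mpoly_deg I (d + d') (\<lambda>x. f x * g x)"
proof -
  obtain b c where bc: "\<And>x. f x = (\<Sum>e\<in>exps I d. b e * monom_fun I e x)"
      "\<And>x. g x = (\<Sum>e\<in>exps I d'. c e * monom_fun I e x)"
    using assms by (auto simp: mpoly_deg_def)
  have mm: "monom_fun I e x * monom_fun I e' x = monom_fun I (\<lambda>i\<in>I. e i + e' i) x" for e e' x
    by (simp add: monom_fun_def power_add prod.distrib)
  have eq: "f x * g x
      = (\<Sum>e\<in>exps I d. \<Sum>e'\<in>exps I d'. (b e * c e') * monom_fun I (\<lambda>i\<in>I. e i + e' i) x)" for x
    unfolding bc sum_product by (simp add: mm[symmetric] mult_ac)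
  show ?thesis unfolding eq
  proof (intro mpoly_deg_sum mpoly_deg_cmult mpoly_deg_monom finite_exps assms(1))
    fix e e' assume "e \<in> exps I d" "e' \<in> exps I d'"
    then show "(\<lambda>i\<in>I. e i + e' i) \<in> exps I (d + d')"
      unfolding exps_def by (auto simp: PiE_iff intro!: add_mono)
  qed
qed

lemma mpoly_deg_power:
  assumes "finite I" "mpoly_deg I d f" shows "mpoly_deg I (k * d) (\<lambda>x. f x ^ k)"
  by (induction k) (use mpoly_deg_mult[OF assms] mpoly_deg_const[OF assms(1)] in auto)

lemma mpoly_deg_prod:
  assumes "finite I" "finite S" "\<And>s. s \<in> S \<Longrightarrow> mpoly_deg I d (f s)"
  shows "mpoly_deg I (card S * d) (\<lambda>x. \<Prod>s\<in>S. f s x)"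
  using assms(2,3)
proof (induction S rule: finite_induct)
  case empty
  then show ?case by (simp add: mpoly_deg_const[OF assms(1)])
next
  case (insert s S)
  then show ?case using mpoly_deg_mult[OF assms(1), of d "f s" "card S * d"] by simp
qed

lemma mpoly_const [simp]: "finite I \<Longrightarrow> mpoly I (\<lambda>_. c)"
  using mpoly_deg_const mpoly_def by blast

lemma mpoly_var: "finite I \<Longrightarrow> i \<in> I \<Longrightarrow> mpoly I (\<lambda>x. x i)"
  using mpoly_deg_var[of I i 1] mpoly_def by blast

lemma mpoly_add:
  assumes "finite I" "mpoly I f" "mpoly I g" shows "mpoly I (\<lambda>x. f x + g x)"
proof -
  obtain d d' where "mpoly_deg I d f" "mpoly_deg I d' g" using assms by (auto simp: mpoly_def)
  then have "mpoly_deg I (max d d') f" "mpoly_deg I (max d d') g"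
    using mpoly_deg_mono[OF assms(1)] by (meson max.cobounded1 max.cobounded2)+
  then show ?thesis using mpoly_deg_add mpoly_def by blast
qed

lemma mpoly_mult:
  assumes "finite I" "mpoly I f" "mpoly I g" shows "mpoly I (\<lambda>x. f x * g x)"
  using assms mpoly_deg_mult[OF assms(1)] unfolding mpoly_def by blast

lemma mpoly_power:
  assumes "finite I" "mpoly I f" shows "mpoly I (\<lambda>x. f x ^ k)"
  using assms mpoly_deg_power[OF assms(1)] unfolding mpoly_def by blast

lemma mpoly_sum:
  assumes "finite I" "finite S" "\<And>s. s \<in> S \<Longrightarrow> mpoly I (f s)"
  shows "mpoly I (\<lambda>x. \<Sum>s\<in>S. f s x)"
  using assms(2,3) by (induction S rule: finite_induct) (auto simp: assms(1) intro!: mpoly_add)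

lemma mpoly_prod:
  assumes "finite I" "finite S" "\<And>s. s \<in> S \<Longrightarrow> mpoly I (f s)"
  shows "mpoly I (\<lambda>x. \<Prod>s\<in>S. f s x)"
  using assms(2,3) by (induction S rule: finite_induct) (auto simp: assms(1) intro!: mpoly_mult)

lemma mpoly_diff:
  assumes "finite I" "mpoly I f" "mpoly I g" shows "mpoly I (\<lambda>x. f x - g x)"
proof -
  have "mpoly I (\<lambda>x. f x + (- 1) * g x)"
    by (intro mpoly_add mpoly_mult assms mpoly_const)
  then show ?thesis by simp
qed

text \<open>The inductions on the number of variables single out \<open>x i\<close> and read the
  rest as coefficients of a polynomial in \<open>x i\<close>; these coefficients do not depend on
  \<open>x i\<close>.\<close>

lemma sum_exps_insert:
  assumes "finite I" "i \<notin> I"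
  shows "(\<Sum>e\<in>exps (insert i I) d. b e * monom_fun (insert i I) e x)
    = (\<Sum>k\<le>d. (\<Sum>e\<in>exps I d. b (e(i := k)) * monom_fun I e x) * x i ^ k)"
proof -
  have "(\<Sum>e\<in>exps (insert i I) d. b e * monom_fun (insert i I) e x)
      = (\<Sum>(k, e)\<in>{..d} \<times> exps I d. b (e(i := k)) * monom_fun (insert i I) (e(i := k)) x)"
    unfolding exps_def PiE_insert_eq
    by (subst sum.reindex[OF inj_combinator[OF assms(2)]]) (simp add: case_prod_unfold)
  also have "\<dots> = (\<Sum>k\<le>d. \<Sum>e\<in>exps I d. b (e(i := k)) * monom_fun I e x * x i ^ k)"
  proof (subst sum.cartesian_product[symmetric], intro sum.cong refl)
    fix k e
    have "monom_fun (insert i I) (e(i := k)) x = x i ^ k * (\<Prod>j\<in>I. x j ^ (e(i := k)) j)"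
      using assms by (simp add: monom_fun_def)
    also have "(\<Prod>j\<in>I. x j ^ (e(i := k)) j) = monom_fun I e x"
      unfolding monom_fun_def using assms by (intro prod.cong) auto
    finally show "b (e(i := k)) * monom_fun (insert i I) (e(i := k)) x
        = b (e(i := k)) * monom_fun I e x * x i ^ k" by (simp only: mult_ac)
  qed
  finally show ?thesis by (simp add: sum_distrib_right)
qed

lemma monom_fun_update: "i \<notin> I \<Longrightarrow> monom_fun I e (x(i := y)) = monom_fun I e x"
  unfolding monom_fun_def by (intro prod.cong) auto

lemma real_polynomial_roots_finite:
  fixes c :: "nat \<Rightarrow> real"
  assumes "\<exists>k\<le>d. c k \<noteq> 0" shows "finite {y. (\<Sum>k\<le>d. c k * y ^ k) = 0}"
  using assms polyfun_finite_roots by blast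

text \<open>With the other variables frozen, a polynomial in \<open>x i\<close> that vanishes on all
  reals has zero coefficients; these are polynomial functions of fewer variables, to which the
  induction applies.\<close>

lemma monom_fun_independent:
  assumes "finite I" "\<And>x. (\<Sum>e\<in>exps I d. b e * monom_fun I e x) = 0" "e \<in> exps I d"
  shows "b e = 0"
  using assms
proof (induction I arbitrary: b e rule: finite_induct)
  case empty
  then show ?case by (simp add: exps_def monom_fun_def)
next
  case (insert i I)
  have coeff: "(\<Sum>e\<in>exps I d. b (e(i := k)) * monom_fun I e x) = 0" if "k \<le> d" for k x
  proof (rule ccontr)
    assume "\<not> ?thesis"
    then have "finite {y. (\<Sum>k\<le>d. (\<Sum>e\<in>exps I d. b (e(i := k)) * monom_fun I e x) * y ^ k) = 0}"
      using that by (intro real_polynomial_roots_finite) blast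
    moreover have "(\<Sum>k\<le>d. (\<Sum>e\<in>exps I d. b (e(i := k)) * monom_fun I e x) * y ^ k) = 0" for y
      using insert.prems(1)[of "x(i := y)"]
      unfolding sum_exps_insert[OF insert.hyps] monom_fun_update[OF insert.hyps(2)] fun_upd_same .
    ultimately show False using infinite_UNIV_char_0[where 'a = real] by simp
  qed
  obtain k e' where "k \<le> d" "e' \<in> exps I d" "e = e'(i := k)"
    using insert.prems(2) unfolding exps_def PiE_insert_eq by auto
  then show ?case using insert.IH[of "\<lambda>e. b (e(i := k))" e'] coeff by (simp only:)
qed

lemma mpoly_measurable:
  assumes "finite I" "mpoly I f"
  shows "f \<in> borel_measurable (PiM I (\<lambda>_. lborel))"
proof -
  obtain d b where "\<And>x. f x = (\<Sum>e\<in>exps I d. b e * monom_fun I e x)"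
    using assms by (auto simp: mpoly_def mpoly_deg_def)
  then have "f = (\<lambda>x. \<Sum>e\<in>exps I d. b e * monom_fun I e x)" by auto
  moreover have "(\<lambda>x. monom_fun I e x) \<in> borel_measurable (PiM I (\<lambda>_. lborel))" for e
    unfolding monom_fun_def by measurable
  ultimately show ?thesis by simp
qed

text \<open>Fubini: some coefficient with respect to \<open>x i\<close> is nonzero at
  \<open>x0\<close>, hence by induction nonzero almost everywhere, and wherever it is nonzero the
  slice of the zero set in direction \<open>i\<close> is finite.\<close>

lemma mpoly_zero_set_null:
  assumes "finite I" "mpoly I f" "f x0 \<noteq> 0"
  shows "{x \<in> space (PiM I (\<lambda>_. lborel)). f x = 0} \<in> null_sets (PiM I (\<lambda>_. lborel))"
  using assms
proof (induction I arbitrary: f x0 rule: finite_induct)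
  case empty
  then obtain d b where "\<And>x. f x = (\<Sum>e\<in>exps {} d. b e * monom_fun {} e x)"
    by (auto simp: mpoly_def mpoly_deg_def)
  then have const: "f x = f x0" for x by (simp add: exps_def monom_fun_def)
  have "f x \<noteq> 0" for x using const[of x] empty.prems(2) by linarith
  then have "{x \<in> space (PiM {} (\<lambda>_. lborel)). f x = 0} = {}" by blast
  then show ?case by (simp only: null_sets.empty_sets)
next
  case (insert i I)
  interpret product_sigma_finite "\<lambda>_::'a. lborel :: real measure"
    by (simp add: product_sigma_finite_def sigma_finite_lborel)
  let ?M = "PiM (insert i I) (\<lambda>_. lborel :: real measure)" and ?N = "PiM I (\<lambda>_. lborel :: real measure)"
  obtain d b where f: "\<And>x. f x = (\<Sum>e\<in>exps (insert i I) d. b e * monom_fun (insert i I) e x)"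
    using insert.prems by (auto simp: mpoly_def mpoly_deg_def)
  define c where "c = (\<lambda>k x. \<Sum>e\<in>exps I d. b (e(i := k)) * monom_fun I e x)"
  have fc: "f x = (\<Sum>k\<le>d. c k x * x i ^ k)" for x
    unfolding f c_def sum_exps_insert[OF insert.hyps] ..
  have c_upd: "c k (x(i := y)) = c k x" for k x y
    unfolding c_def using insert.hyps by (simp add: monom_fun_update)
  obtain k where k: "k \<le> d" "c k x0 \<noteq> 0"
    using insert.prems(2) fc[of x0] by (metis (no_types, lifting) atMost_iff mult_zero_left sum.neutral)
  have "mpoly I (c k)"
    unfolding mpoly_def mpoly_deg_def c_def by (intro exI[of _ d] exI[of _ "\<lambda>e. b (e(i := k))"]) simp
  from insert.IH[OF this k(2)]
  have ae: "AE x in ?N. c k x \<noteq> 0"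
    by (rule AE_mp[OF AE_not_in]) (auto intro!: AE_I2)
  let ?Z = "{x \<in> space ?M. f x = 0}"
  have [measurable]: "f \<in> borel_measurable ?M"
    using mpoly_measurable[of "insert i I" f] insert by simp
  have Z: "?Z \<in> sets ?M" by measurable
  have "emeasure ?M ?Z = (\<integral>\<^sup>+ x. indicator ?Z x \<partial>?M)" using Z by simp
  also have "\<dots> = (\<integral>\<^sup>+ x. (\<integral>\<^sup>+ y. indicator ?Z (x(i := y)) \<partial>lborel) \<partial>?N)"
    using Z insert.hyps by (intro product_nn_integral_insert) auto
  also have "\<dots> = (\<integral>\<^sup>+ x. 0 \<partial>?N)"
  proof (rule nn_integral_cong_AE, use ae in eventually_elim)
    fix x assume "c k x \<noteq> 0"
    then have "finite {y. (\<Sum>k\<le>d. c k x * y ^ k) = 0}"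
      using k(1) by (intro real_polynomial_roots_finite) blast
    moreover have "f (x(i := y)) = (\<Sum>k\<le>d. c k x * y ^ k)" for y
      unfolding fc c_upd by simp
    ultimately have fin: "finite {y. f (x(i := y)) = 0}" by simp
    then have "AE y in lborel. y \<notin> {y. f (x(i := y)) = 0}"
      by (intro AE_not_in finite_imp_null_set_lborel)
    then have "(\<integral>\<^sup>+ y. indicator ?Z (x(i := y)) \<partial>lborel) = (\<integral>\<^sup>+ y. 0 \<partial>(lborel :: real measure))"
      by (intro nn_integral_cong_AE) (auto simp: indicator_def)
    then show "(\<integral>\<^sup>+ y. indicator ?Z (x(i := y)) \<partial>lborel) = 0" by simp
  qed
  finally show ?case using Z by (simp add: null_sets_def)
qed

section \<open>Algebraic dependence\<close>

text \<open>Comparing the parts of lowest degree.\<close>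

lemma near_identity_independent:
  fixes Q :: "'a \<Rightarrow> ('a \<Rightarrow> real) \<Rightarrow> real"
  assumes "finite I"
    and Q: "\<And>i h t. i \<in> I \<Longrightarrow> Q i (\<lambda>k. t * h k) = t\<^sup>2 * Q i h"
    and zero: "\<And>h. (\<Sum>e\<in>exps I d. b e * monom_fun I e (\<lambda>i. h i + Q i h)) = 0"
    and "e0 \<in> exps I d"
  shows "b e0 = 0"
proof (rule ccontr)
  assume "b e0 \<noteq> 0"
  define deg where "deg = (\<lambda>e :: 'a \<Rightarrow> nat. \<Sum>i\<in>I. e i)"
  define S where "S = {e \<in> exps I d. b e \<noteq> 0}"
  have S: "finite S" "S \<noteq> {}"
    using finite_exps[OF assms(1)] assms(4) \<open>b e0 \<noteq> 0\<close> by (auto simp: S_def)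
  define m where "m = Min (deg ` S)"
  have "m \<in> deg ` S" unfolding m_def using S by (intro Min_in) auto
  then obtain e1 where e1: "e1 \<in> exps I d" "b e1 \<noteq> 0" "deg e1 = m" by (auto simp: S_def)
  have m_le: "m \<le> deg e" if "e \<in> exps I d" "b e \<noteq> 0" for e
    unfolding m_def using S that by (intro Min_le) (auto simp: S_def)
  have "(\<Sum>e\<in>exps I d. (if deg e = m then b e else 0) * monom_fun I e h) = 0" for h
  proof -
    \<comment> \<open>The assumed identity at \<open>t * h\<close>, divided by \<open>t ^ m\<close>.
      The truncated subtraction \<open>deg e - m\<close> is harmless because \<open>m\<close> is the
      least degree with a nonzero coefficient. At \<open>t = 0\<close> only the terms of degree
      \<open>m\<close> survive, and the quadratic correction disappears from them.\<close>
    define \<phi> where "\<phi> = (\<lambda>t. \<Sum>e\<in>exps I d. b e * t ^ (deg e - m) * monom_fun I e (\<lambda>i. h i + t * Q i h))"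
    have scale: "t ^ m * (b e * t ^ (deg e - m) * monom_fun I e (\<lambda>i. h i + t * Q i h))
        = b e * monom_fun I e (\<lambda>i. t * h i + Q i (\<lambda>k. t * h k))" if "e \<in> exps I d" for e t
    proof (cases "b e = 0")
      case False
      have "monom_fun I e (\<lambda>i. t * h i + Q i (\<lambda>k. t * h k)) = (\<Prod>i\<in>I. (t * (h i + t * Q i h)) ^ e i)"
        unfolding monom_fun_def by (intro prod.cong refl) (simp add: Q power2_eq_square algebra_simps)
      also have "\<dots> = t ^ deg e * monom_fun I e (\<lambda>i. h i + t * Q i h)"
        by (simp add: monom_fun_def deg_def power_mult_distrib prod.distrib power_sum)
      finally show ?thesis
        using m_le[OF that False] by (simp add: power_add[symmetric] mult_ac)
    qed simp
    have "\<phi> t = 0" if "t \<noteq> 0" for t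
    proof -
      have "t ^ m * \<phi> t = (\<Sum>e\<in>exps I d. b e * monom_fun I e (\<lambda>i. t * h i + Q i (\<lambda>k. t * h k)))"
        unfolding \<phi>_def sum_distrib_left using scale by (intro sum.cong) auto
      also have "\<dots> = 0" using zero[of "\<lambda>k. t * h k"] by simp
      finally show ?thesis using that by simp
    qed
    \<comment> \<open>The division was legitimate for nonzero \<open>t\<close> only; continuity
      carries the conclusion to \<open>t = 0\<close>.\<close>
    then have "(\<phi> \<longlongrightarrow> 0) (at 0)"
      by (intro tendsto_eventually) (auto simp: eventually_at_filter)
    moreover have "isCont \<phi> 0" unfolding \<phi>_def monom_fun_def by (intro continuous_intros)
    then have "(\<phi> \<longlongrightarrow> \<phi> 0) (at 0)" by (simp add: isCont_def)
    ultimately have "\<phi> 0 = 0" using tendsto_unique[of "at (0::real)"] by (metis trivial_limit_at)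
    moreover have "\<phi> 0 = (\<Sum>e\<in>exps I d. (if deg e = m then b e else 0) * monom_fun I e h)"
      unfolding \<phi>_def
    proof (intro sum.cong refl)
      fix e assume "e \<in> exps I d"
      then show "b e * 0 ^ (deg e - m) * monom_fun I e (\<lambda>i. h i + 0 * Q i h)
          = (if deg e = m then b e else 0) * monom_fun I e h"
        using m_le[of e] by (cases "b e = 0") (auto simp: power_0_left)
    qed
    ultimately show ?thesis by simp
  qed
  from monom_fun_independent[OF assms(1) this e1(1)] show False using e1 by simp
qed

text \<open>With exponents up to \<open>K\<close> there are \<open>(K+1)^(card I + 1)\<close> products of powers of \<open>g\<close> and of the
  \<open>card I\<close> combinations of the \<open>f v\<close> with identity Jacobian, more than the dimension of the space of
  polynomials that contains them; so they are linearly dependent.\<close>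

lemma algebraic_relation:
  fixes f J q :: "'o \<Rightarrow> ('a \<Rightarrow> real) \<Rightarrow> real"
  assumes fin: "finite I" "finite Obs"
    and f_deg: "\<And>v. v \<in> Obs \<Longrightarrow> mpoly_deg I 2 (f v)"
    and f_exp: "\<And>v h. v \<in> Obs \<Longrightarrow> f v h = f v (\<lambda>_. 0) + J v h + q v h"
    and quad: "\<And>v h t. v \<in> Obs \<Longrightarrow> q v (\<lambda>k. t * h k) = t\<^sup>2 * q v h"
    and lin: "\<And>v a z b w. v \<in> Obs \<Longrightarrow> J v (\<lambda>i. a * z i + b * w i) = a * J v z + b * J v w"
    and inj: "\<And>h i. (\<And>v. v \<in> Obs \<Longrightarrow> J v h = 0) \<Longrightarrow> i \<in> I \<Longrightarrow> h i = 0"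
    and g: "mpoly_deg I 2 g"
  shows "\<exists>K C. (\<forall>k\<le>K. mpoly Obs (C k)) \<and>
      (\<forall>h. (\<Sum>k\<le>K. C k (\<lambda>v. f v h) * g h ^ k) = 0) \<and> (\<exists>k\<le>K. \<exists>h. C k (\<lambda>v. f v h) \<noteq> 0)"
proof -
  have "\<exists>G. \<forall>h. h i = (\<Sum>v\<in>Obs. G v * J v h)" if "i \<in> I" for i
  proof (rule functional_in_span[of Obs J "\<lambda>h. h i"])
    show "h i = 0" if "\<And>v. v \<in> Obs \<Longrightarrow> J v h = 0" for h using inj that \<open>i \<in> I\<close> by blast
  qed (use fin lin in blast)+
  then obtain G where G: "\<And>i h. i \<in> I \<Longrightarrow> h i = (\<Sum>v\<in>Obs. G i v * J v h)" by metis
  \<comment> \<open>\<open>G\<close> is a left inverse of the linear part \<open>J\<close>; applied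
    to the increments of the \<open>f v\<close> it gives \<open>F\<close>, whose expansion at the
    origin starts with the identity. \<open>L\<close> is the same combination for arbitrary observed
    values \<open>y\<close>, which makes \<open>C\<close> below a polynomial in them.\<close>
  define L where "L = (\<lambda>i y. \<Sum>v\<in>Obs. G i v * (y v - f v (\<lambda>_. 0)))"
  define Q where "Q = (\<lambda>i h. \<Sum>v\<in>Obs. G i v * q v h)"
  define F where "F = (\<lambda>h i. L i (\<lambda>v. f v h))"
  have F: "F h i = h i + Q i h" if "i \<in> I" for h i
  proof -
    have "F h i = (\<Sum>v\<in>Obs. G i v * J v h + G i v * q v h)"
      unfolding F_def L_def
    proof (intro sum.cong refl)
      fix v assume "v \<in> Obs"
      from f_exp[OF this, of h]
      show "G i v * (f v h - f v (\<lambda>_. 0)) = G i v * J v h + G i v * q v h"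
        by (simp add: algebra_simps)
    qed
    then show ?thesis using G[OF that, of h] by (simp add: sum.distrib Q_def)
  qed
  have Q: "Q i (\<lambda>k. t * h k) = t\<^sup>2 * Q i h" for i h t
    unfolding Q_def sum_distrib_left by (intro sum.cong) (auto simp: quad)
  have F_deg: "mpoly_deg I 2 (\<lambda>h. F h i)" for i
    unfolding F_def L_def diff_conv_add_uminus
    by (intro mpoly_deg_sum mpoly_deg_cmult mpoly_deg_add f_deg mpoly_deg_const fin)
  define D where "D = card I"
  \<comment> \<open>Chosen to solve the counting inequality:
    \<open>d + 1 \<le> 2 * (D + 1) * (K + 1)\<close>, hence
    \<open>(d + 1) ^ D \<le> K * (K + 1) ^ D < (K + 1) ^ (D + 1)\<close>.\<close>
  define K where "K = (2 * (D + 1)) ^ D"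
  define d where "d = K * 2 + D * (K * 2)"
  have term_deg: "mpoly_deg I d (\<lambda>h. g h ^ k * monom_fun I e (F h))"
    if "k \<le> K" "e \<in> exps I K" for k e
  proof -
    have "mpoly_deg I (K * 2) (\<lambda>h. g h ^ k)"
      using that by (intro mpoly_deg_mono[OF fin(1) mpoly_deg_power[OF fin(1) g]]) simp
    moreover have "mpoly_deg I (D * (K * 2)) (\<lambda>h. monom_fun I e (F h))"
      unfolding monom_fun_def D_def
    proof (intro mpoly_deg_prod fin)
      fix i assume "i \<in> I"
      then have "e i \<le> K" using that by (auto simp: exps_def)
      then show "mpoly_deg I (K * 2) (\<lambda>h. F h i ^ e i)"
        by (intro mpoly_deg_mono[OF fin(1) mpoly_deg_power[OF fin(1) F_deg]]) simp
    qed
    ultimately show ?thesis unfolding d_def by (intro mpoly_deg_mult fin)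
  qed
  define U where "U = {..K} \<times> exps I K"
  have "\<exists>B. \<forall>h. g h ^ fst u * monom_fun I (snd u) (F h) = (\<Sum>e\<in>exps I d. B e * monom_fun I e h)"
    if "u \<in> U" for u
    using term_deg[of "fst u" "snd u"] that by (auto simp: U_def mpoly_deg_def)
  then obtain B where B: "\<And>u h. u \<in> U \<Longrightarrow>
      g h ^ fst u * monom_fun I (snd u) (F h) = (\<Sum>e\<in>exps I d. B u e * monom_fun I e h)" by metis
  have "card (exps I d) < card U"
  proof -
    have "Suc d \<le> 2 * (D + 1) * Suc K" by (simp add: d_def algebra_simps)
    then have "Suc d ^ D \<le> (2 * (D + 1) * Suc K) ^ D" by (rule power_mono) simp
    also have "\<dots> = (2 * (D + 1)) ^ D * Suc K ^ D" by (rule power_mult_distrib)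
    also have "\<dots> = K * Suc K ^ D" by (simp only: K_def)
    also have "\<dots> < Suc K * Suc K ^ D" by simp
    finally show ?thesis by (simp add: U_def card_exps fin D_def card_cartesian_product)
  qed
  then obtain a where a: "\<exists>u\<in>U. a u \<noteq> 0" "\<forall>e\<in>exps I d. (\<Sum>u\<in>U. B u e * a u) = 0"
    using underdetermined_kernel[of "exps I d" U "\<lambda>e u. B u e"] finite_exps[OF fin(1)]
    by (auto simp: U_def)
  define C where "C = (\<lambda>k y. \<Sum>e\<in>exps I K. a (k, e) * monom_fun I e (\<lambda>i. L i y))"
  have C: "C k (\<lambda>v. f v h) = (\<Sum>e\<in>exps I K. a (k, e) * monom_fun I e (F h))" for k h
    by (simp add: C_def F_def)
  have "mpoly Obs (C k)" for k
    unfolding C_def monom_fun_def L_def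
    by (intro mpoly_sum mpoly_mult mpoly_const mpoly_prod mpoly_power mpoly_diff mpoly_var fin finite_exps)
  moreover have "(\<Sum>k\<le>K. C k (\<lambda>v. f v h) * g h ^ k) = 0" for h
  proof -
    have "(\<Sum>k\<le>K. C k (\<lambda>v. f v h) * g h ^ k)
        = (\<Sum>u\<in>U. a u * (g h ^ fst u * monom_fun I (snd u) (F h)))"
      unfolding C U_def sum_distrib_right by (simp add: sum.cartesian_product case_prod_unfold mult_ac)
    also have "\<dots> = (\<Sum>u\<in>U. \<Sum>e\<in>exps I d. B u e * a u * monom_fun I e h)"
      by (intro sum.cong refl) (simp add: B sum_distrib_left mult_ac)
    also have "\<dots> = (\<Sum>e\<in>exps I d. (\<Sum>u\<in>U. B u e * a u) * monom_fun I e h)"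
      unfolding sum_distrib_right by (rule sum.swap)
    also have "\<dots> = 0" using a(2) by (intro sum.neutral) simp
    finally show ?thesis .
  qed
  \<comment> \<open>If all coefficients vanished along \<open>f\<close>, the powers of
    \<open>g\<close> would drop out and leave a relation among the components of \<open>F\<close>
    alone, which the comparison of lowest degrees excludes.\<close>
  moreover have "\<exists>k\<le>K. \<exists>h. C k (\<lambda>v. f v h) \<noteq> 0"
  proof (rule ccontr)
    assume "\<not> ?thesis"
    then have zero: "(\<Sum>e\<in>exps I K. a (k, e) * monom_fun I e (F h)) = 0" if "k \<le> K" for k h
      using that C by auto
    have F': "monom_fun I e (F h) = monom_fun I e (\<lambda>i. h i + Q i h)" for e h
      unfolding monom_fun_def using F by (intro prod.cong) auto
    obtain k e where ke: "k \<le> K" "e \<in> exps I K" "a (k, e) \<noteq> 0" using a(1) by (auto simp: U_def)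
    have "a (k, e) = 0"
      by (rule near_identity_independent[OF fin(1) Q zero[OF ke(1), unfolded F'] ke(2)])
    then show False using ke by simp
  qed
  ultimately show ?thesis by blast
qed

section \<open>Generic subspaces with prescribed supports\<close>

text \<open>The argument of Halmos and Vaughan. A proper nonempty subset with no more neighbours
  than elements is matched on its own, and its neighbours are withdrawn from the rest. Without such
  a subset any single pair can be matched, because every proper nonempty subset has a neighbour to
  spare.\<close>

theorem hall_marriage:
  fixes N :: "'x \<Rightarrow> 'y set"
  assumes "finite X" "\<And>x. x \<in> X \<Longrightarrow> finite (N x)"
    and "\<And>S. S \<subseteq> X \<Longrightarrow> card S \<le> card (\<Union>x\<in>S. N x)"
  shows "\<exists>\<sigma>. inj_on \<sigma> X \<and> (\<forall>x\<in>X. \<sigma> x \<in> N x)"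
  using assms
proof (induction "card X" arbitrary: X N rule: less_induct)
  case (less X N)
  note hall = less.prems(3) and fin = less.prems(1,2)
  have finS: "finite S" if "S \<subseteq> X" for S
    using that fin(1) by (rule finite_subset)
  show ?case
  proof (cases "\<exists>S. S \<subset> X \<and> S \<noteq> {} \<and> card (\<Union>x\<in>S. N x) \<le> card S")
    case True
    then obtain S where S: "S \<subset> X" "S \<noteq> {}" "card (\<Union>x\<in>S. N x) \<le> card S" by blast
    let ?NS = "\<Union>x\<in>S. N x"
    have eq: "card ?NS = card S" using S hall[of S] by auto
    have "card S < card X" using S fin psubset_card_mono by blast
    then have "\<exists>\<sigma>. inj_on \<sigma> S \<and> (\<forall>x\<in>S. \<sigma> x \<in> N x)"
    proof (rule less.hyps)
      show "finite S" using S by (intro finS) blast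
      show "finite (N x)" if "x \<in> S" for x using fin(2) that S by blast
      show "card W \<le> card (\<Union>x\<in>W. N x)" if "W \<subseteq> S" for W using hall[of W] that S by blast
    qed
    then obtain \<sigma> where \<sigma>: "inj_on \<sigma> S" "\<forall>x\<in>S. \<sigma> x \<in> N x" by blast
    have lt: "card (X - S) < card X"
    proof (intro psubset_card_mono fin(1))
      show "X - S \<subset> X" using S by blast
    qed
    have hl: "card W \<le> card (\<Union>x\<in>W. N x - ?NS)" if W: "W \<subseteq> X - S" for W
    proof -
      have "card W + card S = card (W \<union> S)"
      proof (intro card_Un_disjoint[symmetric])
        show "finite W" "finite S" using W S by (auto intro!: finS)
        show "W \<inter> S = {}" using W by blast
      qed
      also have "\<dots> \<le> card (\<Union>x\<in>W \<union> S. N x)" using W S by (intro hall) auto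
      also have "(\<Union>x\<in>W \<union> S. N x) = (\<Union>x\<in>W. N x - ?NS) \<union> ?NS" by auto
      also have "card \<dots> \<le> card (\<Union>x\<in>W. N x - ?NS) + card ?NS" by (rule card_Un_le)
      finally show ?thesis using eq by simp
    qed
    have "\<exists>\<tau>. inj_on \<tau> (X - S) \<and> (\<forall>x\<in>X - S. \<tau> x \<in> N x - ?NS)"
    proof (rule less.hyps[OF lt _ _ hl])
      show "finite (X - S)" using fin(1) by simp
      show "finite (N x - ?NS)" if "x \<in> X - S" for x using fin(2) that by blast
    qed
    then obtain \<tau> where \<tau>: "inj_on \<tau> (X - S)" "\<forall>x\<in>X - S. \<tau> x \<in> N x - ?NS" by blast
    let ?f = "\<lambda>x. if x \<in> S then \<sigma> x else \<tau> x"
    have "inj_on ?f X"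
    proof (rule inj_onI)
      fix x y assume "x \<in> X" "y \<in> X" "?f x = ?f y"
      moreover have "\<sigma> a \<noteq> \<tau> b" if "a \<in> S" "b \<in> X - S" for a b
        using that \<sigma>(2) \<tau>(2) by (metis DiffE UN_I)
      ultimately show "x = y"
        using inj_onD[OF \<sigma>(1)] inj_onD[OF \<tau>(1)] by (simp split: if_splits) metis
    qed
    moreover have "\<forall>x\<in>X. ?f x \<in> N x" using \<sigma> \<tau> by auto
    ultimately show ?thesis by (intro exI[of _ ?f]) blast
  next
    case tight: False
    show ?thesis
    proof (cases "X = {}")
      case False
      then obtain x where x: "x \<in> X" by blast
      then have "1 \<le> card (N x)" using hall[of "{x}"] by simp
      then obtain y where y: "y \<in> N x" by (metis all_not_in_conv card.empty not_one_le_zero)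
      have lt: "card (X - {x}) < card X" by (rule card_Diff1_less[OF fin(1) x])
      have hl: "card W \<le> card (\<Union>z\<in>W. N z - {y})" if W: "W \<subseteq> X - {x}" for W
      proof (cases "W = {}")
        case False
        then have "card W < card (\<Union>z\<in>W. N z)"
        proof -
          have "W \<subset> X" using W x by blast
          then show ?thesis using tight False by (meson not_le)
        qed
        moreover have "card (\<Union>z\<in>W. N z) - 1 \<le> card ((\<Union>z\<in>W. N z) - {y})"
          by (cases "y \<in> (\<Union>z\<in>W. N z)") (auto simp: card_Diff_singleton)
        ultimately have "card W \<le> card ((\<Union>z\<in>W. N z) - {y})" by linarith
        also have "(\<Union>z\<in>W. N z) - {y} = (\<Union>z\<in>W. N z - {y})" by blast
        finally show ?thesis .
      qed simp
      have "\<exists>\<sigma>. inj_on \<sigma> (X - {x}) \<and> (\<forall>z\<in>X - {x}. \<sigma> z \<in> N z - {y})"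
      proof (rule less.hyps[OF lt _ _ hl])
        show "finite (X - {x})" using fin(1) by simp
        show "finite (N z - {y})" if "z \<in> X - {x}" for z using fin(2) that by blast
      qed
      then obtain \<sigma> where \<sigma>: "inj_on \<sigma> (X - {x})" "\<forall>z\<in>X - {x}. \<sigma> z \<in> N z - {y}" by blast
      let ?f = "\<lambda>z. if z = x then y else \<sigma> z"
      have "inj_on ?f X"
      proof (rule inj_onI)
        fix a b assume "a \<in> X" "b \<in> X" "?f a = ?f b"
        moreover have "\<sigma> z \<noteq> y" if "z \<in> X - {x}" for z using \<sigma>(2) that by blast
        ultimately show "a = b"
          using inj_onD[OF \<sigma>(1), of a b] by (cases "a = x"; cases "b = x") auto
      qed
      moreover have "\<forall>z\<in>X. ?f z \<in> N z" using \<sigma>(2) y by simp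
      ultimately show ?thesis by (intro exI[of _ ?f]) blast
    qed auto
  qed
qed

text \<open>Each of the \<open>N\<close> sets is used for two or three rows of an \<open>(n - \<rho>) \<times> n\<close> matrix.\<close>

definition hall_ok :: "nat \<Rightarrow> nat \<Rightarrow> nat \<Rightarrow> (nat \<Rightarrow> nat set) \<Rightarrow> bool" where
  "hall_ok n \<rho> N Om \<longleftrightarrow> (\<forall>S\<subseteq>{..<n}. card S \<le> n - \<rho> \<longrightarrow>
     card S \<le> 2 * card {t \<in> {..<N}. Om t \<inter> S \<noteq> {}} \<or> (\<forall>t<N. Om t \<inter> S \<noteq> {}))"

text \<open>The rows \<open>t\<close> and \<open>t + N\<close> both belong to the set
  \<open>Om t\<close>, which accounts for the factor 2. As \<open>2 * N\<close> may be smaller than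
  \<open>n - \<rho>\<close>, the doubled count cannot serve the largest \<open>S\<close>; for these
  the second alternative of \<open>hall_ok\<close> makes every row available.\<close>

lemma hall_ok_rows:
  assumes ok: "hall_ok n \<rho> N Om" and N: "0 < N" "2 * N \<le> n - \<rho>"
    and S: "S \<subseteq> {..<n}" "card S \<le> n - \<rho>"
  shows "card S \<le> card {b \<in> {..<n - \<rho>}. Om (b mod N) \<inter> S \<noteq> {}}"
proof (cases "\<forall>t<N. Om t \<inter> S \<noteq> {}")
  case True
  then have "{b \<in> {..<n - \<rho>}. Om (b mod N) \<inter> S \<noteq> {}} = {..<n - \<rho>}" using N by auto
  then show ?thesis using S by simp
next
  case False
  let ?H = "{t \<in> {..<N}. Om t \<inter> S \<noteq> {}}"
  have "card S \<le> 2 * card ?H" using ok S False unfolding hall_ok_def by blast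
  also have "\<dots> = card (?H \<union> (\<lambda>t. t + N) ` ?H)"
    by (subst card_Un_disjoint) (auto simp: card_image)
  also have "\<dots> \<le> card {b \<in> {..<n - \<rho>}. Om (b mod N) \<inter> S \<noteq> {}}"
    using N by (intro card_mono) auto
  finally show ?thesis .
qed

text \<open>The conclusion says that deleting any \<open>\<rho>\<close> columns of \<open>B\<close>
  leaves an invertible matrix. For one \<open>R\<close>, a matching of the remaining columns to rows
  that may be nonzero there gives a 0/1 matrix with this property. Invertibility is an open
  condition on the matrices with the given supports, so one \<open>B\<close> serves all of the
  finitely many \<open>R\<close>.\<close>

lemma generic_annihilator:
  assumes ok: "hall_ok n \<rho> N Om" and N: "0 < N" "2 * N \<le> n - \<rho>"
  shows "\<exists>B :: nat \<times> nat \<Rightarrow> real. (\<forall>b i. i \<notin> Om (b mod N) \<longrightarrow> B (b, i) = 0) \<and>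
     (\<forall>R z. R \<subseteq> {..<n} \<longrightarrow> card R = \<rho> \<longrightarrow> (\<forall>b<n - \<rho>. (\<Sum>i<n. B (b, i) * z i) = 0) \<longrightarrow>
        (\<forall>i\<in>R. z i = 0) \<longrightarrow> (\<forall>i<n. z i = 0))"
proof -
  define L where "L = {B :: nat \<times> nat \<Rightarrow> real. \<forall>b i. i \<notin> Om (b mod N) \<longrightarrow> B (b, i) = 0}"
  define T where "T = (\<lambda>R (B :: nat \<times> nat \<Rightarrow> real) z b. \<Sum>i\<in>{..<n} - R. B (b, i) * z i)"
  define C where "C = {R. R \<subseteq> {..<n} \<and> card R = \<rho>}"
  define P where "P = (\<lambda>R B. \<forall>z. (\<forall>b\<in>{..<n - \<rho>}. T R B z b = 0) \<longrightarrow> (\<forall>i\<in>{..<n} - R. z i = 0))"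
  have "\<exists>B\<in>L. \<forall>R\<in>C. P R B"
  proof (rule line_open_Ball_common_point)
    show "finite C" unfolding C_def by (rule finite_subset[of _ "Pow {..<n}"]) auto
    show "L \<noteq> {}" unfolding L_def by (auto intro!: exI[of _ "\<lambda>_. 0"])
    show "line x y t \<in> L" if "x \<in> L" "y \<in> L" for x y t
      using that by (simp add: L_def line_def)
    show "line_open (P R)" for R
      unfolding P_def
    proof (rule line_open_injective)
      show "T R x (\<lambda>i. a * z i + b * w i) j = a * T R x z j + b * T R x w j" for x a z b w j
        unfolding T_def sum_distrib_left sum.distrib[symmetric]
        by (intro sum.cong refl) (simp add: algebra_simps)
      show "T R x z j = T R x w j" if "\<And>i. i \<in> {..<n} - R \<Longrightarrow> z i = w i" for x z w j
        unfolding T_def using that by (intro sum.cong refl) auto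
      show "T R (line x y t) z j = (1 - t) * T R x z j + t * T R y z j" for x y t z j
        unfolding T_def sum_distrib_left sum.distrib[symmetric]
        by (intro sum.cong refl) (simp add: line_def algebra_simps)
    qed auto
    show "\<exists>B\<in>L. P R B" if "R \<in> C" for R
    proof -
      let ?X = "{..<n} - R"
      have R: "R \<subseteq> {..<n}" "card R = \<rho>" using that by (auto simp: C_def)
      have X: "card ?X = n - \<rho>" using R by (simp add: card_Diff_subset finite_subset)
      have "\<exists>\<sigma>. inj_on \<sigma> ?X \<and> (\<forall>i\<in>?X. \<sigma> i \<in> {b \<in> {..<n - \<rho>}. i \<in> Om (b mod N)})"
      proof (rule hall_marriage)
        fix S assume S: "S \<subseteq> ?X"
        then have "card S \<le> n - \<rho>" using X card_mono[of ?X S] by simp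
        then have "card S \<le> card {b \<in> {..<n - \<rho>}. Om (b mod N) \<inter> S \<noteq> {}}"
          using S by (intro hall_ok_rows[OF ok N]) auto
        also have "{b \<in> {..<n - \<rho>}. Om (b mod N) \<inter> S \<noteq> {}}
            = (\<Union>i\<in>S. {b \<in> {..<n - \<rho>}. i \<in> Om (b mod N)})" by auto
        finally show "card S \<le> card (\<Union>i\<in>S. {b \<in> {..<n - \<rho>}. i \<in> Om (b mod N)})" .
      qed auto
      then obtain \<sigma> where \<sigma>: "inj_on \<sigma> ?X" "\<And>i. i \<in> ?X \<Longrightarrow> \<sigma> i < n - \<rho> \<and> i \<in> Om (\<sigma> i mod N)"
        by auto
      define B :: "nat \<times> nat \<Rightarrow> real" where "B = (\<lambda>(b, i). if i \<in> ?X \<and> \<sigma> i = b then 1 else 0)"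
      have "B \<in> L" unfolding L_def B_def using \<sigma>(2) by auto
      moreover have "P R B" unfolding P_def
      proof (intro allI impI ballI)
        fix z i assume z: "\<forall>b\<in>{..<n - \<rho>}. T R B z b = 0" and i: "i \<in> ?X"
        have "T R B z (\<sigma> i) = (\<Sum>k\<in>?X. if k = i then z k else 0)"
          unfolding T_def B_def using i \<sigma>(1) by (intro sum.cong refl) (auto dest: inj_onD)
        also have "\<dots> = z i" using i by simp
        finally show "z i = 0" using z \<sigma>(2)[OF i] by simp
      qed
      ultimately show ?thesis by blast
    qed
  qed
  then obtain B where B: "B \<in> L" "\<And>R. R \<in> C \<Longrightarrow> P R B" by blast
  have "\<forall>i<n. z i = 0"
    if R: "R \<subseteq> {..<n}" "card R = \<rho>" and z: "\<forall>b<n - \<rho>. (\<Sum>i<n. B (b, i) * z i) = 0" "\<forall>i\<in>R. z i = 0"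
    for R z
  proof -
    have "(\<Sum>i<n. B (b, i) * z i) = T R B z b" for b
      unfolding T_def using z(2) by (intro sum.mono_neutral_right) auto
    then have "\<forall>i\<in>{..<n} - R. z i = 0" using B(2)[of R] R z(1) unfolding P_def C_def by simp
    then show ?thesis using z(2) by auto
  qed
  then show ?thesis using B(1) unfolding L_def by blast
qed

text \<open>The columns of \<open>M\<close> are the basis of the kernel of \<open>B\<close> that is
  dual to the rows \<open>rw\<close>. A vector \<open>v\<close> that agrees on every
  \<open>Om t\<close> with some element of the kernel is itself annihilated by \<open>B\<close>,
  because row \<open>b\<close> sees only the entries in \<open>Om (b mod N)\<close>; vanishing at
  the rows \<open>rw\<close> then makes it zero.\<close>

lemma generic_subspace:
  assumes Om: "\<And>t. t < N \<Longrightarrow> Om t \<subseteq> {..<n}" "\<And>t. t < N \<Longrightarrow> \<rho> \<le> card (Om t)"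
    and ok: "hall_ok n \<rho> N Om" and N: "0 < N" "2 * N \<le> n - \<rho>"
    and rows: "inj_on rw {..<\<rho>}" "\<And>k. k < \<rho> \<Longrightarrow> rw k < n"
  shows "\<exists>M :: nat \<Rightarrow> nat \<Rightarrow> real. (\<forall>k<\<rho>. \<forall>k'<\<rho>. M (rw k) k' = (if k = k' then 1 else 0)) \<and>
     (\<forall>v y. (\<forall>k<\<rho>. v (rw k) = 0) \<longrightarrow> (\<forall>t<N. \<forall>i\<in>Om t. v i = (\<Sum>k<\<rho>. M i k * y t k)) \<longrightarrow>
       (\<forall>i<n. v i = 0) \<and> (\<forall>t<N. \<forall>k<\<rho>. y t k = 0))"
proof -
  obtain B :: "nat \<times> nat \<Rightarrow> real" where B': "\<forall>b i. i \<notin> Om (b mod N) \<longrightarrow> B (b, i) = 0"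
     "\<forall>R z. R \<subseteq> {..<n} \<longrightarrow> card R = \<rho> \<longrightarrow> (\<forall>b<n - \<rho>. (\<Sum>i<n. B (b, i) * z i) = 0) \<longrightarrow>
        (\<forall>i\<in>R. z i = 0) \<longrightarrow> (\<forall>i<n. z i = 0)"
    using generic_annihilator[OF ok N] by (elim exE conjE)
  have supp: "B (b, i) = 0" if "i \<notin> Om (b mod N)" for b i
    using B'(1) that by blast
  have B: "\<forall>i<n. z i = 0"
    if "R \<subseteq> {..<n}" "card R = \<rho>" "\<forall>b<n - \<rho>. (\<Sum>i<n. B (b, i) * z i) = 0" "\<forall>i\<in>R. z i = 0" for R z
    using B'(2)[THEN spec, of R, THEN spec, of z] that by (elim impE) assumption+
  define R where "R = rw ` {..<\<rho>}"
  have R: "R \<subseteq> {..<n}" "card R = \<rho>" "finite R"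
    using rows by (auto simp: R_def card_image)
  have "\<exists>a. (\<forall>b<n - \<rho>. (\<Sum>i<n. B (b, i) * a i) = 0) \<and> (\<forall>k'<\<rho>. a (rw k') = (if k' = k then 1 else 0))"
    if k: "k < \<rho>" for k
  proof -
    let ?J = "Inl ` {..<n - \<rho>} \<union> Inr ` (R - {rw k})"
    let ?T = "\<lambda>j i. case j of Inl b \<Rightarrow> B (b, i) | Inr i' \<Rightarrow> if i = i' then 1 else (0::real)"
    have kR: "rw k \<in> R" using k by (simp add: R_def)
    have "card ?J = (n - \<rho>) + card (R - {rw k})"
      using R by (subst card_Un_disjoint) (auto simp: card_image)
    also have "card (R - {rw k}) = \<rho> - 1" using R kR by simp
    \<comment> \<open>One equation fewer than unknowns: \<open>n - \<rho>\<close> from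
      \<open>B\<close> and \<open>\<rho> - 1\<close> from the other normalisation rows.\<close>
    also have "(n - \<rho>) + (\<rho> - 1) < card {..<n}" using k R card_mono[of "{..<n}" R] by simp
    finally obtain z where z: "\<exists>i\<in>{..<n}. z i \<noteq> 0" "\<forall>j\<in>?J. (\<Sum>i<n. ?T j i * z i) = 0"
      using underdetermined_kernel[of ?J "{..<n}" ?T] R by auto
    have z1: "\<forall>b<n - \<rho>. (\<Sum>i<n. B (b, i) * z i) = 0"
    proof (intro allI impI)
      fix b assume "b < n - \<rho>"
      then have "Inl b \<in> ?J" by simp
      from z(2)[rule_format, OF this] show "(\<Sum>i<n. B (b, i) * z i) = 0" by simp
    qed
    have z2: "z i = 0" if "i \<in> R - {rw k}" for i
    proof -
      have "Inr i \<in> ?J" using that by blast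
      from z(2)[rule_format, OF this] have "(\<Sum>i'<n. (if i' = i then 1 else 0) * z i') = 0" by simp
      moreover have "(\<Sum>i'<n. (if i' = i then 1 else 0) * z i') = (\<Sum>i'<n. if i' = i then z i' else 0)"
        by (intro sum.cong) auto
      ultimately show ?thesis using that R by (auto simp: sum.delta)
    qed
    have z3: "z (rw k) \<noteq> 0"
    proof
      assume "z (rw k) = 0"
      then have "\<forall>i\<in>R. z i = 0" using z2 by blast
      from B[OF R(1,2) z1 this] show False using z(1) by blast
    qed
    show ?thesis
    proof (intro exI[of _ "\<lambda>i. z i / z (rw k)"] conjI allI impI)
      fix b assume "b < n - \<rho>"
      then have "(\<Sum>i<n. B (b, i) * z i) / z (rw k) = 0" using z1 by simp
      then show "(\<Sum>i<n. B (b, i) * (z i / z (rw k))) = 0" by (simp add: sum_divide_distrib)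
    next
      fix k' assume k': "k' < \<rho>"
      show "z (rw k') / z (rw k) = (if k' = k then 1 else 0)"
      proof (cases "k' = k")
        case False
        then have "rw k' \<in> R - {rw k}" using k k' rows(1) by (auto simp: R_def dest: inj_onD)
        then show ?thesis using z2 False by simp
      qed (use z3 in simp)
    qed
  qed
  then obtain a where a: "\<And>k b. k < \<rho> \<Longrightarrow> b < n - \<rho> \<Longrightarrow> (\<Sum>i<n. B (b, i) * a k i) = 0"
      "\<And>k k'. k < \<rho> \<Longrightarrow> k' < \<rho> \<Longrightarrow> a k (rw k') = (if k' = k then 1 else 0)"
    by metis
  have Ba: "(\<Sum>i<n. B (b, i) * (\<Sum>k<\<rho>. a k i * y k)) = 0" if "b < n - \<rho>" for b y
  proof -
    have "(\<Sum>i<n. B (b, i) * (\<Sum>k<\<rho>. a k i * y k)) = (\<Sum>k<\<rho>. (\<Sum>i<n. B (b, i) * a k i) * y k)"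
      unfolding sum_distrib_left sum_distrib_right mult.assoc by (rule sum.swap)
    also have "\<dots> = 0" using a(1) that by (intro sum.neutral) simp
    finally show ?thesis .
  qed
  have main: "(\<forall>i<n. v i = 0) \<and> (\<forall>t<N. \<forall>k<\<rho>. y t k = 0)"
    if v: "\<forall>k<\<rho>. v (rw k) = 0" "\<forall>t<N. \<forall>i\<in>Om t. v i = (\<Sum>k<\<rho>. a k i * y t k)" for v y
  proof
    have "(\<Sum>i<n. B (b, i) * v i) = 0" if b: "b < n - \<rho>" for b
    proof -
      have "(\<Sum>i<n. B (b, i) * v i) = (\<Sum>i<n. B (b, i) * (\<Sum>k<\<rho>. a k i * y (b mod N) k))"
      proof (intro sum.cong refl)
        fix i
        show "B (b, i) * v i = B (b, i) * (\<Sum>k<\<rho>. a k i * y (b mod N) k)"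
          using v(2)[rule_format, of "b mod N" i] supp[of i b] N(1)
          by (cases "i \<in> Om (b mod N)") simp_all
      qed
      then show ?thesis using Ba[OF b] by simp
    qed
    moreover have "\<forall>i\<in>R. v i = 0" using v(1) by (auto simp: R_def)
    ultimately show v0: "\<forall>i<n. v i = 0" using B[OF R(1,2)] by blast
    show "\<forall>t<N. \<forall>k<\<rho>. y t k = 0"
    proof (intro allI impI)
      fix t k assume tk: "t < N" "k < \<rho>"
      \<comment> \<open>Now that \<open>v = 0\<close>, the combination with coefficients
        \<open>y t\<close> vanishes at \<open>\<rho>\<close> rows of \<open>Om t\<close>. The
        annihilator is applied to these rows instead of \<open>R\<close>, which is why it was built
        for all sets of this size.\<close>
      obtain R' where R': "R' \<subseteq> Om t" "card R' = \<rho>"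
        using Om(2)[OF tk(1)] by (meson obtain_subset_with_card_n)
      have "\<forall>i<n. (\<Sum>k<\<rho>. a k i * y t k) = 0"
      proof (rule B[of R'])
        show "R' \<subseteq> {..<n}" using R' Om(1)[OF tk(1)] by blast
        show "\<forall>i\<in>R'. (\<Sum>k<\<rho>. a k i * y t k) = 0"
        proof
          fix i assume "i \<in> R'"
          then have "i \<in> Om t" "i < n" using R' Om(1)[OF tk(1)] by auto
          then show "(\<Sum>k<\<rho>. a k i * y t k) = 0" using v(2)[rule_format, OF tk(1), of i] v0 by simp
        qed
      qed (use R' Ba in auto)
      then have "(\<Sum>k'<\<rho>. a k' (rw k) * y t k') = 0" using rows(2) tk by blast
      moreover have "(\<Sum>k'<\<rho>. a k' (rw k) * y t k') = (\<Sum>k'<\<rho>. if k' = k then y t k' else 0)"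
        using a(2) tk by (intro sum.cong) auto
      ultimately show "y t k = 0" using tk by simp
    qed
  qed
  show ?thesis
  proof (intro exI[of _ "\<lambda>i k. a k i"] conjI)
    show "\<forall>k<\<rho>. \<forall>k'<\<rho>. a k' (rw k) = (if k = k' then 1 else 0)" using a(2) by simp
    show "\<forall>v y. (\<forall>k<\<rho>. v (rw k) = 0) \<longrightarrow> (\<forall>t<N. \<forall>i\<in>Om t. v i = (\<Sum>k<\<rho>. a k i * y t k)) \<longrightarrow>
       (\<forall>i<n. v i = 0) \<and> (\<forall>t<N. \<forall>k<\<rho>. y t k = 0)" using main by blast
  qed
qed

section \<open>Normalised bases\<close>

text \<open>The block matrix \<open>[P | S]\<close> with \<open>q\<close> columns in the first
  block. Bases are plain functions of a row and a column index, so that they can be moved along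
  lines without size conditions.\<close>

definition vcat :: "nat \<Rightarrow> (nat \<Rightarrow> nat \<Rightarrow> real) \<Rightarrow> (nat \<Rightarrow> nat \<Rightarrow> real) \<Rightarrow> nat \<Rightarrow> nat \<Rightarrow> real" where
  "vcat q P S i k = (if k < q then P i k else S i (k - q))"

definition rcat :: "nat \<Rightarrow> (nat \<Rightarrow> nat) \<Rightarrow> (nat \<Rightarrow> nat) \<Rightarrow> nat \<Rightarrow> nat" where
  "rcat q R0 R1 k = (if k < q then R0 k else R1 (k - q))"

lemma block_index:
  fixes c t N b :: nat
  assumes "c < b" "t < N" shows "c * N + t < b * N"
proof -
  have "c * N + t < (c + 1) * N" using assms(2) by simp
  also have "\<dots> \<le> b * N" using assms(1) by (intro mult_right_mono) simp_all
  finally show ?thesis .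
qed

lemma sum_lessThan_add:
  fixes f :: "nat \<Rightarrow> real"
  shows "(\<Sum>k<a + b. f k) = (\<Sum>k<a. f k) + (\<Sum>k<b. f (a + k))"
  by (induction b) (simp_all add: algebra_simps)

lemma sum_vcat:
  "(\<Sum>k<q + s. vcat q P S i k * z k) = (\<Sum>k<q. P i k * z k) + (\<Sum>k<s. S i k * z (q + k))"
  by (simp add: sum_lessThan_add vcat_def)

text \<open>Row indices \<open>R0\<close>, \<open>R1\<close>, \<open>R2\<close> at which bases of the intersection and of the two column spaces can
  be normalised to a unit matrix.\<close>

definition chart :: "nat \<Rightarrow> nat \<Rightarrow> nat \<Rightarrow> nat \<Rightarrow> (nat \<Rightarrow> nat) \<Rightarrow> (nat \<Rightarrow> nat) \<Rightarrow> (nat \<Rightarrow> nat) \<Rightarrow> bool" where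
  "chart n q s1 s2 R0 R1 R2 \<longleftrightarrow>
     inj_on (rcat q R0 R1) {..<q + s1} \<and> (\<forall>k<q + s1. rcat q R0 R1 k < n) \<and>
     inj_on (rcat q R0 R2) {..<q + s2} \<and> (\<forall>k<q + s2. rcat q R0 R2 k < n)"

text \<open>These equations use up the freedom in the bases: \<open>A0\<close> may be recombined,
  and \<open>A1\<close>, \<open>A2\<close> may be recombined and changed by multiples of columns of
  \<open>A0\<close>. \<open>A0\<close> stays free at the rows \<open>R1\<close> and
  \<open>R2\<close>, because vectors of the other blocks must not be added to a basis of the
  intersection.\<close>

definition normalised :: "nat \<Rightarrow> nat \<Rightarrow> nat \<Rightarrow> (nat \<Rightarrow> nat) \<Rightarrow> (nat \<Rightarrow> nat) \<Rightarrow> (nat \<Rightarrow> nat) \<Rightarrow>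
    (nat \<Rightarrow> nat \<Rightarrow> real) \<Rightarrow> (nat \<Rightarrow> nat \<Rightarrow> real) \<Rightarrow> (nat \<Rightarrow> nat \<Rightarrow> real) \<Rightarrow> bool" where
  "normalised q s1 s2 R0 R1 R2 A0 A1 A2 \<longleftrightarrow>
     (\<forall>k<q. (\<forall>k'<q. A0 (R0 k) k' = (if k = k' then 1 else 0)) \<and>
        (\<forall>k'<s1. A1 (R0 k) k' = 0) \<and> (\<forall>k'<s2. A2 (R0 k) k' = 0)) \<and>
     (\<forall>k<s1. \<forall>k'<s1. A1 (R1 k) k' = (if k = k' then 1 else 0)) \<and>
     (\<forall>k<s2. \<forall>k'<s2. A2 (R2 k) k' = (if k = k' then 1 else 0))"

lemma chartD:
  assumes "chart n q s1 s2 R0 R1 R2"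
  shows "k < q \<Longrightarrow> R0 k < n" "k < s1 \<Longrightarrow> R1 k < n" "k < s2 \<Longrightarrow> R2 k < n"
    "k < q \<Longrightarrow> k' < q \<Longrightarrow> R0 k = R0 k' \<longleftrightarrow> k = k'"
    "k < s1 \<Longrightarrow> k' < s1 \<Longrightarrow> R1 k = R1 k' \<longleftrightarrow> k = k'"
    "k < s2 \<Longrightarrow> k' < s2 \<Longrightarrow> R2 k = R2 k' \<longleftrightarrow> k = k'"
    "k < q \<Longrightarrow> k' < s1 \<Longrightarrow> R0 k \<noteq> R1 k'" "k < q \<Longrightarrow> k' < s2 \<Longrightarrow> R0 k \<noteq> R2 k'"
proof -
  have 1: "rcat q R0 R1 a = rcat q R0 R1 b \<longleftrightarrow> a = b" if "a < q + s1" "b < q + s1" for a b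
    using assms that unfolding chart_def inj_on_def by auto
  have 2: "rcat q R0 R2 a = rcat q R0 R2 b \<longleftrightarrow> a = b" if "a < q + s2" "b < q + s2" for a b
    using assms that unfolding chart_def inj_on_def by auto
  have 3: "rcat q R0 R1 a < n" if "a < q + s1" for a using assms that unfolding chart_def by auto
  have 4: "rcat q R0 R2 a < n" if "a < q + s2" for a using assms that unfolding chart_def by auto
  show "k < q \<Longrightarrow> R0 k < n" using 3[of k] by (simp add: rcat_def)
  show "k < s1 \<Longrightarrow> R1 k < n" using 3[of "q + k"] by (simp add: rcat_def)
  show "k < s2 \<Longrightarrow> R2 k < n" using 4[of "q + k"] by (simp add: rcat_def)
  show "k < q \<Longrightarrow> k' < q \<Longrightarrow> R0 k = R0 k' \<longleftrightarrow> k = k'" using 1[of k k'] by (simp add: rcat_def)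
  show "k < s1 \<Longrightarrow> k' < s1 \<Longrightarrow> R1 k = R1 k' \<longleftrightarrow> k = k'" using 1[of "q + k" "q + k'"] by (simp add: rcat_def)
  show "k < s2 \<Longrightarrow> k' < s2 \<Longrightarrow> R2 k = R2 k' \<longleftrightarrow> k = k'" using 2[of "q + k" "q + k'"] by (simp add: rcat_def)
  show "k < q \<Longrightarrow> k' < s1 \<Longrightarrow> R0 k \<noteq> R1 k'" using 1[of k "q + k'"] by (simp add: rcat_def)
  show "k < q \<Longrightarrow> k' < s2 \<Longrightarrow> R0 k \<noteq> R2 k'" using 2[of k "q + k'"] by (simp add: rcat_def)
qed

text \<open>Rigidity of one group of \<open>N\<close> columns that share a unit vector as
  coefficients: \<open>v\<close> is the variation of the corresponding basis vector, zero at the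
  pivot rows \<open>R\<close>, and \<open>y t\<close> is minus the variation of the coefficients of
  column \<open>t\<close>. If no observed entry changes to first order, both vanish.\<close>

definition detects :: "nat \<Rightarrow> nat \<Rightarrow> nat \<Rightarrow> (nat \<Rightarrow> nat) \<Rightarrow> (nat \<Rightarrow> nat set) \<Rightarrow> (nat \<Rightarrow> nat \<Rightarrow> real) \<Rightarrow> bool" where
  "detects n \<rho> N R Om M \<longleftrightarrow> (\<forall>v y. (\<forall>k<\<rho>. v (R k) = 0) \<longrightarrow>
     (\<forall>t<N. \<forall>i\<in>Om t. v i = (\<Sum>k<\<rho>. M i k * y t k)) \<longrightarrow>
     (\<forall>i<n. v i = 0) \<and> (\<forall>t<N. \<forall>k<\<rho>. y t k = 0))"

definition col_injective :: "nat \<Rightarrow> nat set \<Rightarrow> (nat \<Rightarrow> nat \<Rightarrow> real) \<Rightarrow> bool" where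
  "col_injective \<rho> T M \<longleftrightarrow> (\<forall>z. (\<forall>i\<in>T. (\<Sum>k<\<rho>. M i k * z k) = 0) \<longrightarrow> (\<forall>k<\<rho>. z k = 0))"

lemma line_open_col_injective:
  fixes M :: "('a \<Rightarrow> real) \<Rightarrow> nat \<Rightarrow> nat \<Rightarrow> real"
  assumes affine: "\<And>x y t i k. M (line x y t) i k = (1 - t) * M x i k + t * M y i k"
    and "finite T"
  shows "line_open (\<lambda>x. col_injective \<rho> T (M x))"
proof -
  have "line_open (\<lambda>x. \<forall>z. (\<forall>i\<in>T. (\<Sum>k<\<rho>. M x i k * z k) = 0) \<longrightarrow> (\<forall>k\<in>{..<\<rho>}. z k = 0))"
  proof (rule line_open_injective[where T = "\<lambda>x z i. \<Sum>k<\<rho>. M x i k * z k"])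
    show "(\<Sum>k<\<rho>. M x j k * (a * z k + b * w k)) = a * (\<Sum>k<\<rho>. M x j k * z k) + b * (\<Sum>k<\<rho>. M x j k * w k)"
      for x a z b w j
      unfolding sum_distrib_left sum.distrib[symmetric]
      by (intro sum.cong refl) (simp add: algebra_simps)
    show "(\<Sum>k<\<rho>. M (line x y t) j k * z k)
        = (1 - t) * (\<Sum>k<\<rho>. M x j k * z k) + t * (\<Sum>k<\<rho>. M y j k * z k)" for x y t z j
      unfolding sum_distrib_left sum.distrib[symmetric] affine
      by (intro sum.cong refl) (simp add: algebra_simps)
  qed (use \<open>finite T\<close> in auto)
  then show ?thesis by (simp only: col_injective_def Ball_def lessThan_iff)
qed

text \<open>\<open>detects\<close> is the injectivity of a linear system in the unknowns
  \<open>v\<close> (tag \<open>Inl\<close>) and \<open>y\<close> (tag \<open>Inr\<close>) whose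
  coefficients are affine in \<open>M\<close>.\<close>

lemma line_open_detects:
  fixes M :: "('a \<Rightarrow> real) \<Rightarrow> nat \<Rightarrow> nat \<Rightarrow> real"
  assumes affine: "\<And>x y t i k. M (line x y t) i k = (1 - t) * M x i k + t * M y i k"
    and Om: "\<And>t. t < N \<Longrightarrow> Om t \<subseteq> {..<n}" and R: "\<And>k. k < \<rho> \<Longrightarrow> R k < n"
  shows "line_open (\<lambda>x. detects n \<rho> N R Om (M x))"
proof -
  let ?I = "Inl ` {..<n} \<union> Inr ` ({..<N} \<times> {..<\<rho>})"
  let ?J = "Inl ` {..<\<rho>} \<union> Inr ` (SIGMA t:{..<N}. Om t)"
  define T where "T = (\<lambda>x z j. case j of Inl k \<Rightarrow> z (Inl (R k) :: nat + nat \<times> nat)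
     | Inr (t, i) \<Rightarrow> z (Inl i) - (\<Sum>k<\<rho>. M x i k * z (Inr (t, k))))"
  have "line_open (\<lambda>x. \<forall>z. (\<forall>j\<in>?J. T x z j = 0) \<longrightarrow> (\<forall>i\<in>?I. z i = 0))"
  proof (rule line_open_injective)
    have "finite (Om t)" if "t < N" for t using Om[OF that] by (rule finite_subset) simp
    then show "finite ?J" by (intro finite_UnI finite_imageI finite_SigmaI) simp_all
    show "T x (\<lambda>i. a * z i + b * w i) j = a * T x z j + b * T x w j" for x a z b w j
    proof -
      have "(\<Sum>k<\<rho>. M x i k * (a * z (Inr (t, k)) + b * w (Inr (t, k))))
          = a * (\<Sum>k<\<rho>. M x i k * z (Inr (t, k))) + b * (\<Sum>k<\<rho>. M x i k * w (Inr (t, k)))" for t i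
        unfolding sum_distrib_left sum.distrib[symmetric]
        by (intro sum.cong refl) (simp add: algebra_simps)
      then show ?thesis
        unfolding T_def by (auto split: sum.split prod.split simp: algebra_simps)
    qed
    show "T x z j = T x w j" if j: "j \<in> ?J" and eq: "\<And>i. i \<in> ?I \<Longrightarrow> z i = w i" for x z w j
    proof (cases j)
      case (Inl k)
      then have "k < \<rho>" using j by auto
      then show ?thesis using R[of k] eq[of "Inl (R k)"] Inl by (simp add: T_def)
    next
      case (Inr p)
      obtain t i where p: "p = (t, i)" by (cases p)
      have "t < N" "i \<in> Om t" using j Inr p by auto
      moreover from this have "i < n" using Om by auto
      ultimately have "z (Inl i) = w (Inl i)" "\<And>k. k < \<rho> \<Longrightarrow> z (Inr (t, k)) = w (Inr (t, k))"
        using eq by auto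
      then show ?thesis unfolding Inr p T_def by simp
    qed
    show "T (line x y t) z j = (1 - t) * T x z j + t * T y z j" for x y t z j
    proof -
      have "(\<Sum>k<\<rho>. M (line x y t) i k * z (Inr (s, k)))
          = (1 - t) * (\<Sum>k<\<rho>. M x i k * z (Inr (s, k))) + t * (\<Sum>k<\<rho>. M y i k * z (Inr (s, k)))" for s i
        unfolding sum_distrib_left sum.distrib[symmetric] affine
        by (intro sum.cong refl) (simp add: algebra_simps)
      then show ?thesis
        unfolding T_def by (auto split: sum.split prod.split simp: algebra_simps)
    qed
  qed simp
  moreover have "(\<forall>z. (\<forall>j\<in>?J. T x z j = 0) \<longrightarrow> (\<forall>i\<in>?I. z i = 0)) \<longleftrightarrow> detects n \<rho> N R Om (M x)" for x
  proof
    assume L: "\<forall>z. (\<forall>j\<in>?J. T x z j = 0) \<longrightarrow> (\<forall>i\<in>?I. z i = 0)"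
    show "detects n \<rho> N R Om (M x)"
      unfolding detects_def
    proof (intro allI impI)
      fix v :: "nat \<Rightarrow> real" and y :: "nat \<Rightarrow> nat \<Rightarrow> real"
      assume v: "\<forall>k<\<rho>. v (R k) = 0" "\<forall>t<N. \<forall>i\<in>Om t. v i = (\<Sum>k<\<rho>. M x i k * y t k)"
      define z where "z = (\<lambda>j. case j of Inl i \<Rightarrow> v i | Inr (t, k) \<Rightarrow> y t k)"
      have "\<forall>j\<in>?J. T x z j = 0" using v by (auto simp: T_def z_def)
      with L have z: "\<forall>i\<in>?I. z i = 0" by blast
      have "v i = 0" if "i < n" for i using z[rule_format, of "Inl i"] that by (simp add: z_def)
      moreover have "y t k = 0" if "t < N" "k < \<rho>" for t k
        using z[rule_format, of "Inr (t, k)"] that by (simp add: z_def)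
      ultimately show "(\<forall>i<n. v i = 0) \<and> (\<forall>t<N. \<forall>k<\<rho>. y t k = 0)" by blast
    qed
  next
    assume D: "detects n \<rho> N R Om (M x)"
    show "\<forall>z. (\<forall>j\<in>?J. T x z j = 0) \<longrightarrow> (\<forall>i\<in>?I. z i = 0)"
    proof (intro allI impI)
      fix z assume z: "\<forall>j\<in>?J. T x z j = 0"
      have "z (Inl (R k)) = 0" if "k < \<rho>" for k
        using z[rule_format, of "Inl k"] that by (simp add: T_def)
      moreover have "z (Inl i) = (\<Sum>k<\<rho>. M x i k * z (Inr (t, k)))" if "t < N" "i \<in> Om t" for t i
        using z[rule_format, of "Inr (t, i)"] that by (simp add: T_def)
      ultimately have "(\<forall>i<n. z (Inl i) = 0) \<and> (\<forall>t<N. \<forall>k<\<rho>. z (Inr (t, k)) = 0)"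
        using D[unfolded detects_def, rule_format, of "\<lambda>i. z (Inl i)" "\<lambda>t k. z (Inr (t, k))"] by blast
      then show "\<forall>i\<in>?I. z i = 0" by auto
    qed
  qed
  ultimately show ?thesis by simp
qed

text \<open>Rows of \<open>T\<close> outside the chart serve those columns whose own chart row is unavailable.\<close>

lemma normalised_col_injective:
  assumes ch: "chart n q s1 s2 R0 R1 R2" and T: "finite T" "q + s1 + s2 \<le> card T"
  shows "\<exists>A0 A1 A2. normalised q s1 s2 R0 R1 R2 A0 A1 A2 \<and>
     col_injective (q + s1 + s2) T (vcat (q + s1) (vcat q A0 A1) A2)"
proof -
  note c = chartD[OF ch]
  let ?r = "q + s1 + s2"
  \<comment> \<open>\<open>own k\<close> is the row at which column \<open>k\<close> is normalised.
    \<open>R1\<close> and \<open>R2\<close> may share rows, so \<open>own\<close> need not be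
    injective across the second and the third block.\<close>
  define own where "own = rcat (q + s1) (rcat q R0 R1) R2"
  define Q where "Q = own ` {..<?r}"
  define Ou where "Ou = T - Q"
  \<comment> \<open>The columns that cannot use their own row: it lies outside \<open>T\<close>, or
    a column of the first two blocks already claims it.\<close>
  define Rem where "Rem = {k \<in> {..<?r}. own k \<notin> T \<or> (q + s1 \<le> k \<and> own k \<in> own ` {..<q + s1})}"
  have own0: "own k = R0 k" if "k < q" for k using that by (simp add: own_def rcat_def)
  have own1: "own (q + k) = R1 k" if "k < s1" for k using that by (simp add: own_def rcat_def)
  have own2: "own (q + s1 + k) = R2 k" for k by (simp add: own_def rcat_def)
  have inj12: "k = k'" if "k < q + s1" "k' < q + s1" "own k = own k'" for k k'
  proof -
    have "inj_on (rcat q R0 R1) {..<q + s1}" using ch by (simp only: chart_def)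
    moreover have "rcat q R0 R1 k = rcat q R0 R1 k'"
      using that by (simp add: own_def rcat_def[of "q + s1"])
    ultimately show ?thesis using that(1,2) by (simp add: inj_onD)
  qed
  have inj3: "k = k'" if k: "q + s1 \<le> k" "q + s1 \<le> k'" "k < ?r" "k' < ?r" "own k = own k'" for k k'
  proof -
    obtain a a' where "k = q + s1 + a" "k' = q + s1 + a'" using k(1,2) by (metis le_Suc_ex)
    then show ?thesis using k c(6)[of a a'] own2 by simp
  qed
  have inj: "k = k'" if "k < ?r" "k' < ?r" "k \<notin> Rem" "k' \<notin> Rem" "own k = own k'" for k k'
  proof (cases "k < q + s1"; cases "k' < q + s1")
    assume "k < q + s1" "k' < q + s1" then show ?thesis using inj12 that by blast
  next
    assume "\<not> k < q + s1" "\<not> k' < q + s1" then show ?thesis using inj3 that by simp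
  next
    assume "k < q + s1" "\<not> k' < q + s1"
    then have "own k' \<in> own ` {..<q + s1}" using that(5) by (intro image_eqI[of _ _ k]) simp_all
    then have "k' \<in> Rem" using that(2) \<open>\<not> k' < q + s1\<close> unfolding Rem_def by simp
    then show ?thesis using that by blast
  next
    assume "\<not> k < q + s1" "k' < q + s1"
    then have "own k \<in> own ` {..<q + s1}" using that(5) by (intro image_eqI[of _ _ k']) simp_all
    then have "k \<in> Rem" using that(1) \<open>\<not> k < q + s1\<close> unfolding Rem_def by simp
    then show ?thesis using that by blast
  qed
  have "card Rem \<le> card Ou"
  proof -
    have "own ` ({..<?r} - Rem) \<supseteq> T \<inter> Q"
    proof
      fix i assume i: "i \<in> T \<inter> Q"
      show "i \<in> own ` ({..<?r} - Rem)"
      proof (cases "i \<in> own ` {..<q + s1}")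
        case True
        then obtain k where "k < q + s1" "i = own k" by blast
        then show ?thesis using i by (intro image_eqI[of _ _ k]) (auto simp: Rem_def)
      next
        case False
        then obtain k where "k < ?r" "i = own k" using i by (auto simp: Q_def)
        then show ?thesis using i False by (intro image_eqI[of _ _ k]) (auto simp: Rem_def)
      qed
    qed
    then have "card (T \<inter> Q) \<le> card (own ` ({..<?r} - Rem))" by (intro card_mono) auto
    also have "\<dots> \<le> card ({..<?r} - Rem)" by (intro card_image_le) auto
    also have "\<dots> = ?r - card Rem" by (subst card_Diff_subset) (auto simp: Rem_def)
    finally have "card (T \<inter> Q) \<le> ?r - card Rem" .
    moreover have "card ({..<?r} - Rem) \<le> card (T \<inter> Q)"
    proof (rule card_inj_on_le[of own])
      show "inj_on own ({..<?r} - Rem)" using inj by (auto intro!: inj_onI)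
      show "own ` ({..<?r} - Rem) \<subseteq> T \<inter> Q" by (auto simp: Rem_def Q_def)
    qed (use T in simp)
    moreover have "card T = card (T \<inter> Q) + card Ou"
      unfolding Ou_def using T(1) by (metis card_Int_Diff)
    moreover have "card Rem \<le> ?r"
      using card_mono[of "{..<?r}" Rem] by (auto simp: Rem_def)
    ultimately show ?thesis using T(2) by linarith
  qed
  moreover have "finite Rem" "finite Ou" using T by (auto simp: Rem_def Ou_def)
  ultimately obtain \<psi> where \<psi>: "inj_on \<psi> Rem" "\<psi> ` Rem \<subseteq> Ou"
    using card_le_inj by blast
  \<comment> \<open>The first alternative is forced by the normalisation; the second gives each
    column in \<open>Rem\<close> a private row outside the chart. In a vanishing combination the
    private rows eliminate \<open>Rem\<close>, then the own rows eliminate the rest of the third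
    block and finally the first two blocks.\<close>
  define M :: "nat \<Rightarrow> nat \<Rightarrow> real" where
    "M = (\<lambda>i k. if i = own k \<or> (k \<in> Rem \<and> \<psi> k = i) then 1 else 0)"
  have M_own: "M (own k) k' = (if own k = own k' then 1 else 0)" if "k < ?r" for k k'
    using that \<psi>(2) unfolding M_def Ou_def Q_def by auto
  have inj_T: "col_injective ?r T M"
    unfolding col_injective_def
  proof (intro allI impI)
    fix z k assume z: "\<forall>i\<in>T. (\<Sum>k<?r. M i k * z k) = 0" and "k < ?r"
    have 1: "z k = 0" if k: "k \<in> Rem" for k
    proof -
      have "\<psi> k \<in> T" "\<psi> k \<notin> Q" "k < ?r" using \<psi>(2) k by (auto simp: Ou_def Rem_def)
      have "(\<Sum>k'<?r. M (\<psi> k) k' * z k') = (\<Sum>k'<?r. if k' = k then z k' else 0)"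
      proof (intro sum.cong refl)
        fix k' assume "k' \<in> {..<?r}"
        then have "own k' \<in> Q" unfolding Q_def by (rule imageI)
        then have "own k' \<noteq> \<psi> k" using \<open>\<psi> k \<notin> Q\<close> by metis
        then show "M (\<psi> k) k' * z k' = (if k' = k then z k' else 0)"
          using k \<psi>(1) by (auto simp: M_def dest: inj_onD)
      qed
      then show ?thesis using z \<open>\<psi> k \<in> T\<close> \<open>k < ?r\<close> by simp
    qed
    have single: "z k = 0"
      if k: "k < ?r" "own k \<in> T" and others: "\<And>k'. k' < ?r \<Longrightarrow> own k' = own k \<Longrightarrow> k' \<noteq> k \<Longrightarrow> z k' = 0" for k
    proof -
      have "(\<Sum>k'<?r. M (own k) k' * z k') = (\<Sum>k'<?r. if k' = k then z k' else 0)"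
        unfolding M_own[OF k(1)] using others by (intro sum.cong refl) force
      then show ?thesis using z k by simp
    qed
    have 2: "z k = 0" if k: "k < ?r" "q + s1 \<le> k" for k
    proof (cases "k \<in> Rem")
      case False
      then have own: "own k \<in> T" "own k \<notin> own ` {..<q + s1}" using k by (auto simp: Rem_def)
      show ?thesis
      proof (rule single[OF k(1) own(1)])
        fix k' assume k': "k' < ?r" "own k' = own k" "k' \<noteq> k"
        then have "\<not> k' < q + s1" using own(2) by (metis imageI lessThan_iff)
        then show "z k' = 0" using inj3[of k' k] k' k by simp
      qed
    qed (rule 1)
    show "z k = 0"
    proof (cases "k \<in> Rem \<or> q + s1 \<le> k")
      case False
      then have k: "own k \<in> T" "k < q + s1" using \<open>k < ?r\<close> by (auto simp: Rem_def)
      show ?thesis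
      proof (rule single[OF \<open>k < ?r\<close> k(1)])
        fix k' assume k': "k' < ?r" "own k' = own k" "k' \<noteq> k"
        then have "\<not> k' < q + s1" using inj12[of k' k] k(2) by blast
        then show "z k' = 0" using 2[of k'] k' by simp
      qed
    qed (use 1 2 \<open>k < ?r\<close> in blast)
  qed
  let ?A0 = "\<lambda>i k. M i k" and ?A1 = "\<lambda>i k. M i (q + k)" and ?A2 = "\<lambda>i k. M i (q + s1 + k)"
  have "vcat (q + s1) (vcat q ?A0 ?A1) ?A2 = M"
    by (intro ext) (auto simp: vcat_def)
  moreover have "normalised q s1 s2 R0 R1 R2 ?A0 ?A1 ?A2"
    unfolding normalised_def
  proof (intro conjI allI impI)
    show "M (R0 k) k' = (if k = k' then 1 else 0)" if "k < q" "k' < q" for k k'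
      using M_own[of k k'] that c(4)[of k k'] by (simp add: own0)
    show "M (R0 k) (q + k') = 0" if "k < q" "k' < s1" for k k'
      using M_own[of k "q + k'"] that c(7)[of k k'] by (simp add: own0 own1)
    show "M (R0 k) (q + s1 + k') = 0" if "k < q" "k' < s2" for k k'
      using M_own[of k "q + s1 + k'"] that c(8)[of k k'] by (simp add: own0 own2)
    show "M (R1 k) (q + k') = (if k = k' then 1 else 0)" if "k < s1" "k' < s1" for k k'
      using M_own[of "q + k" "q + k'"] that c(5)[of k k'] by (simp add: own1)
    show "M (R2 k) (q + s1 + k') = (if k = k' then 1 else 0)" if "k < s2" "k' < s2" for k k'
      using M_own[of "q + s1 + k" "q + s1 + k'"] that c(6)[of k k'] by (simp add: own2)
  qed
  ultimately show ?thesis using inj_T by (intro exI[of _ ?A0] exI[of _ ?A1] exI[of _ ?A2]) simp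
qed

lemma exists_detecting_basis:
  assumes rows: "inj_on (rcat q R0 R1) {..<q + s}" "\<And>k. k < q + s \<Longrightarrow> rcat q R0 R1 k < n"
    and Om: "\<And>t. t < N \<Longrightarrow> Om t \<subseteq> {..<n} \<and> q + s \<le> card (Om t)"
    and hall: "hall_ok n (q + s) N Om" "0 < N" "2 * N \<le> n - (q + s)"
  shows "\<exists>A0 A1. (\<forall>k<q. (\<forall>k'<q. A0 (R0 k) k' = (if k = k' then 1 else 0)) \<and> (\<forall>k'<s. A1 (R0 k) k' = 0)) \<and>
     (\<forall>k<s. \<forall>k'<s. A1 (R1 k) k' = (if k = k' then 1 else 0)) \<and>
     detects n (q + s) N (rcat q R0 R1) Om (vcat q A0 A1)"
proof -
  have "\<exists>M. (\<forall>k<q + s. \<forall>k'<q + s. M (rcat q R0 R1 k) k' = (if k = k' then 1 else 0)) \<and>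
      detects n (q + s) N (rcat q R0 R1) Om M"
    unfolding detects_def
    by (rule generic_subspace[OF conjunct1[OF Om] conjunct2[OF Om] hall rows])
  then obtain M where M: "\<forall>k<q + s. \<forall>k'<q + s. M (rcat q R0 R1 k) k' = (if k = k' then 1 else 0 :: real)"
     and det: "detects n (q + s) N (rcat q R0 R1) Om M" by blast
  have "M (R0 k) k' = (if k = k' then 1 else 0)" if "k < q" "k' < q" for k k'
    using M[rule_format, of k k'] that by (simp add: rcat_def)
  moreover have "M (R0 k) (q + k') = 0" if "k < q" "k' < s" for k k'
    using M[rule_format, of k "q + k'"] that by (simp add: rcat_def)
  moreover have "M (R1 k) (q + k') = (if k = k' then 1 else 0)" if "k < s" "k' < s" for k k'
    using M[rule_format, of "q + k" "q + k'"] that by (simp add: rcat_def)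
  moreover have "vcat q M (\<lambda>i k. M i (q + k)) = M" by (intro ext) (auto simp: vcat_def)
  ultimately show ?thesis using det by (intro exI[of _ M] exI[of _ "\<lambda>i k. M i (q + k)"]) simp
qed

text \<open>Normalised triples form an affine set on which all the conditions are line-open, so it
  is enough to meet each condition by a triple of its own. A condition on one view leaves the
  private block of the other view free; that block is filled with unit columns at its pivot
  rows.\<close>

lemma exists_generic_frame:
  assumes ch: "chart n q s1 s2 R0 R1 R2"
    and \<T>: "finite \<T>" "\<And>T. T \<in> \<T> \<Longrightarrow> T \<subseteq> {..<n} \<and> q + s1 + s2 \<le> card T"
    and Om1: "\<And>c t. c < q + s1 \<Longrightarrow> t < N1 \<Longrightarrow> Om1 c t \<subseteq> {..<n} \<and> q + s1 \<le> card (Om1 c t)"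
      "\<And>c. c < q + s1 \<Longrightarrow> hall_ok n (q + s1) N1 (Om1 c)" "0 < N1" "2 * N1 \<le> n - (q + s1)"
    and Om2: "\<And>c t. c < s2 \<Longrightarrow> t < N2 \<Longrightarrow> Om2 c t \<subseteq> {..<n} \<and> q + s2 \<le> card (Om2 c t)"
      "\<And>c. c < s2 \<Longrightarrow> hall_ok n (q + s2) N2 (Om2 c)" "0 < N2" "2 * N2 \<le> n - (q + s2)"
  shows "\<exists>A0 A1 A2. normalised q s1 s2 R0 R1 R2 A0 A1 A2 \<and>
     (\<forall>c<q + s1. detects n (q + s1) N1 (rcat q R0 R1) (Om1 c) (vcat q A0 A1)) \<and>
     (\<forall>c<s2. detects n (q + s2) N2 (rcat q R0 R2) (Om2 c) (vcat q A0 A2)) \<and>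
     (\<forall>T\<in>\<T>. col_injective (q + s1 + s2) T (vcat (q + s1) (vcat q A0 A1) A2))"
proof -
  note c = chartD[OF ch]
  have rows: "inj_on (rcat q R0 R1) {..<q + s1}" "\<And>k. k < q + s1 \<Longrightarrow> rcat q R0 R1 k < n"
    "inj_on (rcat q R0 R2) {..<q + s2}" "\<And>k. k < q + s2 \<Longrightarrow> rcat q R0 R2 k < n"
    using ch by (simp_all add: chart_def)
  define A where "A = (\<lambda>(a::nat) (x :: nat \<times> nat \<times> nat \<Rightarrow> real) i k. x (a, i, k))"
  define L where "L = {x. normalised q s1 s2 R0 R1 R2 (A 0 x) (A 1 x) (A 2 x)}"
  define P1 where "P1 = (\<lambda>c x. detects n (q + s1) N1 (rcat q R0 R1) (Om1 c) (vcat q (A 0 x) (A 1 x)))"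
  define P2 where "P2 = (\<lambda>c x. detects n (q + s2) N2 (rcat q R0 R2) (Om2 c) (vcat q (A 0 x) (A 2 x)))"
  define P3 where "P3 = (\<lambda>T x. col_injective (q + s1 + s2) T (vcat (q + s1) (vcat q (A 0 x) (A 1 x)) (A 2 x)))"
  have L_line: "line x y t \<in> L" if "x \<in> L" "y \<in> L" for x y t
    using that by (simp add: L_def normalised_def line_def A_def)
  have in_L: "\<exists>x\<in>L. A 0 x = B0 \<and> A 1 x = B1 \<and> A 2 x = B2"
    if "normalised q s1 s2 R0 R1 R2 B0 B1 B2" for B0 B1 B2
    using that by (intro bexI[of _ "\<lambda>(a, i, k). if a = 0 then B0 i k else if a = 1 then B1 i k else B2 i k"])
      (simp_all add: L_def A_def)
  have open1: "line_open (P1 c)" if "c < q + s1" for c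
    unfolding P1_def
  proof (rule line_open_detects)
    show "Om1 c t \<subseteq> {..<n}" if "t < N1" for t using Om1(1) \<open>c < q + s1\<close> that by blast
    show "rcat q R0 R1 k < n" if "k < q + s1" for k by (rule rows(2)[OF that])
  qed (simp add: vcat_def A_def line_def)
  have open2: "line_open (P2 c)" if "c < s2" for c
    unfolding P2_def
  proof (rule line_open_detects)
    show "Om2 c t \<subseteq> {..<n}" if "t < N2" for t using Om2(1) \<open>c < s2\<close> that by blast
    show "rcat q R0 R2 k < n" if "k < q + s2" for k by (rule rows(4)[OF that])
  qed (simp add: vcat_def A_def line_def)
  have open3: "line_open (P3 T)" if "T \<in> \<T>" for T
    unfolding P3_def
  proof (rule line_open_col_injective)
    show "finite T" using \<T>(2)[OF that] finite_subset[of T "{..<n}"] by simp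
  qed (simp add: vcat_def A_def line_def)
  have ex1: "\<exists>x\<in>L. P1 c x" if cl: "c < q + s1" for c
  proof -
    obtain B0 B1 where B: "\<forall>k<q. (\<forall>k'<q. B0 (R0 k) k' = (if k = k' then 1 else 0)) \<and> (\<forall>k'<s1. B1 (R0 k) k' = 0)"
        "\<forall>k<s1. \<forall>k'<s1. B1 (R1 k) k' = (if k = k' then 1 else 0)"
      and det: "detects n (q + s1) N1 (rcat q R0 R1) (Om1 c) (vcat q B0 B1)"
      using exists_detecting_basis[OF rows(1,2) Om1(1)[OF cl] Om1(2)[OF cl] Om1(3,4)] by blast
    have "normalised q s1 s2 R0 R1 R2 B0 B1 (\<lambda>i k. if i = R2 k then 1 else 0)"
      unfolding normalised_def using B c(6,8) by simp
    from in_L[OF this] obtain x where "x \<in> L" "A 0 x = B0" "A 1 x = B1" by blast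
    then show ?thesis using det unfolding P1_def by (intro bexI[of _ x]) simp_all
  qed
  have ex2: "\<exists>x\<in>L. P2 c x" if cl: "c < s2" for c
  proof -
    obtain B0 B2 where B: "\<forall>k<q. (\<forall>k'<q. B0 (R0 k) k' = (if k = k' then 1 else 0)) \<and> (\<forall>k'<s2. B2 (R0 k) k' = 0)"
        "\<forall>k<s2. \<forall>k'<s2. B2 (R2 k) k' = (if k = k' then 1 else 0)"
      and det: "detects n (q + s2) N2 (rcat q R0 R2) (Om2 c) (vcat q B0 B2)"
      using exists_detecting_basis[OF rows(3,4) Om2(1)[OF cl] Om2(2)[OF cl] Om2(3,4)] by blast
    have "normalised q s1 s2 R0 R1 R2 B0 (\<lambda>i k. if i = R1 k then 1 else 0) B2"
      unfolding normalised_def using B c(5,7) by simp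
    from in_L[OF this] obtain x where "x \<in> L" "A 0 x = B0" "A 2 x = B2" by blast
    then show ?thesis using det unfolding P2_def by (intro bexI[of _ x]) simp_all
  qed
  have ex3: "\<exists>x\<in>L. P3 T x" if T: "T \<in> \<T>" for T
  proof -
    have "finite T" using \<T>(2)[OF T] finite_subset by blast
    then obtain B0 B1 B2 where B: "normalised q s1 s2 R0 R1 R2 B0 B1 B2"
        "col_injective (q + s1 + s2) T (vcat (q + s1) (vcat q B0 B1) B2)"
      using normalised_col_injective[OF ch, of T] \<T>(2)[OF T] by blast
    from in_L[OF B(1)] obtain x where "x \<in> L" "A 0 x = B0" "A 1 x = B1" "A 2 x = B2" by blast
    then show ?thesis using B(2) unfolding P3_def by blast
  qed
  have "normalised q s1 s2 R0 R1 R2 (\<lambda>i k. if i = R0 k then 1 else 0)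
      (\<lambda>i k. if i = R1 k then 1 else 0) (\<lambda>i k. if i = R2 k then 1 else 0)"
    unfolding normalised_def using c by simp
  from in_L[OF this] have L: "L \<noteq> {}" by blast
  let ?C1 = "{..<q + s1}" and ?C2 = "{..<s2}"
  have all1: "\<exists>z\<in>L. \<forall>c\<in>?C1. P1 c z"
    using open1 ex1 L L_line by (intro line_open_Ball_common_point) auto
  have all2: "\<exists>z\<in>L. \<forall>c\<in>?C2. P2 c z"
    using open2 ex2 L L_line by (intro line_open_Ball_common_point) auto
  have all3: "\<exists>z\<in>L. \<forall>T\<in>\<T>. P3 T z"
    using open3 ex3 L L_line \<T>(1) by (intro line_open_Ball_common_point) auto
  have o1: "line_open (\<lambda>z. \<forall>c\<in>?C1. P1 c z)" using open1 by (intro line_open_Ball) auto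
  have o2: "line_open (\<lambda>z. \<forall>c\<in>?C2. P2 c z)" using open2 by (intro line_open_Ball) auto
  have o3: "line_open (\<lambda>z. \<forall>T\<in>\<T>. P3 T z)" using open3 \<T>(1) by (intro line_open_Ball) auto
  have all12: "\<exists>z\<in>L. (\<forall>c\<in>?C1. P1 c z) \<and> (\<forall>c\<in>?C2. P2 c z)"
    using all1 all2 line_open_common_point[OF o1 o2 _ _ _ _ L_line] by blast
  have "\<exists>z\<in>L. ((\<forall>c\<in>?C1. P1 c z) \<and> (\<forall>c\<in>?C2. P2 c z)) \<and> (\<forall>T\<in>\<T>. P3 T z)"
    using all12 all3 line_open_common_point[OF line_open_conj[OF o1 o2] o3 _ _ _ _ L_line] by blast
  then show ?thesis unfolding L_def P1_def P2_def P3_def by blast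
qed

section \<open>The Jacobian\<close>

lemma sum_delta_mult:
  fixes f :: "nat \<Rightarrow> real"
  assumes "c < m" "\<And>k. k < m \<Longrightarrow> X k = (if k = c then 1 else 0)"
  shows "(\<Sum>k<m. f k * X k) = f c"
proof -
  have "(\<Sum>k<m. f k * X k) = (\<Sum>k<m. if k = c then f k else 0)"
    using assms(2) by (intro sum.cong) auto
  then show ?thesis using assms(1) by simp
qed

lemma detectsD:
  assumes "detects n \<rho> N R Om M" "\<And>k. k < \<rho> \<Longrightarrow> v (R k) = 0"
    and "\<And>t i. t < N \<Longrightarrow> i \<in> Om t \<Longrightarrow> v i = (\<Sum>k<\<rho>. M i k * y t k)" and "i < n"
  shows "v i = 0"
proof -
  have "\<forall>k<\<rho>. v (R k) = 0" "\<forall>t<N. \<forall>i\<in>Om t. v i = (\<Sum>k<\<rho>. M i k * y t k)"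
    using assms(2,3) by simp_all
  with assms(1) have "\<forall>i<n. v i = 0" unfolding detects_def by blast
  then show ?thesis using assms(4) by simp
qed

lemma col_injectiveD:
  assumes "col_injective \<rho> T M" "\<And>i. i \<in> T \<Longrightarrow> (\<Sum>k<\<rho>. M i k * z k) = 0" "k < \<rho>"
  shows "z k = 0"
proof -
  have "\<forall>i\<in>T. (\<Sum>k<\<rho>. M i k * z k) = 0" using assms(2) by simp
  with assms(1) have "\<forall>k<\<rho>. z k = 0" unfolding col_injective_def by blast
  then show ?thesis using assms(3) by simp
qed

text \<open>The columns of the first view are split into \<open>q + s1\<close> groups of \<open>N1\<close> columns, the coefficient
  vector of a column in group \<open>c\<close> being the \<open>c\<close>-th unit vector. In the second view, \<open>q\<close> single
  columns are followed by \<open>s2\<close> groups of \<open>N2\<close> columns.\<close>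

definition coeff1 :: "nat \<Rightarrow> nat \<Rightarrow> nat \<Rightarrow> real" where
  "coeff1 N1 k j = (if k = j div N1 then 1 else 0)"

definition coeff2 :: "nat \<Rightarrow> nat \<Rightarrow> nat \<Rightarrow> nat \<Rightarrow> real" where
  "coeff2 q N2 k j = (if k = (if j < q then j else q + (j - q) div N2) then 1 else 0)"

text \<open>Group \<open>g\<close> of the first view concerns only column \<open>g\<close> of
  \<open>[A0 | A1]\<close>. This kills \<open>D1\<close>, which is zero at all pivot rows of that
  view, but determines \<open>D0\<close> only up to combinations of \<open>A1\<close>, since
  \<open>D0\<close> is not normalised at the rows \<open>R1\<close>: the first view does not know
  which part of its column space is shared. The groups of the second view kill \<open>D2\<close>,
  and for each \<open>g < q\<close> one more column of the second view removes the ambiguity,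
  because \<open>A0\<close>, \<open>A1\<close>, \<open>A2\<close> are jointly independent on its
  observed rows. The same independence finally kills \<open>dX\<close> and
  \<open>dY\<close>.\<close>

lemma jacobian_injective:
  assumes norm: "normalised q s1 s2 R0 R1 R2 A0 A1 A2"
    and ch: "chart n q s1 s2 R0 R1 R2"
    and N: "0 < N1" "(q + s1) * N1 \<le> ma" "0 < N2" "q + s2 * N2 \<le> mb"
    and Oma: "\<And>j. j < ma \<Longrightarrow> Oma j \<subseteq> {..<n}" and Omb: "\<And>j. j < mb \<Longrightarrow> Omb j \<subseteq> {..<n}"
    and det1: "\<And>c. c < q + s1 \<Longrightarrow>
      detects n (q + s1) N1 (rcat q R0 R1) (\<lambda>t. Oma (c * N1 + t)) (vcat q A0 A1)"
    and det2: "\<And>c. c < s2 \<Longrightarrow>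
      detects n (q + s2) N2 (rcat q R0 R2) (\<lambda>t. Omb (q + (c * N2 + t))) (vcat q A0 A2)"
    and inja: "\<And>j. j < ma \<Longrightarrow> col_injective (q + s1 + s2) (Oma j) (vcat (q + s1) (vcat q A0 A1) A2)"
    and injb: "\<And>j. j < mb \<Longrightarrow> col_injective (q + s1 + s2) (Omb j) (vcat (q + s1) (vcat q A0 A1) A2)"
    and d0: "\<And>k k'. k < q \<Longrightarrow> k' < q \<Longrightarrow> D0 (R0 k) k' = 0"
    and d1: "\<And>k k'. k < q \<Longrightarrow> k' < s1 \<Longrightarrow> D1 (R0 k) k' = 0" "\<And>k k'. k < s1 \<Longrightarrow> k' < s1 \<Longrightarrow> D1 (R1 k) k' = 0"
    and d2: "\<And>k k'. k < q \<Longrightarrow> k' < s2 \<Longrightarrow> D2 (R0 k) k' = 0" "\<And>k k'. k < s2 \<Longrightarrow> k' < s2 \<Longrightarrow> D2 (R2 k) k' = 0"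
    and eq1: "\<And>j i. j < ma \<Longrightarrow> i \<in> Oma j \<Longrightarrow>
      (\<Sum>k<q + s1. vcat q D0 D1 i k * coeff1 N1 k j) + (\<Sum>k<q + s1. vcat q A0 A1 i k * dX k j) = 0"
    and eq2: "\<And>j i. j < mb \<Longrightarrow> i \<in> Omb j \<Longrightarrow>
      (\<Sum>k<q + s2. vcat q D0 D2 i k * coeff2 q N2 k j) + (\<Sum>k<q + s2. vcat q A0 A2 i k * dY k j) = 0"
  shows "(\<forall>i<n. (\<forall>k<q. D0 i k = 0) \<and> (\<forall>k<s1. D1 i k = 0) \<and> (\<forall>k<s2. D2 i k = 0)) \<and>
    (\<forall>j<ma. \<forall>k<q + s1. dX k j = 0) \<and> (\<forall>j<mb. \<forall>k<q + s2. dY k j = 0)"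
proof -
  note c = chartD[OF ch]
  have nrm: "A1 (R0 k) k' = 0" if "k < q" "k' < s1" for k k'
    using norm that by (simp add: normalised_def)
  have nrm1: "A1 (R1 k) k' = (if k = k' then 1 else 0)" if "k < s1" "k' < s1" for k k'
    using norm that by (simp add: normalised_def)
  have group1: "vcat q D0 D1 i g = (\<Sum>k<q + s1. vcat q A0 A1 i k * (- dX k (g * N1 + t)))"
    if "g < q + s1" "t < N1" "i \<in> Oma (g * N1 + t)" for g t i
  proof -
    have "g * N1 + t < ma" using block_index[OF that(1,2)] N(2) by simp
    moreover have "(\<Sum>k<q + s1. vcat q D0 D1 i k * coeff1 N1 k (g * N1 + t)) = vcat q D0 D1 i g"
      using that by (intro sum_delta_mult) (simp_all add: coeff1_def)
    ultimately show ?thesis using eq1[of "g * N1 + t" i] that(3) by (simp add: sum_negf)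
  qed
  have D1: "D1 i g = 0" if "i < n" "g < s1" for i g
  proof -
    have rows: "D1 (rcat q R0 R1 k) g = 0" if "k < q + s1" for k
      using d1 that \<open>g < s1\<close> by (simp add: rcat_def)
    have cols: "D1 i g = (\<Sum>k<q + s1. vcat q A0 A1 i k * (- dX k ((q + g) * N1 + t)))"
      if "t < N1" "i \<in> Oma ((q + g) * N1 + t)" for t i
      using group1[OF _ that] \<open>g < s1\<close> by (simp add: vcat_def)
    show ?thesis
      by (rule detectsD[OF det1[of "q + g"], where v = "\<lambda>i. D1 i g" and y = "\<lambda>t k. - dX k ((q + g) * N1 + t)"])
        (fact rows cols that | simp add: \<open>g < s1\<close>)+
  qed
  have D0: "D0 i g = (\<Sum>k<s1. A1 i k * D0 (R1 k) g)" if "i < n" "g < q" for i g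
  proof -
    \<comment> \<open>Subtracting the combination of \<open>A1\<close> with the values of
      \<open>D0\<close> at the rows \<open>R1\<close> makes \<open>v\<close> vanish at all pivot
      rows; \<open>y\<close> absorbs the same combination into the coefficients.\<close>
    define v where "v = (\<lambda>i. D0 i g - (\<Sum>k<s1. A1 i k * D0 (R1 k) g))"
    define y where "y = (\<lambda>t k. - dX k (g * N1 + t) - (if k < q then 0 else D0 (R1 (k - q)) g))"
    have rows: "v (rcat q R0 R1 k) = 0" if k: "k < q + s1" for k
    proof (cases "k < q")
      case True
      then have "rcat q R0 R1 k = R0 k" by (simp add: rcat_def)
      then show ?thesis using d0[OF True \<open>g < q\<close>] nrm[OF True] by (simp add: v_def)
    next
      case False
      then have row: "rcat q R0 R1 k = R1 (k - q)" "k - q < s1" using k by (simp_all add: rcat_def)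
      have "(\<Sum>k'<s1. A1 (R1 (k - q)) k' * D0 (R1 k') g) = (\<Sum>k'<s1. D0 (R1 k') g * A1 (R1 (k - q)) k')"
        by (simp only: mult.commute)
      also have "\<dots> = D0 (R1 (k - q)) g"
        using row(2) nrm1[OF row(2)] by (intro sum_delta_mult) auto
      finally show ?thesis unfolding row(1) v_def by simp
    qed
    have cols: "v i = (\<Sum>k<q + s1. vcat q A0 A1 i k * y t k)"
      if t: "t < N1" "i \<in> Oma (g * N1 + t)" for t i
    proof -
      have "(\<Sum>k<q + s1. vcat q A0 A1 i k * y t k)
          = (\<Sum>k<q + s1. vcat q A0 A1 i k * (- dX k (g * N1 + t)))
            - (\<Sum>k<q + s1. vcat q A0 A1 i k * (if k < q then 0 else D0 (R1 (k - q)) g))"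
        unfolding y_def right_diff_distrib sum_subtractf ..
      also have "(\<Sum>k<q + s1. vcat q A0 A1 i k * (if k < q then 0 else D0 (R1 (k - q)) g))
          = (\<Sum>k<s1. A1 i k * D0 (R1 k) g)"
        unfolding sum_vcat by simp
      also have "(\<Sum>k<q + s1. vcat q A0 A1 i k * (- dX k (g * N1 + t))) = D0 i g"
        using group1[OF _ t] \<open>g < q\<close> by (simp add: vcat_def)
      finally show ?thesis by (simp add: v_def)
    qed
    have "v i = 0"
      by (rule detectsD[OF det1[of g], where v = v and y
          = y]) (fact rows cols that | simp add: trans_less_add1[OF \<open>g < q\<close>])+
    then show ?thesis by (simp add: v_def)
  qed
  have group2: "D2 i g = (\<Sum>k<q + s2. vcat q A0 A2 i k * (- dY k (q + (g * N2 + t))))"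
    if "g < s2" "t < N2" "i \<in> Omb (q + (g * N2 + t))" for g t i
  proof -
    have "q + (g * N2 + t) < mb" using block_index[OF that(1,2)] N(4) by simp
    moreover have "(\<Sum>k<q + s2. vcat q D0 D2 i k * coeff2 q N2 k (q + (g * N2 + t))) = vcat q D0 D2 i (q + g)"
      using that by (intro sum_delta_mult) (simp_all add: coeff2_def)
    ultimately show ?thesis
      using eq2[of "q + (g * N2 + t)" i] that(3) by (simp add: sum_negf vcat_def)
  qed
  have D2: "D2 i g = 0" if "i < n" "g < s2" for i g
  proof -
    have rows: "D2 (rcat q R0 R2 k) g = 0" if "k < q + s2" for k
      using d2 that \<open>g < s2\<close> by (simp add: rcat_def)
    show ?thesis
      by (rule detectsD[OF det2[OF \<open>g < s2\<close>], where v = "\<lambda>i. D2 i g" and y = "\<lambda>t k. - dY k (q + (g * N2 + t))"])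
        (fact rows group2[OF \<open>g < s2\<close>] that)+
  qed
  have split3: "(\<Sum>k<q + s1 + s2. vcat (q + s1) (vcat q A0 A1) A2 i k * z k)
      = (\<Sum>k<q + s1. vcat q A0 A1 i k * z k) + (\<Sum>k<s2. A2 i k * z (q + s1 + k))" for i z
    by (rule sum_vcat)
  have w: "D0 (R1 k) g = 0" if "k < s1" "g < q" for k g
  proof -
    \<comment> \<open>Coordinates with respect to \<open>[A0 | A1 | A2]\<close>: the middle block
      carries what is left of \<open>D0\<close>, the outer blocks carry the variation of the
      coefficients of column \<open>g\<close> of the second view.\<close>
    define z where "z = (\<lambda>k. if k < q then dY k g else if k < q + s1 then D0 (R1 (k - q)) g else dY (k - s1) g)"
    have "g < mb" using that N(4) by simp
    have zero: "(\<Sum>k<q + s1 + s2. vcat (q + s1) (vcat q A0 A1) A2 i k * z k) = 0" if i: "i \<in> Omb g" for i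
    proof -
      have "i < n" using i Omb[OF \<open>g < mb\<close>] by auto
      have "(\<Sum>k<q + s2. vcat q D0 D2 i k * coeff2 q N2 k g) = vcat q D0 D2 i g"
        using \<open>g < q\<close> by (intro sum_delta_mult) (simp_all add: coeff2_def)
      then have "D0 i g + (\<Sum>k<q + s2. vcat q A0 A2 i k * dY k g) = 0"
        using eq2[OF \<open>g < mb\<close> i] \<open>g < q\<close> by (simp add: vcat_def[of q D0 D2])
      then show ?thesis
        unfolding split3 sum_vcat z_def using D0[OF \<open>i < n\<close> \<open>g < q\<close>] by (simp add: ac_simps)
    qed
    have "z (q + k) = 0"
      by (rule col_injectiveD[OF injb[OF \<open>g < mb\<close>] zero]) (simp_all add: \<open>k < s1\<close> trans_less_add1)
    then show ?thesis using \<open>k < s1\<close> by (simp add: z_def)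
  qed
  then have D0': "D0 i g = 0" if "i < n" "g < q" for i g using D0[OF that] that by simp
  have dX: "dX k j = 0" if "j < ma" "k < q + s1" for j k
  proof -
    define z where "z = (\<lambda>k. if k < q + s1 then dX k j else 0)"
    have zero: "(\<Sum>k<q + s1 + s2. vcat (q + s1) (vcat q A0 A1) A2 i k * z k) = 0" if i: "i \<in> Oma j" for i
    proof -
      have "i < n" using i Oma[OF \<open>j < ma\<close>] by auto
      have "(\<Sum>k<q + s1. vcat q D0 D1 i k * coeff1 N1 k j) = 0"
        using D0'[OF \<open>i < n\<close>] D1[OF \<open>i < n\<close>] by (intro sum.neutral) (auto simp: vcat_def)
      then show ?thesis unfolding split3 using eq1[OF \<open>j < ma\<close> i] by (simp add: z_def)
    qed
    have "z k = 0"
      by (rule col_injectiveD[OF inja[OF \<open>j < ma\<close>] zero]) (use that in simp_all)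
    then show ?thesis using that by (simp add: z_def)
  qed
  have dY: "dY k j = 0" if "j < mb" "k < q + s2" for j k
  proof -
    define z where "z = (\<lambda>k. if k < q then dY k j else if k < q + s1 then 0 else dY (k - s1) j)"
    have zero: "(\<Sum>k<q + s1 + s2. vcat (q + s1) (vcat q A0 A1) A2 i k * z k) = 0" if i: "i \<in> Omb j" for i
    proof -
      have "i < n" using i Omb[OF \<open>j < mb\<close>] by auto
      have "(\<Sum>k<q + s2. vcat q D0 D2 i k * coeff2 q N2 k j) = 0"
        using D0'[OF \<open>i < n\<close>] D2[OF \<open>i < n\<close>] by (intro sum.neutral) (auto simp: vcat_def)
      then have "(\<Sum>k<q + s2. vcat q A0 A2 i k * dY k j) = 0" using eq2[OF \<open>j < mb\<close> i] by simp
      then show ?thesis unfolding split3 sum_vcat z_def by (simp add: ac_simps)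
    qed
    have "z (if k < q then k else k + s1) = 0"
      by (rule col_injectiveD[OF injb[OF \<open>j < mb\<close>] zero]) (use that in simp_all)
    then show ?thesis using that by (simp add: z_def split: if_splits)
  qed
  show ?thesis using D0' D1 D2 dX dY by blast
qed

section \<open>The random sampling pattern\<close>

text \<open>Sampling without replacement is at most as likely to stay inside a set as sampling with
  replacement: \<open>(s - i) / (n - i) \<le> s / n\<close> for each of the \<open>k\<close> draws.
  The induction works with the cross-multiplied form.\<close>

lemma subsets_card_ratio:
  fixes s n k :: nat
  assumes "s \<le> n" "k \<le> n" "0 < n"
  shows "real (s choose k) / real (n choose k) \<le> (real s / real n) ^ k"
proof (cases "k \<le> s")
  case False
  then show ?thesis by (simp add: binomial_eq_0)
next
  case True
  have "real (s choose k) * real n ^ k \<le> real (n choose k) * real s ^ k"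
    using True assms
  proof (induction k)
    case 0
    then show ?case by simp
  next
    case (Suc k)
    have step: "real (Suc k) * real (m choose Suc k) = real (m - k) * real (m choose k)" for m
    proof -
      have "Suc k * (m choose Suc k) = (m - k) * (m choose k)"
        unfolding binomial_absorb_comp by (rule binomial_absorption)
      then show ?thesis by (simp only: of_nat_mult[symmetric])
    qed
    have IH: "real (s choose k) * real n ^ k \<le> real (n choose k) * real s ^ k" using Suc by simp
    have c: "real (s - k) * real n \<le> real (n - k) * real s"
      using Suc.prems by (simp add: of_nat_diff algebra_simps mult_left_mono)
    have "(real (s choose k) * real n ^ k) * (real (s - k) * real n)
        \<le> (real (n choose k) * real s ^ k) * (real (n - k) * real s)"
      by (rule mult_mono[OF IH c]) simp_all
    then have "(real (s - k) * real (s choose k)) * real n ^ Suc k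
        \<le> (real (n - k) * real (n choose k)) * real s ^ Suc k"
      by (simp add: ac_simps)
    then have "real (Suc k) * (real (s choose Suc k) * real n ^ Suc k)
        \<le> real (Suc k) * (real (n choose Suc k) * real s ^ Suc k)"
      unfolding step[symmetric] by (simp only: mult.assoc)
    then show ?case by (simp only: mult_le_cancel_left_pos of_nat_0_less_iff zero_less_Suc)
  qed
  moreover have "0 < real (n choose k)" using assms by simp
  ultimately show ?thesis using assms by (simp add: power_divide field_simps)
qed

lemma sampling_support:
  assumes "Om \<in> set_pmf (sampling n m k)" "\<forall>j<m. k j \<le> n" "j < m"
  shows "Om j \<subseteq> {..<n} \<and> card (Om j) = k j"
proof -
  let ?S = "{S. S \<subseteq> {..<n} \<and> card S = k j}"
  have "finite ?S" by (rule finite_subset[of _ "Pow {..<n}"]) auto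
  moreover have "?S \<noteq> {}"
    using assms(2,3) obtain_subset_with_card_n[of "k j" "{..<n}"] by fastforce
  moreover have "Om j \<in> set_pmf (pmf_of_set ?S)"
    using assms(1,3) unfolding sampling_def by (auto simp: set_Pi_pmf PiE_dflt_def)
  ultimately show ?thesis by simp
qed

text \<open>Independence gives a product over the columns in \<open>J\<close>; as the ratio is at
  most 1, a column with more than \<open>l\<close> entries only makes its factor smaller.\<close>

lemma sampling_inside:
  assumes k: "\<forall>j<m. l \<le> k j \<and> k j \<le> n" and "J \<subseteq> {..<m}" "W \<subseteq> {..<n}" "0 < n"
  shows "measure_pmf.prob (sampling n m k) {Om. \<forall>j\<in>J. Om j \<subseteq> W} \<le> (real (card W) / real n) ^ (l * card J)"
proof -
  define p where "p = (\<lambda>j. pmf_of_set {S. S \<subseteq> {..<n} \<and> card S = k j})"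
  have fin: "finite {S. S \<subseteq> {..<n} \<and> card S = a}" for a
    by (rule finite_subset[of _ "Pow {..<n}"]) auto
  have W: "card W \<le> n" "finite W" using card_mono[of "{..<n}" W] assms(3) finite_subset by auto
  have single: "measure_pmf.prob (p j) {S. S \<subseteq> W} \<le> (real (card W) / real n) ^ l" if "j < m" for j
  proof -
    have kj: "l \<le> k j" "k j \<le> n" using k that by auto
    have ne: "{S. S \<subseteq> {..<n} \<and> card S = k j} \<noteq> {}"
      using kj(2) obtain_subset_with_card_n[of "k j" "{..<n}"] by fastforce
    have "{S. S \<subseteq> {..<n} \<and> card S = k j} \<inter> {S. S \<subseteq> W} = {S. S \<subseteq> W \<and> card S = k j}"
      using assms(3) by auto
    then have "measure_pmf.prob (p j) {S. S \<subseteq> W} = real (card W choose k j) / real (n choose k j)"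
      unfolding p_def using measure_pmf_of_set[OF ne fin] W(2) by (simp add: n_subsets)
    also have "\<dots> \<le> (real (card W) / real n) ^ k j"
      by (rule subsets_card_ratio[OF W(1) kj(2) assms(4)])
    also have "\<dots> \<le> (real (card W) / real n) ^ l"
      using W(1) kj(1) assms(4) by (intro power_decreasing) auto
    finally show ?thesis .
  qed
  have sub: "{Om. \<forall>j\<in>J. Om j \<subseteq> W} \<inter> set_pmf (sampling n m k)
      \<subseteq> PiE_dflt {..<m} {} (\<lambda>j. if j \<in> J then {S. S \<subseteq> W} else UNIV)"
    unfolding sampling_def by (auto simp: set_Pi_pmf PiE_dflt_def)
  have "measure_pmf.prob (sampling n m k) {Om. \<forall>j\<in>J. Om j \<subseteq> W}
      = measure_pmf.prob (sampling n m k) ({Om. \<forall>j\<in>J. Om j \<subseteq> W} \<inter> set_pmf (sampling n m k))"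
    by (rule measure_Int_set_pmf[symmetric])
  also have "\<dots> \<le> measure_pmf.prob (sampling n m k) (PiE_dflt {..<m} {} (\<lambda>j. if j \<in> J then {S. S
      \<subseteq> W} else UNIV))"
    by (rule measure_pmf.finite_measure_mono[OF sub]) simp
  also have "\<dots> = (\<Prod>j<m. measure_pmf.prob (p j) (if j \<in> J then {S. S \<subseteq> W} else UNIV))"
    unfolding sampling_def p_def by (rule measure_Pi_pmf_PiE_dflt) simp
  also have "\<dots> \<le> (\<Prod>j<m. if j \<in> J then (real (card W) / real n) ^ l else 1)"
    using single by (intro prod_mono) auto
  also have "\<dots> = (\<Prod>j\<in>J. (real (card W) / real n) ^ l)"
    using assms(2) by (simp add: prod.If_cases Int_absorb1)
  also have "\<dots> = (real (card W) / real n) ^ (l * card J)"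
    by (simp add: power_mult)
  finally show ?thesis .
qed

text \<open>If a set of size \<open>a\<close> violates the condition, at least \<open>N - (a - 1) div 2\<close> of the sets avoid it.\<close>

lemma hall_ok_prob:
  assumes k: "\<forall>j<m. l \<le> k j \<and> k j \<le> n" and "0 < n" "\<rho> < l" "l \<le> n"
    and N: "N = (n - \<rho>) div 2" and \<gamma>: "inj_on \<gamma> {..<N}" "\<gamma> ` {..<N} \<subseteq> {..<m}"
  shows "measure_pmf.prob (sampling n m k) {Om. \<not> hall_ok n \<rho> N (\<lambda>t. Om (\<gamma> t))}
    \<le> (\<Sum>a = 1..n - l. real (n choose a) * real (N choose (N - (a - 1) div 2)) *
          (real (n - a) / real n) ^ (l * (N - (a - 1) div 2)))"
proof -
  define h where "h = (\<lambda>a::nat. N - (a - 1) div 2)"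
  define Bad where "Bad = (\<lambda>S J. {Om :: nat \<Rightarrow> nat set. \<forall>j\<in>\<gamma> ` J. Om j \<subseteq> {..<n} - S})"
  define F where "F = (\<lambda>a. {S. S \<subseteq> {..<n} \<and> card S = a})"
  define G where "G = (\<lambda>b. {J. J \<subseteq> {..<N} \<and> card J = b})"
  have finF: "finite (F a)" for a unfolding F_def by (rule finite_subset[of _ "Pow {..<n}"]) auto
  have finG: "finite (G b)" for b unfolding G_def by (rule finite_subset[of _ "Pow {..<N}"]) auto
  have cover: "Om \<in> (\<Union>a\<in>{1..n - l}. \<Union>S\<in>F a. \<Union>J\<in>G (h a). Bad S J)"
    if Om: "Om \<in> set_pmf (sampling n m k)" "\<not> hall_ok n \<rho> N (\<lambda>t. Om (\<gamma> t))" for Om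
  proof -
    obtain S where S: "S \<subseteq> {..<n}" "card S \<le> n - \<rho>"
        "\<not> card S \<le> 2 * card {t \<in> {..<N}. Om (\<gamma> t) \<inter> S \<noteq> {}}" "\<not> (\<forall>t<N. Om (\<gamma> t) \<inter> S \<noteq> {})"
      using Om(2) unfolding hall_ok_def by blast
    let ?H = "{t \<in> {..<N}. Om (\<gamma> t) \<inter> S \<noteq> {}}"
    have sup: "Om (\<gamma> t) \<subseteq> {..<n} \<and> l \<le> card (Om (\<gamma> t))" if "t < N" for t
      using sampling_support[OF Om(1), of "\<gamma> t"] k \<gamma>(2) that by auto
    have avoid: "Om (\<gamma> t) \<subseteq> {..<n} - S" if "t \<in> {..<N} - ?H" for t using sup that by blast
    obtain t where t: "t < N" "Om (\<gamma> t) \<inter> S = {}" using S(4) by blast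
    \<comment> \<open>The second alternative of \<open>hall_ok\<close> fails as well, so some column
      with at least \<open>l\<close> observed entries misses \<open>S\<close>. This is why the sum
      stops at \<open>n - l\<close>.\<close>
    have "card (Om (\<gamma> t) \<union> S) \<le> n"
      using card_mono[of "{..<n}" "Om (\<gamma> t) \<union> S"] sup[OF t(1)] S(1) by simp
    moreover have "card (Om (\<gamma> t) \<union> S) = card (Om (\<gamma> t)) + card S"
      using sup[OF t(1)] S(1) t(2) finite_subset[of _ "{..<n}"] by (intro card_Un_disjoint) auto
    ultimately have "card S \<le> n - l" using sup[OF t(1)] by linarith
    have "card ({..<N} - ?H) = N - card ?H"
      by (subst card_Diff_subset) auto
    moreover have "card ?H \<le> (card S - 1) div 2" using S(3) by linarith
    ultimately have "h (card S) \<le> card ({..<N} - ?H)" unfolding h_def by linarith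
    then obtain J where J: "J \<subseteq> {..<N} - ?H" "card J = h (card S)"
      by (meson obtain_subset_with_card_n)
    have "card S \<in> {1..n - l}" using S(3) \<open>card S \<le> n - l\<close> by simp
    moreover have "S \<in> F (card S)" using S(1) by (simp add: F_def)
    moreover have "J \<in> G (h (card S))" using J by (auto simp: G_def)
    moreover have "Om \<in> Bad S J" using J(1) avoid unfolding Bad_def by blast
    ultimately show ?thesis by blast
  qed
  have term_bound: "measure_pmf.prob (sampling n m k) (Bad S J)
      \<le> (real (n - a) / real n) ^ (l * b)" if "S \<in> F a" "J \<in> G b" for S J a b
  proof -
    have SJ: "S \<subseteq> {..<n}" "card S = a" "J \<subseteq> {..<N}" "card J = b"
      using that by (auto simp: F_def G_def)
    have "inj_on \<gamma> J" using \<gamma>(1) SJ(3) inj_on_subset by blast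
    then have "card (\<gamma> ` J) = b" using SJ(4) by (simp add: card_image)
    moreover have "card ({..<n} - S) = n - a"
      using SJ(1,2) finite_subset[OF SJ(1)] by (simp add: card_Diff_subset)
    moreover have "\<gamma> ` J \<subseteq> {..<m}" using \<gamma>(2) SJ(3) by blast
    ultimately show ?thesis
      using sampling_inside[OF k, of "\<gamma> ` J" "{..<n} - S"] \<open>0 < n\<close> unfolding Bad_def by simp
  qed
  have "measure_pmf.prob (sampling n m k) {Om. \<not> hall_ok n \<rho> N (\<lambda>t. Om (\<gamma> t))}
      = measure_pmf.prob (sampling n m k) ({Om. \<not> hall_ok n \<rho> N (\<lambda>t. Om (\<gamma> t))} \<inter> set_pmf (sampling n m k))"
    by (rule measure_Int_set_pmf[symmetric])
  also have "\<dots> \<le> measure_pmf.prob (sampling n m k) (\<Union>a\<in>{1..n - l}. \<Union>S\<in>F a. \<Union>J\<in>G (h a). Bad S J)"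
    by (rule measure_pmf.finite_measure_mono) (use cover in blast, simp)
  also have "\<dots> \<le> (\<Sum>a\<in>{1..n - l}. measure_pmf.prob (sampling n m k) (\<Union>S\<in>F a. \<Union>J\<in>G (h a). Bad S J))"
    by (rule measure_pmf.finite_measure_subadditive_finite) simp_all
  also have "\<dots> \<le> (\<Sum>a\<in>{1..n - l}. \<Sum>S\<in>F a. measure_pmf.prob (sampling n m k) (\<Union>J\<in>G (h a). Bad S J))"
    by (intro sum_mono measure_pmf.finite_measure_subadditive_finite finF) simp
  also have "\<dots> \<le> (\<Sum>a\<in>{1..n - l}. \<Sum>S\<in>F a. \<Sum>J\<in>G (h a). measure_pmf.prob (sampling n m k) (Bad S J))"
    by (intro sum_mono measure_pmf.finite_measure_subadditive_finite finG) simp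
  also have "\<dots> \<le> (\<Sum>a\<in>{1..n - l}. \<Sum>S\<in>F a. \<Sum>J\<in>G (h a). (real (n - a) / real n) ^ (l * h a))"
    by (intro sum_mono term_bound)
  also have "\<dots> = (\<Sum>a\<in>{1..n - l}. real (n choose a) * real (N choose h a) * (real (n - a) / real n) ^ (l * h a))"
    by (intro sum.cong refl) (simp add: F_def G_def n_subsets)
  finally show ?thesis unfolding h_def .
qed

section \<open>Tail estimates for the union bound\<close>

lemma binomial_power_le_exp:
  fixes y :: real
  assumes "0 \<le> y" shows "real (n choose k) * y ^ k \<le> exp (real n * y)"
proof (cases "k \<le> n")
  case True
  have "real (n choose k) * y ^ k * 1 ^ (n - k) \<le> (\<Sum>k\<le>n. real (n choose k) * y ^ k * 1 ^ (n - k))"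
    using True assms by (intro member_le_sum) auto
  also have "\<dots> = (y + 1) ^ n" by (simp add: binomial_ring)
  also have "\<dots> \<le> exp y ^ n" using assms exp_ge_add_one_self[of y] by (intro power_mono) (auto simp: add.commute)
  finally show ?thesis by (simp add: exp_of_nat_mult)
qed (simp add: binomial_eq_0)

text \<open>The binomials cost at most \<open>n\<close> to the power \<open>a + h\<close>, which is
  at most \<open>3 * a / 2\<close>. At least \<open>n / 6\<close> columns avoid the set, so the last
  factor is at most \<open>exp (- a * l / 6)\<close>. The constants 9, 3 and 6 in the bound on
  \<open>l\<close> are six times 3/2, 1/2 and 1: the first pays for the binomials, the third leaves
  \<open>exp (- a)\<close>, and the second leaves \<open>x\<close> as soon as \<open>a\<close> is at
  least 2.\<close>

lemma tail_term_small:
  fixes n \<rho> l N a :: nat and x :: real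
  assumes n: "6 \<le> n" "6 * \<rho> \<le> n" and x: "0 < x" "x \<le> 1"
    and l: "9 * ln n - 3 * ln x + 6 \<le> real l" and N: "N = (n - \<rho>) div 2"
    and a: "1 \<le> a" "2 * a \<le> n"
  shows "real (n choose a) * real (N choose (N - (a - 1) div 2)) *
      (real (n - a) / real n) ^ (l * (N - (a - 1) div 2)) \<le> exp (- real a) * x"
proof -
  define h where "h = (a - 1) div 2"
  define q where "q = N - h"
  have nr: "6 * real \<rho> \<le> real n" using n(2) by linarith
  have Nr: "real n - real \<rho> - 1 \<le> 2 * real N" using n unfolding N by linarith
  have hr: "2 * real h \<le> real a - 1" using a unfolding h_def by linarith
  have "h \<le> N" using hr Nr nr a n by linarith
  then have qr: "real q = real N - real h" by (simp add: q_def)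
  have ln0: "0 \<le> ln (real n)" using n by simp
  have lnx: "ln x \<le> 0" using x by simp
  have e: "real n ^ k = exp (real k * ln n)" for k using n by (simp add: exp_of_nat_mult)
  have "real (n choose a) \<le> real n ^ a" using binomial_le_pow[of a n] a by (simp flip: of_nat_power)
  also have "\<dots> = exp (real a * ln n)" by (rule e)
  finally have 1: "real (n choose a) \<le> exp (real a * ln n)" .
  have "N choose q = N choose h" unfolding q_def using \<open>h \<le> N\<close> by (rule binomial_symmetric[symmetric])
  also have "\<dots> \<le> N ^ h" using \<open>h \<le> N\<close> by (rule binomial_le_pow)
  also have "\<dots> \<le> n ^ h" unfolding N by (intro power_mono) auto
  finally have "real (N choose q) \<le> real n ^ h" by (simp flip: of_nat_power)
  then have 2: "real (N choose q) \<le> exp (real h * ln n)" unfolding e .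
  have "real (n - a) / real n = 1 - real a / real n" using a n by (simp add: of_nat_diff field_simps)
  also have "\<dots> \<le> exp (- (real a / real n))" using exp_ge_add_one_self[of "- (real a / real n)"] by simp
  finally have "(real (n - a) / real n) ^ (l * q) \<le> exp (- (real a / real n)) ^ (l * q)"
    by (intro power_mono) auto
  also have "\<dots> = exp (- (real a * (real l * (real q / real n))))"
    by (simp add: exp_of_nat_mult[symmetric] mult_ac)
  finally have 3: "(real (n - a) / real n) ^ (l * q) \<le> exp (- (real a * (real l * (real q / real n))))" .
  have "real (n choose a) * real (N choose q) * (real (n - a) / real n) ^ (l * q)
      \<le> exp (real a * ln n) * exp (real h * ln n) * exp (- (real a * (real l * (real q / real n))))"
    by (intro mult_mono 1 2 3) auto
  also have "\<dots> = exp ((real a + real h) * ln n - real a * (real l * (real q / real n)))"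
    by (simp add: exp_add[symmetric] exp_diff exp_minus field_simps)
  also have "\<dots> \<le> exp (- real a + ln x)"
  proof (subst exp_le_cancel_iff)
    show "(real a + real h) * ln n - real a * (real l * (real q / real n)) \<le> - real a + ln x"
    proof (cases "a = 1")
      \<comment> \<open>For \<open>a = 1\<close> the general estimate would leave only the square
        root of \<open>x\<close>. Here \<open>h = 0\<close>, so at least a third of \<open>n\<close>
        columns avoid the set, which doubles the exponent.\<close>
      case True
      then have "h = 0" by (simp add: h_def)
      have "1 / 3 \<le> real q / real n" using qr \<open>h = 0\<close> Nr nr n by (simp add: field_simps)
      then have "real l * (1 / 3) \<le> real l * (real q / real n)" by (rule mult_left_mono) simp
      then show ?thesis using l ln0 lnx \<open>h = 0\<close> True by simp
    next
      case False
      have "1 / 6 \<le> real q / real n" using qr hr Nr nr n a by (simp add: field_simps)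
      then have "real l * (1 / 6) \<le> real l * (real q / real n)" by (rule mult_left_mono) simp
      define D where "D = real a * (real l * (real q / real n))"
      have "real a * (real l * (1 / 6)) \<le> D"
        unfolding D_def using \<open>real l * (1 / 6) \<le> _\<close> by (rule mult_left_mono) simp
      moreover have "real a * ((9 * ln n - 3 * ln x + 6) * (1 / 6)) \<le> real a * (real l * (1 / 6))"
        using l by (intro mult_left_mono mult_right_mono) auto
      moreover have "real h * ln n \<le> (real a / 2) * ln n" using hr ln0 by (intro mult_right_mono) auto
      moreover have "(real a / 2) * ln x \<le> 1 * ln x"
        using False a lnx by (intro mult_right_mono_neg) auto
      ultimately have "(real a + real h) * ln n - D \<le> - real a + ln x" by (simp add: algebra_simps)
      then show ?thesis unfolding D_def .
    qed
  qed
  also have "\<dots> = exp (- real a) * exp (ln x)" by (rule exp_add)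
  also have "exp (ln x) = x" using x by simp
  finally show ?thesis unfolding q_def h_def .
qed

text \<open>Large sets are measured by the size \<open>s\<close> of their complement, with
  \<open>l \<le> s < n / 2\<close>. Of the power \<open>y ^ (l * q)\<close>, the factors
  \<open>y ^ s\<close> and \<open>y ^ q\<close> are spent on the two binomials. Since
  \<open>2 * \<rho> < l \<le> s\<close> gives \<open>s \<le> 4 * q\<close>, the resulting
  exponentials are at most \<open>exp 6\<close> for each of the \<open>q\<close> columns, and the
  remaining \<open>l - 5\<close> factors of at most 1/2 per column outweigh this.\<close>

lemma tail_term_large:
  fixes n \<rho> l N a :: nat and x :: real
  assumes n: "6 \<le> n" and x: "0 < x" "x \<le> 1"
    and l: "9 * ln n - 3 * ln x + 6 \<le> real l" "2 * \<rho> < l" and N: "N = (n - \<rho>) div 2"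
    and a: "1 \<le> a" "a \<le> n - l" "n < 2 * a"
  shows "real (n choose a) * real (N choose (N - (a - 1) div 2)) *
      (real (n - a) / real n) ^ (l * (N - (a - 1) div 2)) \<le> x / (3 * real n)"
proof -
  define s where "s = n - a"
  define q where "q = N - (a - 1) div 2"
  define y where "y = real s / real n"
  have ln0: "0 \<le> ln (real n)" using n by simp
  have lnx: "ln x \<le> 0" using x by simp
  have "6 \<le> l" using l(1) ln0 lnx by linarith
  have s: "l \<le> s" "a + s = n" "2 * s < n" using a unfolding s_def by linarith+
  have q4: "s \<le> 4 * q" "1 \<le> q" using s l(2) a unfolding q_def N by linarith+
  have y: "0 < y" "y \<le> 1 / 2" using s n \<open>6 \<le> l\<close> by (simp_all add: y_def field_simps)
  have "s + q + (l - 5) * q \<le> l * q"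
  proof -
    have "s + q + (l - 5) * q \<le> 5 * q + (l - 5) * q" using q4 by simp
    also have "\<dots> = l * q" using \<open>6 \<le> l\<close> by (simp add: distrib_right[symmetric])
    finally show ?thesis .
  qed
  then have "y ^ (l * q) \<le> y ^ (s + q + (l - 5) * q)" using y by (intro power_decreasing) auto
  also have "\<dots> = y ^ s * y ^ q * y ^ ((l - 5) * q)" by (simp add: power_add)
  finally have 1: "y ^ (l * q) \<le> y ^ s * y ^ q * y ^ ((l - 5) * q)" .
  have "n choose a = n choose s" using s binomial_symmetric[of a n] by (simp add: s_def)
  then have "real (n choose a) * real (N choose q) * y ^ (l * q)
      \<le> (real (n choose s) * y ^ s) * (real (N choose q) * y ^ q) * y ^ ((l - 5) * q)"
    using mult_left_mono[OF 1, of "real (n choose s) * real (N choose q)"] by (simp add: mult_ac)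
  also have "\<dots> \<le> exp (real n * y) * exp (real N * y) * (1 / 2) ^ ((l - 5) * q)"
    using y by (intro mult_mono binomial_power_le_exp power_mono) auto
  also have "exp (real n * y) * exp (real N * y) \<le> exp (6 * real q)"
  proof -
    have "real n * y = real s" using n by (simp add: y_def)
    moreover have "real N * y \<le> (real n / 2) * y" using y unfolding N by (intro mult_right_mono) auto
    ultimately have "real n * y + real N * y \<le> 6 * real q" using q4 by simp
    then show ?thesis by (simp flip: exp_add)
  qed
  also have "exp (6 * real q) * (1 / 2) ^ ((l - 5) * q) = (exp 6 * (1 / 2) ^ (l - 5)) ^ q"
    by (simp only: power_mult power_mult_distrib exp_of_nat2_mult)
  finally have 2: "real (n choose a) * real (N choose q) * y ^ (l * q) \<le> (exp 6 * (1 / 2) ^ (l - 5)) ^ q"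
    by simp
  \<comment> \<open>As \<open>ln 2\<close> is at least 2/3, \<open>l * ln 2\<close> is at least
    \<open>6 * ln n - 2 * ln x + 4\<close>. With \<open>exp 1 \<le> 3\<close> this leads to
    \<open>288 * x ^ 2 / n ^ 6\<close>, and \<open>6 \<le> n\<close> does the rest.\<close>
  have base: "exp 6 * (1 / 2) ^ (l - 5) \<le> x / (3 * real n)"
  proof -
    have "(1 / 2 :: real) ^ l = (1 / 2) ^ 5 * (1 / 2) ^ (l - 5)"
      using \<open>6 \<le> l\<close> by (simp flip: power_add)
    also have "(1 / 2 :: real) ^ 5 = 1 / 32" by (simp add: power_divide)
    finally have "(1 / 2 :: real) ^ (l - 5) = 32 * (1 / 2) ^ l" by simp
    moreover have "(1 / 2 :: real) ^ l = exp (- (real l * ln 2))"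
      by (simp add: exp_minus exp_of_nat_mult power_one_over inverse_eq_divide)
    moreover have "- (real l * ln 2) \<le> - (6 * ln n) + 2 * ln x - 4"
    proof -
      have "real l * (2 / 3) \<le> real l * ln 2" using ln2_ge_two_thirds by (intro mult_left_mono) auto
      then show ?thesis using l(1) by simp
    qed
    ultimately have "(1 / 2 :: real) ^ (l - 5) \<le> 32 * exp (- (6 * ln n) + 2 * ln x - 4)" by simp
    then have "exp 6 * (1 / 2) ^ (l - 5) \<le> exp 6 * (32 * exp (- (6 * ln n) + 2 * ln x - 4))"
      by (rule mult_left_mono) simp
    also have "\<dots> = 32 * exp (2 * ln x - 6 * ln n + 2)" by (simp add: exp_add[symmetric] algebra_simps)
    also have "\<dots> = 32 * (x ^ 2 * exp 1 ^ 2 / real n ^ 6)"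
    proof -
      have "exp (2 * ln x) = x ^ 2" using exp_of_nat_mult[of 2 "ln x"] x by simp
      moreover have "exp (6 * ln n) = real n ^ 6" using exp_of_nat_mult[of 6 "ln n"] n by simp
      moreover have "exp (2 :: real) = exp 1 ^ 2" using exp_of_nat_mult[of 2 "1 :: real"] by simp
      ultimately show ?thesis by (simp add: exp_add exp_diff)
    qed
    also have "\<dots> \<le> 32 * (x ^ 2 * 3 ^ 2 / real n ^ 6)"
      using exp_le by (intro mult_left_mono divide_right_mono power_mono) auto
    also have "\<dots> = (288 * x) * (x / real n ^ 6)" by (simp add: power2_eq_square)
    also have "\<dots> \<le> (6 ^ 5 / 3) * (x / real n ^ 6)" using x by (intro mult_right_mono) auto
    also have "\<dots> \<le> (real n ^ 5 / 3) * (x / real n ^ 6)"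
      using x n by (intro mult_right_mono divide_right_mono power_mono) auto
    also have "\<dots> = x / (3 * real n)" using n by (simp add: field_simps power_Suc eval_nat_numeral)
    finally show ?thesis .
  qed
  have "x / (3 * real n) \<le> 1" using x n by (simp add: field_simps)
  then have "exp 6 * (1 / 2) ^ (l - 5) \<le> (1 :: real)" using base by linarith
  then have "(exp 6 * (1 / 2) ^ (l - 5)) ^ q \<le> (exp 6 * (1 / 2 :: real) ^ (l - 5)) ^ 1"
    using q4(2) by (intro power_decreasing) auto
  with 2 base show ?thesis unfolding y_def s_def q_def by simp
qed

text \<open>Each term is at most the sum of the two bounds. The bounds for small sets form a
  geometric series of ratio 2/5, an upper estimate of \<open>exp (- 1)\<close>, with sum at most
  2/3; those for large sets are at most \<open>n\<close> times \<open>x / (3 * n)\<close>.\<close>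

lemma tail_sum:
  fixes n \<rho> l N :: nat and x :: real
  assumes n: "6 \<le> n" "6 * \<rho> \<le> n" and x: "0 < x" "x \<le> 1"
    and l: "9 * ln n - 3 * ln x + 6 \<le> real l" "2 * \<rho> < l" and N: "N = (n - \<rho>) div 2"
  shows "(\<Sum>a = 1..n - l. real (n choose a) * real (N choose (N - (a - 1) div 2)) *
      (real (n - a) / real n) ^ (l * (N - (a - 1) div 2))) \<le> x"
proof -
  have "(\<Sum>a = 1..n - l. real (n choose a) * real (N choose (N - (a - 1) div 2)) *
      (real (n - a) / real n) ^ (l * (N - (a - 1) div 2)))
      \<le> (\<Sum>a = 1..n - l. (2 / 5) ^ a * x + x / (3 * real n))"
  proof (rule sum_mono)
    fix a assume a: "a \<in> {1..n - l}"
    show "real (n choose a) * real (N choose (N - (a - 1) div 2)) *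
      (real (n - a) / real n) ^ (l * (N - (a - 1) div 2)) \<le> (2 / 5) ^ a * x + x / (3 * real n)"
    proof (cases "2 * a \<le> n")
      case True
      have "5 / 2 \<le> exp (1 :: real)" using exp_lower_Taylor_quadratic[of "1 :: real"] by simp
      then have "exp (- 1) \<le> (2 / 5 :: real)" by (simp add: exp_minus field_simps)
      then have "exp (- 1) ^ a \<le> (2 / 5 :: real) ^ a" by (intro power_mono) auto
      moreover have "exp (- 1) ^ a = exp (- real a)" by (simp flip: exp_of_nat_mult)
      ultimately have "exp (- real a) * x \<le> (2 / 5) ^ a * x" using x by (intro mult_right_mono) auto
      moreover have "0 \<le> x / (3 * real n)" using x by simp
      ultimately show ?thesis
        using tail_term_small[OF n x l(1) N _ True] a by force
    next
      case False
      moreover have "0 \<le> (2 / 5) ^ a * x" using x by simp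
      ultimately show ?thesis
        using tail_term_large[OF n(1) x l N, of a] a by force
    qed
  qed
  also have "\<dots> = x * (\<Sum>a = 1..n - l. (2 / 5) ^ a) + real (n - l) * (x / (3 * real n))"
    by (simp add: sum.distrib sum_distrib_left mult.commute)
  also have "(\<Sum>a = 1..n - l. (2 / 5 :: real) ^ a) \<le> 2 / 3"
  proof -
    have "(\<Sum>a = 1..m. (2 / 5 :: real) ^ a) = 2 / 3 - 2 / 3 * (2 / 5) ^ m" for m
      by (induction m) auto
    then show ?thesis by simp
  qed
  also have "real (n - l) * (x / (3 * real n)) \<le> real n * (x / (3 * real n))"
    using x by (intro mult_right_mono) auto
  finally show ?thesis using x n by (simp add: mult_left_mono)
qed

section \<open>Normal form of a completion\<close>

text \<open>The \<open>\<kappa>\<close> independent vectors and the columns of \<open>A\<close>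
  generate each other, so their spans agree. This makes ranks accessible through sums over plain
  functions.\<close>

lemma mrank_eq_card:
  fixes a :: "nat \<Rightarrow> nat \<Rightarrow> real"
  assumes A: "A \<in> carrier_mat n m"
    and indep: "\<And>z k. (\<And>i. i < n \<Longrightarrow> (\<Sum>k<\<kappa>. a i k * z k) = 0) \<Longrightarrow> k < \<kappa> \<Longrightarrow> z k = 0"
    and cols: "\<And>j. j < m \<Longrightarrow> \<exists>y. \<forall>i<n. A $$ (i, j) = (\<Sum>k<\<kappa>. a i k * y k)"
    and basis: "\<And>k. k < \<kappa> \<Longrightarrow> \<exists>y. \<forall>i<n. a i k = (\<Sum>j<m. A $$ (i, j) * y j)"
  shows "vec_space.rank n A = \<kappa>"
proof -
  interpret vec_space "TYPE(real)" n .
  define M where "M = mat n \<kappa> (\<lambda>(i, k). a i k)"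
  have M: "M \<in> carrier_mat n \<kappa>" by (simp add: M_def)
  have Mv: "(M *\<^sub>v v) $ i = (\<Sum>k<\<kappa>. a i k * v $ k)" if "v \<in> carrier_vec \<kappa>" "i < n" for v i
    using that by (simp add: M_def scalar_prod_def atLeast0LessThan)
  have Av: "(A *\<^sub>v v) $ i = (\<Sum>j<m. A $$ (i, j) * v $ j)" if "v \<in> carrier_vec m" "i < n" for v i
    using that A by (simp add: scalar_prod_def atLeast0LessThan)
  have kernel: "v = 0\<^sub>v \<kappa>" if v: "v \<in> carrier_vec \<kappa>" "M *\<^sub>v v = 0\<^sub>v n" for v
  proof (rule eq_vecI)
    fix k assume "k < dim_vec (0\<^sub>v \<kappa>)"
    then have "k < \<kappa>" by simp
    have "(\<Sum>k<\<kappa>. a i k * v $ k) = 0" if "i < n" for i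
      using Mv[OF v(1) that] v(2) that by simp
    then show "v $ k = 0\<^sub>v \<kappa> $ k" using indep[of "\<lambda>k. v $ k" k] \<open>k < \<kappa>\<close> by simp
  qed (use v in simp)
  have "distinct (cols M)"
    unfolding distinct_conv_nth
  proof (intro allI impI)
    fix k k' assume k: "k < length (cols M)" "k' < length (cols M)" "k \<noteq> k'"
    then have kk: "k < \<kappa>" "k' < \<kappa>" using M by auto
    show "cols M ! k \<noteq> cols M ! k'"
    proof
      assume "cols M ! k = cols M ! k'"
      then have eq: "col M k = col M k'" using k by simp
      have "a i k = a i k'" if "i < n" for i
        using arg_cong[OF eq, of "\<lambda>v. v $ i"] that kk by (simp add: M_def)
      moreover have "(\<Sum>l<\<kappa>. a i l * (if l = k then 1 else if l = k' then - 1 else 0)) = a i k - a i k'" for i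
      proof -
        have "(\<Sum>l<\<kappa>. a i l * (if l = k then 1 else if l = k' then - 1 else 0))
            = (\<Sum>l<\<kappa>. (if l = k then a i l else 0) - (if l = k' then a i l else 0))"
          using k(3) by (intro sum.cong) auto
        then show ?thesis using kk by (simp add: sum_subtractf)
      qed
      ultimately have "(if k = k then 1 else if k = k' then - 1 else 0) = (0 :: real)"
        by (intro indep[of "\<lambda>l. if l = k then 1 else if l = k' then - 1 else 0" k]) (use kk in simp_all)
      then show False by simp
    qed
  qed
  moreover have "lin_indpt (set (cols M))"
  proof
    assume "lin_dep (set (cols M))"
    then obtain v where "v \<in> carrier_vec \<kappa>" "v \<noteq> 0\<^sub>v \<kappa>" "M *\<^sub>v v = 0\<^sub>v n"
      using lin_depE[OF M _ \<open>distinct (cols M)\<close>] by blast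
    then show False using kernel by blast
  qed
  ultimately have "rank M = \<kappa>" by (rule lin_indpt_full_rank[OF M])
  moreover have "span (set (cols A)) = span (set (cols M))"
  proof
    have "set (cols A) \<subseteq> span (set (cols M))"
    proof
      fix v assume "v \<in> set (cols A)"
      then obtain j where j: "j < m" "v = col A j"
        using A by (auto simp: cols_def)
      obtain y where y: "\<forall>i<n. A $$ (i, j) = (\<Sum>k<\<kappa>. a i k * y k)" using cols[OF j(1)] by blast
      have "M *\<^sub>v vec \<kappa> y = v"
      proof (rule eq_vecI)
        fix i assume "i < dim_vec v"
        then have "i < n" using j A by simp
        then show "(M *\<^sub>v vec \<kappa> y) $ i = v $ i" using y j A by (subst Mv) simp_all
      qed (use j A M in simp)
      moreover have "v \<in> carrier_vec n" using j A by simp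
      ultimately show "v \<in> span (set (cols M))"
        using col_space_eq[OF M] M unfolding col_space_def by auto
    qed
    then show "span (set (cols A)) \<subseteq> span (set (cols M))"
      using cols_dim[of M] M by (intro span_is_subset span_is_submodule) auto
    have "set (cols M) \<subseteq> span (set (cols A))"
    proof
      fix v assume "v \<in> set (cols M)"
      then obtain k where k: "k < \<kappa>" "v = col M k"
        using M by (auto simp: cols_def)
      obtain y where y: "\<forall>i<n. a i k = (\<Sum>j<m. A $$ (i, j) * y j)" using basis[OF k(1)] by blast
      have "A *\<^sub>v vec m y = v"
      proof (rule eq_vecI)
        fix i assume "i < dim_vec v"
        then have "i < n" using k M by simp
        then show "(A *\<^sub>v vec m y) $ i = v $ i" using y k by (subst Av) (simp_all add: M_def)
      qed (use k A M in simp)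
      moreover have "v \<in> carrier_vec n" using k M by simp
      ultimately show "v \<in> span (set (cols A))"
        using col_space_eq[OF A] A unfolding col_space_def by auto
    qed
    then show "span (set (cols M)) \<subseteq> span (set (cols A))"
      using cols_dim[of A] A by (intro span_is_subset span_is_submodule) auto
  qed
  ultimately show ?thesis unfolding rank_def by simp
qed

section \<open>Subspaces of vectors and their pivot rows\<close>

definition lin_closed :: "(nat \<Rightarrow> real) set \<Rightarrow> bool" where
  "lin_closed S \<longleftrightarrow> (\<forall>s\<in>S. \<forall>w\<in>S. \<forall>a b. (\<lambda>i. a * s i + b * w i) \<in> S) \<and> (\<lambda>_. 0) \<in> S"

lemma lin_closedD: "lin_closed S \<Longrightarrow> s \<in> S \<Longrightarrow> w \<in> S \<Longrightarrow> (\<lambda>i. a * s i + b * w i) \<in> S"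
  by (simp add: lin_closed_def)

lemma lin_closed_sum:
  assumes "lin_closed S" "finite K" "\<And>k. k \<in> K \<Longrightarrow> s k \<in> S"
  shows "(\<lambda>i. \<Sum>k\<in>K. c k * s k i) \<in> S"
  using assms(2,3)
proof (induction K rule: finite_induct)
  case empty
  then show ?case using assms(1) by (simp add: lin_closed_def)
next
  case (insert k K)
  then have 1: "s k \<in> S" "(\<lambda>i. \<Sum>k\<in>K. c k * s k i) \<in> S" by simp_all
  then have "(\<lambda>i. c k * s k i + 1 * (\<Sum>k\<in>K. c k * s k i)) \<in> S"
    by (intro lin_closedD[OF assms(1)])
  then show ?case using insert.hyps by simp
qed

text \<open>For a linear \<open>S\<close> and a finite \<open>R\<close> this says that the
  restriction of \<open>S\<close> to the rows \<open>R\<close> is onto.\<close>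

definition dual_on :: "(nat \<Rightarrow> real) set \<Rightarrow> nat set \<Rightarrow> bool" where
  "dual_on S R \<longleftrightarrow> (\<forall>k\<in>R. \<exists>s\<in>S. \<forall>i\<in>R. s i = (if i = k then 1 else 0))"

text \<open>For a maximal \<open>R\<close> the restriction is also injective: a vector of
  \<open>S\<close> that vanishes on \<open>R\<close> but not at \<open>i0\<close> could be scaled
  and used to correct the dual vectors, so that \<open>i0\<close> could be added. Starting from
  \<open>P\<close> lets the pivot rows of a subspace be extended to those of a larger space.\<close>

lemma row_basis:
  assumes S: "lin_closed S" and P: "P \<subseteq> {..<n}" "dual_on S P"
  shows "\<exists>R. P \<subseteq> R \<and> R \<subseteq> {..<n} \<and> dual_on S R \<and> (\<forall>s\<in>S. (\<forall>i\<in>R. s i = 0) \<longrightarrow> (\<forall>i<n. s i = 0))"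
proof -
  define C where "C = {R. P \<subseteq> R \<and> R \<subseteq> {..<n} \<and> dual_on S R}"
  have "finite C" unfolding C_def by (rule finite_subset[of _ "Pow {..<n}"]) auto
  moreover have "P \<in> C" using P by (simp add: C_def)
  ultimately have "\<exists>R\<in>C. P \<subseteq> R \<and> (\<forall>R'\<in>C. R \<subseteq> R' \<longrightarrow> R = R')" by (rule finite_has_maximal2)
  then obtain R where R: "R \<in> C" "\<forall>R'\<in>C. R \<subseteq> R' \<longrightarrow> R = R'" by (elim bexE conjE)
  have RC: "P \<subseteq> R" "R \<subseteq> {..<n}" "dual_on S R" using R(1) by (simp_all add: C_def)
  have "s i0 = 0" if s: "s \<in> S" "\<forall>i\<in>R. s i = 0" and i0: "i0 < n" for s i0
  proof (rule ccontr)
    assume ne: "s i0 \<noteq> 0"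
    then have "i0 \<notin> R" using s(2) by blast
    have "dual_on S (insert i0 R)"
      unfolding dual_on_def
    proof
      fix k assume k: "k \<in> insert i0 R"
      show "\<exists>w\<in>S. \<forall>i\<in>insert i0 R. w i = (if i = k then 1 else 0)"
      proof (cases "k = i0")
        case True
        have "(\<lambda>i. 1 / s i0 * s i + 0 * s i) \<in> S" by (rule lin_closedD[OF S s(1) s(1)])
        moreover have "\<forall>i\<in>insert i0 R. 1 / s i0 * s i + 0 * s i = (if i = k then 1 else 0)"
          using s(2) ne True \<open>i0 \<notin> R\<close> by auto
        ultimately show ?thesis by (intro bexI[of _ "\<lambda>i. 1 / s i0 * s i + 0 * s i"])
      next
        case False
        then obtain w where w: "w \<in> S" "\<forall>i\<in>R. w i = (if i = k then 1 else 0)"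
          using k RC(3) unfolding dual_on_def by blast
        have "(\<lambda>i. 1 * w i + (- w i0 / s i0) * s i) \<in> S" by (rule lin_closedD[OF S w(1) s(1)])
        moreover have "\<forall>i\<in>insert i0 R. 1 * w i + (- w i0 / s i0) * s i = (if i = k then 1 else 0)"
          using s(2) ne False w(2) by auto
        ultimately show ?thesis by (intro bexI[of _ "\<lambda>i. 1 * w i + (- w i0 / s i0) * s i"])
      qed
    qed
    then have "insert i0 R \<in> C" using RC i0 by (auto simp: C_def)
    then have "R = insert i0 R" using R(2) by blast
    then show False using \<open>i0 \<notin> R\<close> by blast
  qed
  then show ?thesis using RC by (intro exI[of _ R]) blast
qed

text \<open>The pivot rows of \<open>S0\<close> are kept and extended to pivot rows of
  \<open>S1\<close>. The dual vectors at the added rows vanish at the old ones, and they form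
  \<open>A1\<close>.\<close>

lemma adapted_basis:
  assumes S1: "lin_closed S1" and S0: "lin_closed S0" "S0 \<subseteq> S1"
    and R0: "bij_betw R0 {..<q} R" "R \<subseteq> {..<n}" "dual_on S0 R"
    and A0': "\<forall>k<q. (\<lambda>i. A0 i k) \<in> S0" "\<forall>k<q. \<forall>k'<q. A0 (R0 k) k' = (if k = k' then 1 else 0)"
  shows "\<exists>s1 R1 A1. inj_on (rcat q R0 R1) {..<q + s1} \<and> (\<forall>k<q + s1. rcat q R0 R1 k < n) \<and>
     (\<forall>k<s1. (\<lambda>i. A1 i k) \<in> S1) \<and> (\<forall>k<q. \<forall>k'<s1. A1 (R0 k) k' = 0) \<and>
     (\<forall>k<s1. \<forall>k'<s1. A1 (R1 k) k' = (if k = k' then 1 else 0)) \<and>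
     (\<forall>s\<in>S1. \<exists>y. \<forall>i<n. s i = (\<Sum>k<q + s1. vcat q A0 A1 i k * y k))"
proof -
  note A0 = A0'[rule_format]
  have "dual_on S1 R" using R0(3) S0(2) unfolding dual_on_def by blast
  from row_basis[OF S1 R0(2) this] obtain T where T: "R \<subseteq> T" "T \<subseteq> {..<n}" "dual_on S1 T"
      "\<forall>s\<in>S1. (\<forall>i\<in>T. s i = 0) \<longrightarrow> (\<forall>i<n. s i = 0)" by (elim exE conjE)
  define s1 where "s1 = card (T - R)"
  have "finite (T - R)" using T(2) finite_subset by blast
  from ex_bij_betw_nat_finite[OF this] obtain R1 where R1: "bij_betw R1 {..<s1} (T - R)"
    by (auto simp: s1_def atLeast0LessThan)
  have R1T: "R1 k \<in> T - R" if "k < s1" for k using R1 that bij_betwE by blast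
  have R0R: "R0 k \<in> R" if "k < q" for k using R0(1) that bij_betwE by blast
  have "\<exists>s\<in>S1. \<forall>i\<in>T. s i = (if i = R1 k then 1 else 0)" if "k < s1" for k
    using T(3) R1T[OF that] unfolding dual_on_def by blast
  then obtain a where a: "\<And>k. k < s1 \<Longrightarrow> a k \<in> S1"
      "\<And>k i. k < s1 \<Longrightarrow> i \<in> T \<Longrightarrow> a k i = (if i = R1 k then 1 else 0)" by metis
  define A1 where "A1 = (\<lambda>i k. a k i)"
  have inj1: "R1 k = R1 k' \<longleftrightarrow> k = k'" if "k < s1" "k' < s1" for k k'
    using R1 that unfolding bij_betw_def inj_on_def by auto
  have inj0: "R0 k = R0 k' \<longleftrightarrow> k = k'" if "k < q" "k' < q" for k k'
    using R0(1) that unfolding bij_betw_def inj_on_def by auto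
  have "inj_on (rcat q R0 R1) {..<q + s1}"
  proof (rule inj_onI)
    fix k k' assume k: "k \<in> {..<q + s1}" "k' \<in> {..<q + s1}" "rcat q R0 R1 k = rcat q R0 R1 k'"
    have ne: "R0 b \<noteq> R1 c" if "b < q" "c < s1" for b c using R1T[OF that(2)] R0R[OF that(1)] by auto
    show "k = k'"
    proof (cases "k < q"; cases "k' < q")
      assume "k < q" "k' < q" then show ?thesis using k inj0 by (simp add: rcat_def)
    next
      assume "k < q" "\<not> k' < q" then show ?thesis using k ne[of k "k' - q"] by (simp add: rcat_def)
    next
      assume kk: "\<not> k < q" "k' < q"
      then have "k - q < s1" using k(1) by auto
      from ne[OF kk(2) this] show ?thesis using k(3) kk by (simp add: rcat_def)
    next
      assume "\<not> k < q" "\<not> k' < q"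
      then show ?thesis using k inj1[of "k - q" "k' - q"] by (simp add: rcat_def)
    qed
  qed
  moreover have "\<forall>k<q + s1. rcat q R0 R1 k < n"
  proof (intro allI impI)
    fix k assume "k < q + s1"
    then have "rcat q R0 R1 k \<in> T"
      using R0R[of k] R1T[of "k - q"] T(1) by (auto simp: rcat_def)
    then show "rcat q R0 R1 k < n" using T(2) by auto
  qed
  moreover have "\<forall>k<s1. (\<lambda>i. A1 i k) \<in> S1" using a(1) by (simp add: A1_def)
  moreover have A1_0: "\<forall>k<q. \<forall>k'<s1. A1 (R0 k) k' = 0"
  proof (intro allI impI)
    fix k k' assume "k < q" "k' < s1"
    then have "R0 k \<in> T" "R0 k \<noteq> R1 k'" using R0R[of k] R1T[of k'] T(1) by auto
    then show "A1 (R0 k) k' = 0" using a(2)[OF \<open>k' < s1\<close>] by (simp add: A1_def)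
  qed
  moreover have A1_1: "\<forall>k<s1. \<forall>k'<s1. A1 (R1 k) k' = (if k = k' then 1 else 0)"
  proof (intro allI impI)
    fix k k' assume "k < s1" "k' < s1"
    then show "A1 (R1 k) k' = (if k = k' then 1 else 0)"
      using a(2)[OF \<open>k' < s1\<close>, of "R1 k"] R1T[of k] inj1[of k k'] by (simp add: A1_def)
  qed
  moreover have "\<exists>y. \<forall>i<n. s i = (\<Sum>k<q + s1. vcat q A0 A1 i k * y k)" if s: "s \<in> S1" for s
  proof -
    \<comment> \<open>\<open>A0\<close> is not normalised at the added rows, so its contribution
      there is subtracted before the coefficient of \<open>A1\<close> is read off.\<close>
    define c where "c = (\<lambda>k. s (R1 k) - (\<Sum>k'<q. A0 (R1 k) k' * s (R0 k')))"
    define y where "y = (\<lambda>k. if k < q then s (R0 k) else c (k - q))"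
    define w where "w = (\<lambda>i. s i - (\<Sum>k<q + s1. vcat q A0 A1 i k * y k))"
    have sum_eq: "(\<Sum>k<q + s1. vcat q A0 A1 i k * y k) = (\<Sum>k<q. A0 i k * s (R0 k)) + (\<Sum>k<s1. A1 i k * c k)" for i
      unfolding sum_vcat by (simp add: y_def)
    have "(\<lambda>i. \<Sum>k\<in>{..<q + s1}. y k * vcat q A0 A1 i k) \<in> S1"
    proof (rule lin_closed_sum[OF S1])
      fix k assume "k \<in> {..<q + s1}"
      then show "(\<lambda>i. vcat q A0 A1 i k) \<in> S1"
        using A0(1)[of k] S0(2) a(1)[of "k - q"] by (cases "k < q") (auto simp: vcat_def A1_def)
    qed simp
    then have "(\<lambda>i. 1 * s i + (- 1) * (\<Sum>k\<in>{..<q + s1}. y k * vcat q A0 A1 i k)) \<in> S1"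
      by (rule lin_closedD[OF S1 s])
    then have "w \<in> S1" by (simp add: w_def mult.commute)
    moreover have "w i = 0" if i: "i \<in> T" for i
    proof (cases "i \<in> R")
      case True
      then obtain k where k: "k < q" "i = R0 k" using R0(1) unfolding bij_betw_def by auto
      have "(\<Sum>k'<q. A0 i k' * s (R0 k')) = (\<Sum>k'<q. if k' = k then s (R0 k') else 0)"
        using A0(2) k by (intro sum.cong) auto
      moreover have "(\<Sum>k'<s1. A1 i k' * c k') = 0" using A1_0 k by simp
      ultimately show ?thesis unfolding w_def sum_eq using k by simp
    next
      case False
      then obtain k where k: "k < s1" "i = R1 k" using R1 i unfolding bij_betw_def by auto
      have "(\<Sum>k'<s1. A1 i k' * c k') = (\<Sum>k'<s1. if k' = k then c k' else 0)"
        using A1_1 k by (intro sum.cong) auto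
      then have "(\<Sum>k'<s1. A1 i k' * c k') = c k" using k by simp
      then show ?thesis unfolding w_def sum_eq using k by (simp add: c_def)
    qed
    ultimately have "\<forall>i<n. w i = 0" using T(4) by blast
    then show ?thesis by (intro exI[of _ y]) (simp add: w_def)
  qed
  ultimately show ?thesis by blast
qed

text \<open>Pivot rows are chosen for the intersection \<open>S0\<close> of the column spaces of the
  two views and extended separately to each view. The block sizes \<open>q\<close>,
  \<open>s1\<close>, \<open>s2\<close> are what this choice yields; the three prescribed ranks
  identify them, once \<open>[A0 | A1 | A2]\<close> is known to be independent and to span the
  column space of \<open>V\<close>.\<close>

lemma rank_normal_form:
  assumes V: "V \<in> carrier_mat n (m1 + m2)"
    and rank: "mrank n (view1 n m1 V) = r1" "mrank n (view2 n m1 m2 V) = r2" "mrank n V = r"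
  shows "\<exists>R0 R1 R2 A0 A1 A2 X Y. chart n (r1 + r2 - r) (r - r2) (r - r1) R0 R1 R2 \<and>
     normalised (r1 + r2 - r) (r - r2) (r - r1) R0 R1 R2 A0 A1 A2 \<and>
     (\<forall>i<n. \<forall>j<m1. V $$ (i, j) = (\<Sum>k<r1. vcat (r1 + r2 - r) A0 A1 i k * X j k)) \<and>
     (\<forall>i<n. \<forall>j<m2. V $$ (i, m1 + j) = (\<Sum>k<r2. vcat (r1 + r2 - r) A0 A2 i k * Y j k))"
proof -
  define S1 where "S1 = {s. \<exists>y. \<forall>i<n. s i = (\<Sum>j<m1. V $$ (i, j) * y j)}"
  define S2 where "S2 = {s. \<exists>y. \<forall>i<n. s i = (\<Sum>j<m2. V $$ (i, m1 + j) * y j)}"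
  have closed: "lin_closed {s. \<exists>y. \<forall>i<n. s i = (\<Sum>j<m. W i j * y j)}" for W :: "nat \<Rightarrow> nat \<Rightarrow> real" and m
    unfolding lin_closed_def
  proof (intro conjI ballI allI)
    fix s w :: "nat \<Rightarrow> real" and a b :: real
    assume "s \<in> {s. \<exists>y. \<forall>i<n. s i = (\<Sum>j<m. W i j * y j)}" "w \<in> {s. \<exists>y. \<forall>i<n. s i = (\<Sum>j<m. W i j * y j)}"
    then obtain y z where yz: "\<forall>i<n. s i = (\<Sum>j<m. W i j * y j)" "\<forall>i<n. w i = (\<Sum>j<m. W i j * z j)" by blast
    have "a * (\<Sum>j<m. W i j * y j) + b * (\<Sum>j<m. W i j * z j) = (\<Sum>j<m. W i j * (a * y j + b * z j))" for i
      unfolding sum_distrib_left sum.distrib[symmetric] by (intro sum.cong refl) (simp add: algebra_simps)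
    then show "(\<lambda>i. a * s i + b * w i) \<in> {s. \<exists>y. \<forall>i<n. s i = (\<Sum>j<m. W i j * y j)}"
      using yz by (intro CollectI exI[of _ "\<lambda>j. a * y j + b * z j"]) simp
  qed (auto intro!: exI[of _ "\<lambda>_. 0"])
  have c1: "lin_closed S1" and c2: "lin_closed S2"
    unfolding S1_def S2_def by (rule closed)+
  define S0 where "S0 = S1 \<inter> S2"
  have c0: "lin_closed S0" using c1 c2 unfolding S0_def lin_closed_def by blast
  have "dual_on S0 {}" by (simp add: dual_on_def)
  from row_basis[where n = n, OF c0 empty_subsetI this] obtain R where R: "R \<subseteq> {..<n}" "dual_on S0 R"
      "\<forall>s\<in>S0. (\<forall>i\<in>R. s i = 0) \<longrightarrow> (\<forall>i<n. s i = 0)" by (elim exE conjE)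
  define q where "q = card R"
  have "finite R" using R(1) finite_subset by blast
  from ex_bij_betw_nat_finite[OF this] obtain R0 where R0: "bij_betw R0 {..<q} R"
    by (auto simp: q_def atLeast0LessThan)
  have R0R: "R0 k \<in> R" if "k < q" for k using R0 that bij_betwE by blast
  have inj0: "R0 k = R0 k' \<longleftrightarrow> k = k'" if "k < q" "k' < q" for k k'
    using R0 that unfolding bij_betw_def inj_on_def by auto
  have "\<exists>s\<in>S0. \<forall>i\<in>R. s i = (if i = R0 k then 1 else 0)" if "k < q" for k
    using R(2) R0R[OF that] unfolding dual_on_def by blast
  then obtain a0 where a0: "\<And>k. k < q \<Longrightarrow> a0 k \<in> S0"
      "\<And>k i. k < q \<Longrightarrow> i \<in> R \<Longrightarrow> a0 k i = (if i = R0 k then 1 else 0)" by metis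
  define A0 where "A0 = (\<lambda>i k. a0 k i)"
  have A0: "(\<lambda>i. A0 i k) \<in> S0" if "k < q" for k using a0(1)[OF that] by (simp add: A0_def)
  have A0_1: "A0 (R0 k) k' = (if k = k' then 1 else 0)" if "k < q" "k' < q" for k k'
    using a0(2)[OF that(2) R0R[OF that(1)]] inj0[OF that] by (simp add: A0_def)
  have A0_all: "\<forall>k<q. (\<lambda>i. A0 i k) \<in> S0" "\<forall>k<q. \<forall>k'<q. A0 (R0 k) k' = (if k = k' then 1 else 0)"
    using A0 A0_1 by blast+
  have sub: "S0 \<subseteq> S1" "S0 \<subseteq> S2" by (auto simp: S0_def)
  from adapted_basis[OF c1 c0 sub(1) R0 R(1,2) A0_all]
  obtain s1 R1 A1 where v1: "inj_on (rcat q R0 R1) {..<q + s1}" "\<forall>k<q + s1. rcat q R0 R1 k < n"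
     "\<forall>k<s1. (\<lambda>i. A1 i k) \<in> S1" "\<forall>k<q. \<forall>k'<s1. A1 (R0 k) k' = 0"
     "\<forall>k<s1. \<forall>k'<s1. A1 (R1 k) k' = (if k = k' then 1 else 0)"
     "\<forall>s\<in>S1. \<exists>y. \<forall>i<n. s i = (\<Sum>k<q + s1. vcat q A0 A1 i k * y k)" by (elim exE conjE)
  from adapted_basis[OF c2 c0 sub(2) R0 R(1,2) A0_all]
  obtain s2 R2 A2 where v2: "inj_on (rcat q R0 R2) {..<q + s2}" "\<forall>k<q + s2. rcat q R0 R2 k < n"
     "\<forall>k<s2. (\<lambda>i. A2 i k) \<in> S2" "\<forall>k<q. \<forall>k'<s2. A2 (R0 k) k' = 0"
     "\<forall>k<s2. \<forall>k'<s2. A2 (R2 k) k' = (if k = k' then 1 else 0)"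
     "\<forall>s\<in>S2. \<exists>y. \<forall>i<n. s i = (\<Sum>k<q + s2. vcat q A0 A2 i k * y k)" by (elim exE conjE)
  have ch: "chart n q s1 s2 R0 R1 R2" using v1(1,2) v2(1,2) by (simp add: chart_def)
  have nrm: "normalised q s1 s2 R0 R1 R2 A0 A1 A2"
    unfolding normalised_def using A0_1 v1(4,5) v2(4,5) by blast
  have indep2: "z k = 0"
    if z: "\<And>i. i < n \<Longrightarrow> (\<Sum>k<q + s. vcat q A0 B i k * z k) = 0" and k: "k < q + s"
      and B: "\<forall>k<q. \<forall>k'<s. B (R0 k) k' = 0" "\<forall>k<s. \<forall>k'<s. B (T k) k' = (if k = k' then 1 else 0)"
        "\<forall>k<s. T k < n"
    for B :: "nat \<Rightarrow> nat \<Rightarrow> real" and s T z k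
  proof -
    have z0: "z k = 0" if "k < q" for k
    proof -
      have "R0 k < n" using R0R[OF that] R(1) by auto
      moreover have "(\<Sum>k'<q. A0 (R0 k) k' * z k') = (\<Sum>k'<q. if k' = k then z k' else 0)"
        using A0_1 that by (intro sum.cong) auto
      ultimately show ?thesis using z[of "R0 k"] that B(1) unfolding sum_vcat by simp
    qed
    have z1: "z (q + k) = 0" if "k < s" for k
    proof -
      have "(\<Sum>k'<s. B (T k) k' * z (q + k')) = (\<Sum>k'<s. if k' = k then z (q + k') else 0)"
        using B(2) that by (intro sum.cong) auto
      then show ?thesis using z[of "T k"] that B(3) z0 unfolding sum_vcat by simp
    qed
    show ?thesis using z0[of k] z1[of "k - q"] k by (cases "k < q") auto
  qed
  have R1n: "\<forall>k<s1. R1 k < n" and R2n: "\<forall>k<s2. R2 k < n"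
    using chartD(2,3)[OF ch] by blast+
  have in1: "(\<lambda>i. vcat q A0 A1 i k) \<in> S1" if "k < q + s1" for k
    using A0[of k] sub(1) v1(3) that by (cases "k < q") (auto simp: vcat_def)
  have in2: "(\<lambda>i. vcat q A0 A2 i k) \<in> S2" if "k < q + s2" for k
    using A0[of k] sub(2) v2(3) that by (cases "k < q") (auto simp: vcat_def)
  have delta: "(\<Sum>j'<m. W j' * (if j' = j then 1 else 0)) = W j" if "j < m" for W :: "nat \<Rightarrow> real" and j m
    using that by (simp add: if_distrib[where f = "\<lambda>c. _ * c"] cong: if_cong)
  have col1: "(\<lambda>i. V $$ (i, j)) \<in> S1" if "j < m1" for j
    unfolding S1_def using delta[OF that] by (intro CollectI exI[of _ "\<lambda>j'. if j' = j then 1 else 0"]) simp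
  have col2: "(\<lambda>i. V $$ (i, m1 + j)) \<in> S2" if "j < m2" for j
    unfolding S2_def using delta[OF that] by (intro CollectI exI[of _ "\<lambda>j'. if j' = j then 1 else 0"]) simp
  have V1: "\<exists>y. \<forall>i<n. V $$ (i, j) = (\<Sum>k<q + s1. vcat q A0 A1 i k * y k)" if "j < m1" for j
    using bspec[OF v1(6) col1[OF that]] .
  have V2: "\<exists>y. \<forall>i<n. V $$ (i, m1 + j) = (\<Sum>k<q + s2. vcat q A0 A2 i k * y k)" if "j < m2" for j
    using bspec[OF v2(6) col2[OF that]] .
  have "mrank n (view1 n m1 V) = q + s1"
  proof (rule mrank_eq_card)
    show "view1 n m1 V \<in> carrier_mat n m1" by (simp add: view1_def)
    show "z k = 0" if "\<And>i. i < n \<Longrightarrow> (\<Sum>k<q + s1. vcat q A0 A1 i k * z k) = 0" "k < q + s1" for z k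
      using indep2[OF that v1(4,5) R1n] .
    show "\<exists>y. \<forall>i<n. view1 n m1 V $$ (i, j) = (\<Sum>k<q + s1. vcat q A0 A1 i k * y k)" if "j < m1" for j
      using V1[OF that] that by (simp add: view1_def)
    show "\<exists>y. \<forall>i<n. vcat q A0 A1 i k = (\<Sum>j<m1. view1 n m1 V $$ (i, j) * y j)" if "k < q + s1" for k
      using in1[OF that] by (simp add: view1_def S1_def)
  qed
  then have e1: "r1 = q + s1" using rank by simp
  have "mrank n (view2 n m1 m2 V) = q + s2"
  proof (rule mrank_eq_card)
    show "view2 n m1 m2 V \<in> carrier_mat n m2" by (simp add: view2_def)
    show "z k = 0" if "\<And>i. i < n \<Longrightarrow> (\<Sum>k<q + s2. vcat q A0 A2 i k * z k) = 0" "k < q + s2" for z k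
      using indep2[OF that v2(4,5) R2n] .
    show "\<exists>y. \<forall>i<n. view2 n m1 m2 V $$ (i, j) = (\<Sum>k<q + s2. vcat q A0 A2 i k * y k)" if "j < m2" for j
      using V2[OF that] that by (simp add: view2_def)
    show "\<exists>y. \<forall>i<n. vcat q A0 A2 i k = (\<Sum>j<m2. view2 n m1 m2 V $$ (i, j) * y j)" if "k < q + s2" for k
      using in2[OF that] by (simp add: view2_def S2_def)
  qed
  then have e2: "r2 = q + s2" using rank by simp
  have split3: "(\<Sum>k<q + s1 + s2. vcat (q + s1) (vcat q A0 A1) A2 i k * z k)
      = (\<Sum>k<q + s1. vcat q A0 A1 i k * z k) + (\<Sum>k<s2. A2 i k * z (q + s1 + k))" for i z
    by (rule sum_vcat)
  have "mrank n V = q + s1 + s2"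
  proof (rule mrank_eq_card[OF V])
    show "z k = 0"
      if z: "\<And>i. i < n \<Longrightarrow> (\<Sum>k<q + s1 + s2. vcat (q + s1) (vcat q A0 A1) A2 i k * z k) = 0"
        and k: "k < q + s1 + s2" for z k
    proof -
      \<comment> \<open>In a vanishing combination the part from \<open>A1\<close> is minus the part
        from \<open>[A0 | A2]\<close>, hence lies in both column spaces. It vanishes at the pivot
        rows of the intersection, so it is zero.\<close>
      define w where "w = (\<lambda>i. \<Sum>k\<in>{..<s1}. z (q + k) * A1 i k)"
      define w' where "w' = (\<lambda>i. \<Sum>k\<in>{..<q + s2}. - z (if k < q then k else k + s1) * vcat q A0 A2 i k)"
      have wS1: "w \<in> S1" unfolding w_def using v1(3) by (intro lin_closed_sum[OF c1]) auto
      have "w' \<in> S2" unfolding w'_def using in2 by (intro lin_closed_sum[OF c2]) auto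
      have ww': "w i = w' i" if "i < n" for i
      proof -
        have "w' i = (\<Sum>k<q + s2. vcat q A0 A2 i k * (- z (if k < q then k else k + s1)))"
          unfolding w'_def by (intro sum.cong) auto
        also have "\<dots> = - (\<Sum>k<q. A0 i k * z k) - (\<Sum>k<s2. A2 i k * z (q + k + s1))"
          unfolding sum_vcat by (simp add: sum_negf)
        finally show ?thesis
          using z[OF that] unfolding split3 sum_vcat w_def by (simp add: ac_simps)
      qed
      have "w \<in> S2" using \<open>w' \<in> S2\<close> ww' unfolding S2_def by simp
      then have "w \<in> S0" using wS1 by (simp add: S0_def)
      moreover have "\<forall>i\<in>R. w i = 0"
      proof
        fix i assume "i \<in> R"
        then obtain b where "b < q" "i = R0 b" using R0 unfolding bij_betw_def by auto
        then show "w i = 0" using v1(4) by (simp add: w_def)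
      qed
      ultimately have w0: "\<forall>i<n. w i = 0" using R(3) by blast
      have z1: "z (q + b) = 0" if "b < s1" for b
      proof -
        have "w (R1 b) = (\<Sum>k<s1. if k = b then z (q + k) else 0)"
          unfolding w_def using v1(5) that by (intro sum.cong) auto
        then show ?thesis using w0 R1n that by simp
      qed
      define z' where "z' = (\<lambda>k. z (if k < q then k else k + s1))"
      have z'0: "(\<Sum>k<q + s2. vcat q A0 A2 i k * z' k) = 0" if "i < n" for i
        using z[OF that] z1 unfolding split3 sum_vcat z'_def by (simp add: ac_simps)
      have z'1: "z' b = 0" if "b < q + s2" for b
        by (rule indep2[OF z'0 that v2(4,5) R2n])
      consider "k < q" | "q \<le> k" "k < q + s1" | "q + s1 \<le> k" by linarith
      then show ?thesis
      proof cases
        case 1 then show ?thesis using z'1[of k] by (simp add: z'_def)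
      next
        case 2 then show ?thesis using z1[of "k - q"] by simp
      next
        case 3
        then obtain b where "k = q + s1 + b" using le_Suc_ex by blast
        then show ?thesis using z'1[of "q + b"] k by (simp add: z'_def ac_simps)
      qed
    qed
    show "\<exists>y. \<forall>i<n. V $$ (i, j) = (\<Sum>k<q + s1 + s2. vcat (q + s1) (vcat q A0 A1) A2 i k * y k)"
      if "j < m1 + m2" for j
    proof (cases "j < m1")
      case True
      then obtain y where y: "\<forall>i<n. V $$ (i, j) = (\<Sum>k<q + s1. vcat q A0 A1 i k * y k)" using V1 by blast
      then show ?thesis
        unfolding split3 by (intro exI[of _ "\<lambda>k. if k < q + s1 then y k else 0"]) simp
    next
      case False
      then have "j - m1 < m2" using that by linarith
      from V2[OF this] obtain y
        where y: "\<forall>i<n. V $$ (i, m1 + (j - m1)) = (\<Sum>k<q + s2. vcat q A0 A2 i k * y k)" ..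
      then show ?thesis
        using False unfolding split3 sum_vcat
        by (intro exI[of _ "\<lambda>k. if k < q then y k else if k < q + s1 then 0 else y (k - s1)"])
          (simp add: ac_simps)
    qed
    show "\<exists>y. \<forall>i<n. vcat (q + s1) (vcat q A0 A1) A2 i k = (\<Sum>j<m1 + m2. V $$ (i, j) * y j)"
      if k: "k < q + s1 + s2" for k
    proof (cases "k < q + s1")
      case True
      then obtain y where "\<forall>i<n. vcat q A0 A1 i k = (\<Sum>j<m1. V $$ (i, j) * y j)"
        using in1 by (auto simp: S1_def)
      then show ?thesis
        unfolding sum_lessThan_add using True
        by (intro exI[of _ "\<lambda>j. if j < m1 then y j else 0"]) (simp add: vcat_def)
    next
      case False
      then have "k - (q + s1) < s2" using k by simp
      then obtain y where "\<forall>i<n. A2 i (k - (q + s1)) = (\<Sum>j<m2. V $$ (i, m1 + j) * y j)"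
        using v2(3) by (auto simp: S2_def)
      then show ?thesis
        unfolding sum_lessThan_add using False
        by (intro exI[of _ "\<lambda>j. if j < m1 then 0 else y (j - m1)"]) (simp add: vcat_def)
    qed
  qed
  then have e3: "r = q + s1 + s2" using rank by simp
  have e: "r1 + r2 - r = q" "r - r2 = s1" "r - r1 = s2" using e1 e2 e3 by simp_all
  have "\<forall>j. \<exists>y. j < m1 \<longrightarrow> (\<forall>i<n. V $$ (i, j) = (\<Sum>k<q + s1. vcat q A0 A1 i k * y k))"
    using V1 by simp
  from choice[OF this] obtain X where
    X: "\<forall>j<m1. \<forall>i<n. V $$ (i, j) = (\<Sum>k<q + s1. vcat q A0 A1 i k * X j k)" by (elim exE)
  have "\<forall>j. \<exists>y. j < m2 \<longrightarrow> (\<forall>i<n. V $$ (i, m1 + j) = (\<Sum>k<q + s2. vcat q A0 A2 i k * y k))"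
    using V2 by simp
  from choice[OF this] obtain Y where
    Y: "\<forall>j<m2. \<forall>i<n. V $$ (i, m1 + j) = (\<Sum>k<q + s2. vcat q A0 A2 i k * Y j k)" by (elim exE)
  have "\<forall>i<n. \<forall>j<m1. V $$ (i, j) = (\<Sum>k<r1. vcat q A0 A1 i k * X j k)"
    unfolding e1 using X by blast
  moreover have "\<forall>i<n. \<forall>j<m2. V $$ (i, m1 + j) = (\<Sum>k<r2. vcat q A0 A2 i k * Y j k)"
    unfolding e2 using Y by blast
  ultimately show ?thesis
    unfolding e using ch nrm by (intro exI conjI)
qed

section \<open>Finiteness of generic fibres\<close>

text \<open>The linearisation of the completion problem at the bases \<open>A0\<close>, \<open>A1\<close>, \<open>A2\<close> and the
  coefficients \<open>C1\<close>, \<open>C2\<close> has trivial kernel.\<close>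

definition rigid :: "nat \<Rightarrow> nat \<Rightarrow> nat \<Rightarrow> nat \<Rightarrow> (nat \<Rightarrow> nat) \<Rightarrow> (nat \<Rightarrow> nat) \<Rightarrow> (nat \<Rightarrow> nat) \<Rightarrow> nat \<Rightarrow> nat \<Rightarrow>
    (nat \<Rightarrow> nat set) \<Rightarrow> (nat \<Rightarrow> nat set) \<Rightarrow> (nat \<Rightarrow> nat \<Rightarrow> real) \<Rightarrow> (nat \<Rightarrow> nat \<Rightarrow> real) \<Rightarrow> (nat \<Rightarrow> nat \<Rightarrow> real) \<Rightarrow>
    (nat \<Rightarrow> nat \<Rightarrow> real) \<Rightarrow> (nat \<Rightarrow> nat \<Rightarrow> real) \<Rightarrow> bool" where
  "rigid n q s1 s2 R0 R1 R2 ma mb Oma Omb A0 A1 A2 C1 C2 \<longleftrightarrow> (\<forall>D0 D1 D2 dX dY.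
     (\<forall>k<q. (\<forall>k'<q. D0 (R0 k) k' = 0) \<and> (\<forall>k'<s1. D1 (R0 k) k' = 0) \<and> (\<forall>k'<s2. D2 (R0 k) k' = 0)) \<longrightarrow>
     (\<forall>k<s1. \<forall>k'<s1. D1 (R1 k) k' = 0) \<longrightarrow> (\<forall>k<s2. \<forall>k'<s2. D2 (R2 k) k' = 0) \<longrightarrow>
     (\<forall>j<ma. \<forall>i\<in>Oma j. (\<Sum>k<q + s1. vcat q D0 D1 i k * C1 k j) + (\<Sum>k<q + s1. vcat q A0 A1 i k * dX k j) = 0) \<longrightarrow>
     (\<forall>j<mb. \<forall>i\<in>Omb j. (\<Sum>k<q + s2. vcat q D0 D2 i k * C2 k j) + (\<Sum>k<q + s2. vcat q A0 A2 i k * dY k j) = 0) \<longrightarrow>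
     (\<forall>i<n. (\<forall>k<q. D0 i k = 0) \<and> (\<forall>k<s1. D1 i k = 0) \<and> (\<forall>k<s2. D2 i k = 0)) \<and>
     (\<forall>j<ma. \<forall>k<q + s1. dX k j = 0) \<and> (\<forall>j<mb. \<forall>k<q + s2. dY k j = 0))"

text \<open>Lets whichever view has enough columns play the part of the first one.\<close>

lemma rigid_swap:
  assumes "rigid n q s1 s2 R0 R1 R2 ma mb Oma Omb A0 A1 A2 C1 C2"
  shows "rigid n q s2 s1 R0 R2 R1 mb ma Omb Oma A0 A2 A1 C2 C1"
  unfolding rigid_def
proof (intro allI impI, goal_cases)
  case (1 D0 D1 D2 dX dY)
  show ?case
    using assms[unfolded rigid_def, THEN spec[of _ D0], THEN spec[of _ D2], THEN spec[of _ D1],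
        THEN spec[of _ dY], THEN spec[of _ dX]] 1 by meson
qed

text \<open>The coefficients of columns beyond the groups vary as well; therefore the joint
  independence on the observed rows is demanded of every column of both views.\<close>

lemma exists_rigid:
  assumes ch: "chart n q s1 s2 R0 R1 R2"
    and Oma: "\<And>j. j < ma \<Longrightarrow> Oma j \<subseteq> {..<n} \<and> q + s1 + s2 \<le> card (Oma j)"
    and Omb: "\<And>j. j < mb \<Longrightarrow> Omb j \<subseteq> {..<n} \<and> q + s1 + s2 \<le> card (Omb j)"
    and N1: "0 < N1" "2 * N1 \<le> n - (q + s1)" "(q + s1) * N1 \<le> ma"
    and N2: "0 < N2" "2 * N2 \<le> n - (q + s2)" "q + s2 * N2 \<le> mb"
    and hall1: "\<And>c. c < q + s1 \<Longrightarrow> hall_ok n (q + s1) N1 (\<lambda>t. Oma (c * N1 + t))"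
    and hall2: "\<And>c. c < s2 \<Longrightarrow> hall_ok n (q + s2) N2 (\<lambda>t. Omb (q + (c * N2 + t)))"
  shows "\<exists>A0 A1 A2 C1 C2. normalised q s1 s2 R0 R1 R2 A0 A1 A2 \<and>
     rigid n q s1 s2 R0 R1 R2 ma mb Oma Omb A0 A1 A2 C1 C2"
proof -
  have idx1: "c * N1 + t < ma" if "c < q + s1" "t < N1" for c t
    using block_index[OF that] N1(3) by simp
  have idx2: "q + (c * N2 + t) < mb" if "c < s2" "t < N2" for c t
    using block_index[OF that] N2(3) by simp
  have "\<exists>A0 A1 A2. normalised q s1 s2 R0 R1 R2 A0 A1 A2 \<and>
     (\<forall>c<q + s1. detects n (q + s1) N1 (rcat q R0 R1) (\<lambda>t. Oma (c * N1 + t)) (vcat q A0 A1)) \<and>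
     (\<forall>c<s2. detects n (q + s2) N2 (rcat q R0 R2) (\<lambda>t. Omb (q + (c * N2 + t))) (vcat q A0 A2)) \<and>
     (\<forall>T\<in>Oma ` {..<ma} \<union> Omb ` {..<mb}. col_injective (q + s1 + s2) T (vcat (q + s1) (vcat q A0 A1) A2))"
  proof (rule exists_generic_frame[OF ch])
    show "finite (Oma ` {..<ma} \<union> Omb ` {..<mb})" by simp
    show "T \<subseteq> {..<n} \<and> q + s1 + s2 \<le> card T" if "T \<in> Oma ` {..<ma} \<union> Omb ` {..<mb}" for T
      using that Oma Omb by auto
    show "Oma (c * N1 + t) \<subseteq> {..<n} \<and> q + s1 \<le> card (Oma (c * N1 + t))" if "c < q + s1" "t < N1" for c t
      using Oma[OF idx1[OF that]] by linarith
    show "Omb (q + (c * N2 + t)) \<subseteq> {..<n} \<and> q + s2 \<le> card (Omb (q + (c * N2 + t)))" if "c < s2" "t < N2" for c t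
      using Omb[OF idx2[OF that]] by linarith
  qed (fact hall1 hall2 N1 N2)+
  then obtain A0 A1 A2 where A: "normalised q s1 s2 R0 R1 R2 A0 A1 A2"
     "\<forall>c<q + s1. detects n (q + s1) N1 (rcat q R0 R1) (\<lambda>t. Oma (c * N1 + t)) (vcat q A0 A1)"
     "\<forall>c<s2. detects n (q + s2) N2 (rcat q R0 R2) (\<lambda>t. Omb (q + (c * N2 + t))) (vcat q A0 A2)"
     "\<forall>T\<in>Oma ` {..<ma} \<union> Omb ` {..<mb}. col_injective (q + s1 + s2) T (vcat (q + s1) (vcat q A0 A1) A2)"
    by (elim exE conjE)
  have "rigid n q s1 s2 R0 R1 R2 ma mb Oma Omb A0 A1 A2 (coeff1 N1) (coeff2 q N2)"
    unfolding rigid_def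
  proof (intro allI impI, goal_cases)
    case (1 D0 D1 D2 dX dY)
    show ?case
    proof (rule jacobian_injective[OF A(1) ch N1(1,3) N2(1,3)])
      show "Oma j \<subseteq> {..<n}" if "j < ma" for j using Oma[OF that] by blast
      show "Omb j \<subseteq> {..<n}" if "j < mb" for j using Omb[OF that] by blast
      show "detects n (q + s1) N1 (rcat q R0 R1) (\<lambda>t. Oma (c * N1 + t)) (vcat q A0 A1)" if "c < q + s1" for c
        using A(2) that by blast
      show "detects n (q + s2) N2 (rcat q R0 R2) (\<lambda>t. Omb (q + (c * N2 + t))) (vcat q A0 A2)" if "c < s2" for c
        using A(3) that by blast
      show "col_injective (q + s1 + s2) (Oma j) (vcat (q + s1) (vcat q A0 A1) A2)" if "j < ma" for j
        using A(4) that by blast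
      show "col_injective (q + s1 + s2) (Omb j) (vcat (q + s1) (vcat q A0 A1) A2)" if "j < mb" for j
        using A(4) that by blast
      show "(\<Sum>k<q + s1. vcat q D0 D1 i k * coeff1 N1 k j) + (\<Sum>k<q + s1. vcat q A0 A1 i k * dX k j) = 0"
        if "j < ma" "i \<in> Oma j" for j i using 1(4) that by blast
      show "(\<Sum>k<q + s2. vcat q D0 D2 i k * coeff2 q N2 k j) + (\<Sum>k<q + s2. vcat q A0 A2 i k * dY k j) = 0"
        if "j < mb" "i \<in> Omb j" for j i using 1(5) that by blast
    qed (use 1(1-3) in blast)+
  qed
  then show ?thesis using A(1) by (intro exI conjI)
qed

text \<open>For \<open>x = y\<close> this is an entry of the parametrised matrix. Separating the
  bases, taken from \<open>x\<close>, from the coefficients, taken from \<open>y\<close>, makes the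
  expansion into constant, linear and quadratic part a matter of bilinearity.\<close>

definition bilin :: "nat \<Rightarrow> nat \<Rightarrow> nat \<Rightarrow> nat \<Rightarrow> (nat \<times> nat \<times> nat \<Rightarrow> real) \<Rightarrow>
    (nat \<times> nat \<times> nat \<Rightarrow> real) \<Rightarrow> nat \<Rightarrow> nat \<Rightarrow> real" where
  "bilin q m1 r1 r2 x y i j = (if j < m1
     then \<Sum>k<r1. vcat q (\<lambda>i k. x (0, i, k)) (\<lambda>i k. x (1, i, k)) i k * y (3, k, j)
     else \<Sum>k<r2. vcat q (\<lambda>i k. x (0, i, k)) (\<lambda>i k. x (2, i, k)) i k * y (4, k, j - m1))"

lemma bilin_left:
  "bilin q m1 r1 r2 (\<lambda>u. a * x u + b * w u) y i j = a * bilin q m1 r1 r2 x y i j + b * bilin q m1 r1 r2 w y i j"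
proof -
  have "(\<Sum>k<m. vcat q (\<lambda>i k. a * x (0, i, k) + b * w (0, i, k))
        (\<lambda>i k. a * x (t, i, k) + b * w (t, i, k)) i k * y (c, k, l))
      = a * (\<Sum>k<m. vcat q (\<lambda>i k. x (0, i, k)) (\<lambda>i k. x (t, i, k)) i k * y (c, k, l))
        + b * (\<Sum>k<m. vcat q (\<lambda>i k. w (0, i, k)) (\<lambda>i k. w (t, i, k)) i k * y (c, k, l))" for m t c l
    unfolding sum_distrib_left sum.distrib[symmetric]
    by (intro sum.cong refl) (simp add: vcat_def distrib_left distrib_right mult.assoc mult.left_commute)
  then show ?thesis by (simp add: bilin_def)
qed

lemma bilin_right:
  "bilin q m1 r1 r2 x (\<lambda>u. a * y u + b * w u) i j = a * bilin q m1 r1 r2 x y i j + b * bilin q m1 r1 r2 x w i j"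
proof -
  have "(\<Sum>k<m. vcat q (\<lambda>i k. x (0, i, k)) (\<lambda>i k. x (t, i, k)) i k * (a * y (c, k, l) + b * w (c, k, l)))
      = a * (\<Sum>k<m. vcat q (\<lambda>i k. x (0, i, k)) (\<lambda>i k. x (t, i, k)) i k * y (c, k, l))
        + b * (\<Sum>k<m. vcat q (\<lambda>i k. x (0, i, k)) (\<lambda>i k. x (t, i, k)) i k * w (c, k, l))" for m t c l
    unfolding sum_distrib_left sum.distrib[symmetric]
    by (intro sum.cong refl) (simp add: vcat_def distrib_left distrib_right mult.assoc mult.left_commute)
  then show ?thesis by (simp add: bilin_def)
qed

lemma bilin_cong:
  assumes "\<And>k. k < q \<Longrightarrow> x (0, i, k) = x' (0, i, k)" "\<And>k. k < r1 - q \<Longrightarrow> x (1, i, k) = x' (1, i, k)"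
    and "\<And>k. k < r2 - q \<Longrightarrow> x (2, i, k) = x' (2, i, k)"
    and "\<And>k. j < m1 \<Longrightarrow> k < r1 \<Longrightarrow> y (3, k, j) = y' (3, k, j)"
    and "\<And>k. m1 \<le> j \<Longrightarrow> k < r2 \<Longrightarrow> y (4, k, j - m1) = y' (4, k, j - m1)"
  shows "bilin q m1 r1 r2 x y i j = bilin q m1 r1 r2 x' y' i j"
  unfolding bilin_def vcat_def using assms by (auto intro!: sum.cong)

lemma mpoly_deg_bilin:
  assumes "finite I" "\<And>u. mpoly_deg I 1 (\<lambda>h. P h u)"
  shows "mpoly_deg I 2 (\<lambda>h. bilin q m1 r1 r2 (P h) (P h) i j)"
proof -
  have prod: "mpoly_deg I 2 (\<lambda>h. P h u * P h v)" for u v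
    using mpoly_deg_mult[OF assms(1) assms(2)[of u] assms(2)[of v]] by (simp add: numeral_2_eq_2)
  have "mpoly_deg I 2 (\<lambda>h. vcat q (\<lambda>i k. P h (0, i, k)) (\<lambda>i k. P h (a, i, k)) i k * P h v)" for a k v
    using prod by (cases "k < q") (simp_all add: vcat_def)
  then show ?thesis
    unfolding bilin_def by (cases "j < m1") (simp_all add: mpoly_deg_sum assms(1))
qed

lemma mpoly_bilin:
  assumes "finite I" "\<And>u. u \<in> {0} \<times> {i} \<times> {..<q} \<union> {1} \<times> {i} \<times> {..<r1 - q} \<union> {2} \<times> {i} \<times> {..<r2 - q} \<Longrightarrow> u \<in> I"
    and "\<And>k. j < m1 \<Longrightarrow> k < r1 \<Longrightarrow> (3, k, j) \<in> I" "\<And>k. m1 \<le> j \<Longrightarrow> k < r2 \<Longrightarrow> (4, k, j - m1) \<in> I"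
  shows "mpoly I (\<lambda>p. bilin q m1 r1 r2 p p i j)"
proof -
  have v1: "mpoly I (\<lambda>p. vcat q (\<lambda>i k. p (0, i, k)) (\<lambda>i k. p (1, i, k)) i k)" if "k < r1" for k
    using assms(2) that by (cases "k < q") (auto simp: vcat_def intro!: mpoly_var assms(1))
  have v2: "mpoly I (\<lambda>p. vcat q (\<lambda>i k. p (0, i, k)) (\<lambda>i k. p (2, i, k)) i k)" if "k < r2" for k
    using assms(2) that by (cases "k < q") (auto simp: vcat_def intro!: mpoly_var assms(1))
  show ?thesis
  proof (cases "j < m1")
    case True
    have "mpoly I (\<lambda>p. \<Sum>k<r1. vcat q (\<lambda>i k. p (0, i, k)) (\<lambda>i k. p (1, i, k)) i k * p (3, k, j))"
      using assms(3)[OF True] by (intro mpoly_sum mpoly_mult v1 mpoly_var assms(1)) auto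
    then show ?thesis unfolding bilin_def using True by simp
  next
    case False
    have "mpoly I (\<lambda>p. \<Sum>k<r2. vcat q (\<lambda>i k. p (0, i, k)) (\<lambda>i k. p (2, i, k)) i k * p (4, k, j - m1))"
      using assms(4) False by (intro mpoly_sum mpoly_mult v2 mpoly_var assms(1)) auto
    then show ?thesis unfolding bilin_def using False by simp
  qed
qed

lemma finite_real_polynomial_roots_of_family:
  assumes "\<forall>z\<in>Z. (\<Sum>k\<le>K. c k * z ^ k) = (0 :: real)" "k \<le> K" "c k \<noteq> 0"
  shows "finite Z"
  by (rule finite_subset[OF _ real_polynomial_roots_finite[of K c]]) (use assms in auto)

lemma param_index_mem:
  "(0, i, k) \<in> param_index n m1 m2 r1 r2 r \<longleftrightarrow> i < n \<and> k < r1 + r2 - r"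
  "(1, i, k) \<in> param_index n m1 m2 r1 r2 r \<longleftrightarrow> i < n \<and> k < r - r2"
  "(Suc 0, i, k) \<in> param_index n m1 m2 r1 r2 r \<longleftrightarrow> i < n \<and> k < r - r2"
  "(2, i, k) \<in> param_index n m1 m2 r1 r2 r \<longleftrightarrow> i < n \<and> k < r - r1"
  "(3, i, k) \<in> param_index n m1 m2 r1 r2 r \<longleftrightarrow> i < r1 \<and> k < m1"
  "(4, i, k) \<in> param_index n m1 m2 r1 r2 r \<longleftrightarrow> i < r2 \<and> k < m2"
  by (auto simp: param_index_def)

lemma finite_param_index: "finite (param_index n m1 m2 r1 r2 r)"
  by (simp add: param_index_def)

lemma param_index_cases:
  assumes "u \<in> param_index n m1 m2 r1 r2 r"
  obtains a i k where "u = (a, i, k)" "a = 0 \<or> a = 1 \<or> a = 2 \<or> a = 3 \<or> a = 4"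
  using assms by (auto simp: param_index_def)

definition free_index :: "nat \<Rightarrow> nat \<Rightarrow> nat \<Rightarrow> nat \<Rightarrow> nat \<Rightarrow> nat \<Rightarrow> (nat \<Rightarrow> nat) \<Rightarrow> (nat \<Rightarrow> nat) \<Rightarrow> (nat \<Rightarrow> nat) \<Rightarrow>
    (nat \<times> nat \<times> nat) set" where
  "free_index n m1 m2 r1 r2 r R0 R1 R2 = param_index n m1 m2 r1 r2 r -
     ({0, 1, 2} \<times> R0 ` {..<r1 + r2 - r} \<times> UNIV \<union> {1} \<times> R1 ` {..<r - r2} \<times> UNIV \<union>
      {2} \<times> R2 ` {..<r - r1} \<times> UNIV)"

abbreviation norm_params :: "nat \<Rightarrow> nat \<Rightarrow> nat \<Rightarrow> (nat \<Rightarrow> nat) \<Rightarrow> (nat \<Rightarrow> nat) \<Rightarrow> (nat \<Rightarrow> nat) \<Rightarrow>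
    (nat \<times> nat \<times> nat \<Rightarrow> real) \<Rightarrow> bool" where
  "norm_params q s1 s2 R0 R1 R2 x \<equiv> normalised q s1 s2 R0 R1 R2
     (\<lambda>i k. x (0, i, k)) (\<lambda>i k. x (1, i, k)) (\<lambda>i k. x (2, i, k))"

lemma norm_params_fixed:
  assumes "norm_params (r1 + r2 - r) (r - r2) (r - r1) R0 R1 R2 x"
    and "norm_params (r1 + r2 - r) (r - r2) (r - r1) R0 R1 R2 y"
    and "u \<in> param_index n m1 m2 r1 r2 r - free_index n m1 m2 r1 r2 r R0 R1 R2"
  shows "x u = y u"
proof -
  have u: "u \<in> param_index n m1 m2 r1 r2 r"
    and nf: "u \<in> {0, 1, 2} \<times> R0 ` {..<r1 + r2 - r} \<times> UNIV \<union> {1} \<times> R1 ` {..<r - r2} \<times> UNIV \<union>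
      {2} \<times> R2 ` {..<r - r1} \<times> UNIV"
    using assms(3) unfolding free_index_def by blast+
  obtain a i k where uu: "u = (a, i, k)" "a = 0 \<or> a = 1 \<or> a = 2 \<or> a = 3 \<or> a = 4"
    using u by (rule param_index_cases)
  note x = assms(1)[unfolded normalised_def] and y = assms(2)[unfolded normalised_def]
  from nf consider l where "a = 0" "i = R0 l" "l < r1 + r2 - r" | l where "a = 1" "i = R0 l" "l < r1 + r2 - r"
    | l where "a = 2" "i = R0 l" "l < r1 + r2 - r" | l where "a = 1" "i = R1 l" "l < r - r2"
    | l where "a = 2" "i = R2 l" "l < r - r1"
    unfolding uu(1) by auto
  then show ?thesis
  proof cases
    case 1
    then have "k < r1 + r2 - r" using u by (simp add: uu param_index_mem)
    then show ?thesis using 1 x y unfolding uu(1) by simp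
  next
    case 2
    then have "k < r - r2" using u by (simp add: uu param_index_mem)
    then show ?thesis using 2 x y unfolding uu(1) by simp
  next
    case 3
    then have "k < r - r1" using u by (simp add: uu param_index_mem)
    then show ?thesis using 3 x y unfolding uu(1) by simp
  next
    case 4
    then have "k < r - r2" using u by (simp add: uu param_index_mem)
    then show ?thesis using 4 x y unfolding uu(1) by simp
  next
    case 5
    then have "k < r - r1" using u by (simp add: uu param_index_mem)
    then show ?thesis using 5 x y unfolding uu(1) by simp
  qed
qed

text \<open>On one chart the normalised parameters are the points \<open>x0 + res h\<close>, and the
  observed entries are quadratic in \<open>h\<close> with linear part \<open>J\<close>, which
  \<open>rigid\<close> makes injective. The resulting relation for the entry at \<open>i0\<close>,
  \<open>j0\<close> has coefficients that depend on the observed entries only, so it binds every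
  normalised \<open>p'\<close> with the same observed entries as \<open>p\<close>. One of its
  coefficients, read as a polynomial in the full, not normalised \<open>p\<close>, has a null zero
  set; off that set the relation is nontrivial.\<close>

lemma chart_fibre_finite:
  fixes n m1 m2 r r1 r2 :: nat
  defines "q \<equiv> r1 + r2 - r" and "s1 \<equiv> r - r2" and "s2 \<equiv> r - r1"
  assumes r: "r1 = q + s1" "r2 = q + s2"
    and norm: "normalised q s1 s2 R0 R1 R2 A0 A1 A2"
    and rig: "rigid n q s1 s2 R0 R1 R2 m1 m2 Om (\<lambda>j. Om (m1 + j)) A0 A1 A2 C1 C2"
    and Om: "\<And>j. j < m1 + m2 \<Longrightarrow> Om j \<subseteq> {..<n}" and ij: "i0 < n" "j0 < m1 + m2"
  shows "\<exists>N\<in>null_sets (param_measure n m1 m2 r1 r2 r). \<forall>p\<in>space (param_measure n m1 m2 r1 r2 r) - N.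
     finite {bilin q m1 r1 r2 p' p' i0 j0 | p'. norm_params q s1 s2 R0 R1 R2 p' \<and>
       (\<forall>j<m1 + m2. \<forall>i\<in>Om j. bilin q m1 r1 r2 p' p' i j = bilin q m1 r1 r2 p p i j)}"
proof -
  define I where "I = free_index n m1 m2 r1 r2 r R0 R1 R2"
  define PI where "PI = param_index n m1 m2 r1 r2 r"
  define Obs where "Obs = (SIGMA j:{..<m1 + m2}. Om j)"
  define x0 :: "nat \<times> nat \<times> nat \<Rightarrow> real" where "x0 = (\<lambda>(a, i, k). if a = 0 then A0 i k else if a = 1 then A1 i k
     else if a = 2 then A2 i k else if a = 3 then C1 i k else C2 i k)"
  define res where "res = (\<lambda>h u. if u \<in> I then h u else 0 :: real)"
  define E where "E = (\<lambda>x y i j. bilin q m1 r1 r2 x y i j)"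
  define P where "P = (\<lambda>h u. 1 * x0 u + 1 * res h u)"
  define f where "f = (\<lambda>v h. E (P h) (P h) (snd v) (fst v))"
  define J where "J = (\<lambda>v h. E (res h) x0 (snd v) (fst v) + E x0 (res h) (snd v) (fst v))"
  define Q where "Q = (\<lambda>v h. E (res h) (res h) (snd v) (fst v))"
  have x0s: "(\<lambda>i k. x0 (0, i, k)) = A0" "(\<lambda>i k. x0 (1, i, k)) = A1" "(\<lambda>i k. x0 (2, i, k)) = A2"
    "\<And>k j. x0 (3, k, j) = C1 k j" "\<And>k j. x0 (4, k, j) = C2 k j"
    by (simp_all add: x0_def fun_eq_iff)
  have finPI: "finite PI" by (simp add: PI_def finite_param_index)
  have IPI: "I \<subseteq> PI" by (auto simp: I_def PI_def free_index_def)
  have finI: "finite I" using finPI IPI finite_subset by blast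
  have finObs: "finite Obs" unfolding Obs_def using Om by (auto intro: finite_subset)
  have P_deg: "mpoly_deg I 1 (\<lambda>h. P h u)" for u
  proof (cases "u \<in> I")
    case True
    have "mpoly_deg I 1 (\<lambda>h. 1 * x0 u + 1 * h u)"
      using True by (intro mpoly_deg_add mpoly_deg_cmult mpoly_deg_const mpoly_deg_var finI) simp_all
    then show ?thesis using True by (simp add: P_def res_def)
  next
    case False
    then show ?thesis by (simp add: P_def res_def mpoly_deg_const finI)
  qed
  have E_deg: "mpoly_deg I 2 (\<lambda>h. E (P h) (P h) i j)" for i j
    unfolding E_def by (rule mpoly_deg_bilin[OF finI P_deg])
  have E_left: "E (\<lambda>u. a * x u + b * w u) y i j = a * E x y i j + b * E w y i j" for a x b w y i j
    unfolding E_def by (rule bilin_left)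
  have E_right: "E x (\<lambda>u. a * y u + b * w u) i j = a * E x y i j + b * E x w i j" for a x b w y i j
    unfolding E_def by (rule bilin_right)
  have P0: "P (\<lambda>_. 0) = x0" by (simp add: P_def res_def)
  have res_lin: "res (\<lambda>u. a * z u + b * w u) = (\<lambda>u. a * res z u + b * res w u)" for a z b w
    by (auto simp: res_def)
  have res_scale: "res (\<lambda>u. t * h u) = (\<lambda>u. t * res h u + 0 * res h u)" for t h
    by (auto simp: res_def)
  have "\<exists>K C. (\<forall>k\<le>K. mpoly Obs (C k)) \<and>
      (\<forall>h. (\<Sum>k\<le>K. C k (\<lambda>v. f v h) * E (P h) (P h) i0 j0 ^ k) = 0) \<and>
      (\<exists>k\<le>K. \<exists>h. C k (\<lambda>v. f v h) \<noteq> 0)"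
  proof (rule algebraic_relation[OF finI finObs, where J = J and q = Q])
    show "mpoly_deg I 2 (f v)" for v unfolding f_def by (rule E_deg)
    show "mpoly_deg I 2 (\<lambda>h. E (P h) (P h) i0 j0)" by (rule E_deg)
    show "f v h = f v (\<lambda>_. 0) + J v h + Q v h" for v h
      unfolding f_def P0 unfolding P_def E_left E_right J_def Q_def by simp
    show "Q v (\<lambda>k. t * h k) = t\<^sup>2 * Q v h" for v h t
      unfolding Q_def res_scale E_left E_right by (simp add: power2_eq_square)
    show "J v (\<lambda>i. a * z i + b * w i) = a * J v z + b * J v w" for v a z b w
      unfolding J_def res_lin E_left E_right by (simp add: algebra_simps)
    fix h u assume J0: "\<And>v. v \<in> Obs \<Longrightarrow> J v h = 0" and u: "u \<in> I"
    define D0 where "D0 = (\<lambda>i k. res h (0, i, k))"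
    define D1 where "D1 = (\<lambda>i k. res h (1, i, k))"
    define D2 where "D2 = (\<lambda>i k. res h (2, i, k))"
    define dX where "dX = (\<lambda>k j. res h (3, k, j))"
    define dY where "dY = (\<lambda>k j. res h (4, k, j))"
    have z0: "\<forall>k<q. (\<forall>k'<q. D0 (R0 k) k' = 0) \<and> (\<forall>k'<s1. D1 (R0 k) k' = 0) \<and> (\<forall>k'<s2. D2 (R0 k) k' = 0)"
      by (auto simp: D0_def D1_def D2_def res_def I_def free_index_def q_def)
    have z1: "\<forall>k<s1. \<forall>k'<s1. D1 (R1 k) k' = 0"
      by (auto simp: D1_def res_def I_def free_index_def s1_def)
    have z2: "\<forall>k<s2. \<forall>k'<s2. D2 (R2 k) k' = 0"
      by (auto simp: D2_def res_def I_def free_index_def s2_def)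
    have e1: "\<forall>j<m1. \<forall>i\<in>Om j. (\<Sum>k<q + s1. vcat q D0 D1 i k * C1 k j) + (\<Sum>k<q
        + s1. vcat q A0 A1 i k * dX k j) = 0"
    proof (intro allI impI ballI)
      fix j i assume ji: "j < m1" "i \<in> Om j"
      then have "J (j, i) h = 0" by (intro J0) (simp add: Obs_def)
      then show "(\<Sum>k<q + s1. vcat q D0 D1 i k * C1 k j) + (\<Sum>k<q + s1. vcat q A0 A1 i k * dX k j) = 0"
        using ji unfolding J_def E_def bilin_def x0s D0_def D1_def dX_def r by simp
    qed
    have e2: "\<forall>j<m2. \<forall>i\<in>Om (m1 + j). (\<Sum>k<q + s2. vcat q D0 D2 i k * C2 k j) + (\<Sum>k<q
        + s2. vcat q A0 A2 i k * dY k j) = 0"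
    proof (intro allI impI ballI)
      fix j i assume ji: "j < m2" "i \<in> Om (m1 + j)"
      then have "J (m1 + j, i) h = 0" by (intro J0) (simp add: Obs_def)
      then show "(\<Sum>k<q + s2. vcat q D0 D2 i k * C2 k j) + (\<Sum>k<q + s2. vcat q A0 A2 i k * dY k j) = 0"
        using ji unfolding J_def E_def bilin_def x0s D0_def D2_def dY_def r by simp
    qed
    have concl: "(\<forall>i<n. (\<forall>k<q. D0 i k = 0) \<and> (\<forall>k<s1. D1 i k = 0) \<and> (\<forall>k<s2. D2 i k = 0)) \<and>
       (\<forall>j<m1. \<forall>k<q + s1. dX k j = 0) \<and> (\<forall>j<m2. \<forall>k<q + s2. dY k j = 0)"
      using rig[unfolded rigid_def, THEN spec[of _ D0], THEN spec[of _ D1], THEN spec[of _ D2],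
        THEN spec[of _ dX], THEN spec[of _ dY]] z0 z1 z2 e1 e2 by (elim impE) assumption+
    have uPI: "u \<in> param_index n m1 m2 r1 r2 r" using u IPI by (auto simp: PI_def)
    then obtain a i k where uu: "u = (a, i, k)" "a = 0 \<or> a = 1 \<or> a = 2 \<or> a = 3 \<or> a = 4"
      by (rule param_index_cases)
    have "res h u = 0"
      using uu(2)
    proof (elim disjE)
      assume "a = 0"
      then show ?thesis using uPI concl by (simp add: uu(1) param_index_mem D0_def q_def)
    next
      assume "a = 1"
      then show ?thesis using uPI concl by (simp add: uu(1) param_index_mem D1_def s1_def)
    next
      assume "a = 2"
      then show ?thesis using uPI concl by (simp add: uu(1) param_index_mem D2_def s2_def)
    next
      assume "a = 3"
      then show ?thesis using uPI concl r by (simp add: uu(1) param_index_mem dX_def)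
    next
      assume "a = 4"
      then show ?thesis using uPI concl r by (simp add: uu(1) param_index_mem dY_def)
    qed
    then show "h u = 0" using u by (simp add: res_def)
  qed
  then obtain K C k h where C: "\<forall>k\<le>K. mpoly Obs (C k)"
      "\<forall>h. (\<Sum>k\<le>K. C k (\<lambda>v. f v h) * E (P h) (P h) i0 j0 ^ k) = 0"
      "k \<le> K" "C k (\<lambda>v. f v h) \<noteq> 0"
    by blast
  define obs where "obs = (\<lambda>p v. E p p (snd v) (fst v))"
  have obs_cong: "E p p i j = E p' p' i j"
    if eq: "\<And>u. u \<in> PI \<Longrightarrow> p u = p' u" and ij: "i < n" "j < m1 + m2" for p p' i j
    unfolding E_def
  proof (rule bilin_cong)
    show "p (0, i, k) = p' (0, i, k)" if "k < q" for k
      using that ij by (intro eq) (simp add: PI_def param_index_mem q_def)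
    show "p (1, i, k) = p' (1, i, k)" if "k < r1 - q" for k
      using that ij r by (intro eq) (simp add: PI_def param_index_mem s1_def)
    show "p (2, i, k) = p' (2, i, k)" if "k < r2 - q" for k
      using that ij r by (intro eq) (simp add: PI_def param_index_mem s2_def)
    show "p (3, k, j) = p' (3, k, j)" if "j < m1" "k < r1" for k
      using that by (intro eq) (simp add: PI_def param_index_mem)
    show "p (4, k, j - m1) = p' (4, k, j - m1)" if "m1 \<le> j" "k < r2" for k
      using that ij by (intro eq) (simp add: PI_def param_index_mem less_diff_conv2)
  qed
  have E_poly: "mpoly PI (\<lambda>p. E p p i j)" if "i < n" "j < m1 + m2" for i j
    unfolding E_def
  proof (rule mpoly_bilin[OF finPI])
    show "u \<in> PI" if "u \<in> {0} \<times> {i} \<times> {..<q} \<union> {1} \<times> {i} \<times> {..<r1 - q} \<union> {2} \<times> {i} \<times> {..<r2 - q}" for u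
    proof -
      have d: "r1 - q = s1" "r2 - q = s2" using r by simp_all
      have mem: "(0, i, k) \<in> PI \<longleftrightarrow> k < q" "(1, i, k) \<in> PI \<longleftrightarrow> k < s1" "(2, i, k) \<in> PI \<longleftrightarrow> k < s2" for k
        using \<open>i < n\<close> by (simp_all add: PI_def param_index_mem q_def s1_def s2_def)
      show ?thesis using that unfolding d by (auto simp del: One_nat_def simp: mem)
    qed
    show "(3, k, j) \<in> PI" if "j < m1" "k < r1" for k using that by (simp add: PI_def param_index_mem)
    show "(4, k, j - m1) \<in> PI" if "m1 \<le> j" "k < r2" for k
      using that \<open>j < m1 + m2\<close> by (simp add: PI_def param_index_mem less_diff_conv2)
  qed
  have ObsD: "snd v < n" "fst v < m1 + m2" if v_Obs: "v \<in> Obs" for v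
  proof -
    obtain j i where v: "v = (j, i)" "j < m1 + m2" "i \<in> Om j" using v_Obs by (auto simp: Obs_def)
    then show "snd v < n" "fst v < m1 + m2" using Om[OF v(2)] by auto
  qed
  have C_poly: "mpoly PI (\<lambda>p. C k (obs p))"
  proof -
    obtain d b where b: "\<And>y. C k y = (\<Sum>e\<in>exps Obs d. b e * monom_fun Obs e y)"
      using C(1,3) by (auto simp: mpoly_def mpoly_deg_def)
    show ?thesis
      unfolding b monom_fun_def
    proof (intro mpoly_sum mpoly_mult mpoly_const mpoly_prod mpoly_power finPI finObs finite_exps)
      fix v assume "v \<in> Obs"
      then show "mpoly PI (\<lambda>p. obs p v)" unfolding obs_def by (intro E_poly ObsD)
    qed
  qed
  \<comment> \<open>The point on the chart at which the coefficient is nonzero also lies in the full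
    parameter space, so it is a witness for the polynomial in \<open>p\<close>.\<close>
  have "C k (obs (P h)) \<noteq> 0" using C(4) by (simp add: obs_def f_def)
  note zeros = mpoly_zero_set_null[where f = "\<lambda>p. C k (obs p)" and ?x0.0 = "P h", OF finPI C_poly this]
  have null: "{p \<in> space (param_measure n m1 m2 r1 r2 r). C k (obs p) = 0}
      \<in> null_sets (param_measure n m1 m2 r1 r2 r)"
    unfolding param_measure_def PI_def[symmetric] by (rule zeros)
  show ?thesis
  proof (rule bexI[OF ballI null])
    fix p assume p: "p \<in> space (param_measure n m1 m2 r1 r2 r) -
        {p \<in> space (param_measure n m1 m2 r1 r2 r). C k (obs p) = 0}"
    have Ck: "C k (obs p) \<noteq> 0" using p by blast
    show "finite {bilin q m1 r1 r2 p' p' i0 j0 | p'. norm_params q s1 s2 R0 R1 R2 p' \<and>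
       (\<forall>j<m1 + m2. \<forall>i\<in>Om j. bilin q m1 r1 r2 p' p' i j = bilin q m1 r1 r2 p p i j)}" (is "finite ?Z")
    proof (rule finite_real_polynomial_roots_of_family[where c = "\<lambda>k. C k (obs p)"])
      show "\<forall>z\<in>?Z. (\<Sum>k\<le>K. C k (obs p) * z ^ k) = 0"
      proof
        fix z assume "z \<in> ?Z"
        then obtain p' where p': "z = E p' p' i0 j0" "norm_params q s1 s2 R0 R1 R2 p'"
           "\<forall>j<m1 + m2. \<forall>i\<in>Om j. E p' p' i j = E p p i j"
          unfolding E_def by blast
        \<comment> \<open>Outside \<open>I\<close> the normalisation forces \<open>p'\<close> to
          agree with \<open>x0\<close>, so \<open>p'\<close> is the point of the chart with
          displacement \<open>h'\<close>.\<close>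
        define h' where "h' = (\<lambda>u. p' u - x0 u)"
        have "norm_params q s1 s2 R0 R1 R2 x0" unfolding x0s by (rule norm)
        then have "p' u = x0 u" if "u \<in> PI - I" for u
          using norm_params_fixed[of r1 r2 r R0 R1 R2 p' x0 u n m1 m2] p'(2) that
          by (simp add: PI_def I_def q_def s1_def s2_def)
        then have P': "P h' u = p' u" if "u \<in> PI" for u
          using that by (auto simp: P_def res_def h'_def)
        have "C k (\<lambda>v. f v h') = C k (obs p)" if k_le: "k \<le> K" for k
        proof -
          obtain d b where b: "\<And>y. C k y = (\<Sum>e\<in>exps Obs d. b e * monom_fun Obs e y)"
            using C(1) k_le by (auto simp: mpoly_def mpoly_deg_def)
          have "f v h' = obs p v" if v: "v \<in> Obs" for v
          proof -
            have "f v h' = E p' p' (snd v) (fst v)"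
              unfolding f_def by (rule obs_cong[OF P' ObsD[OF v]])
            also have "\<dots> = E p p (snd v) (fst v)" using p'(3) v by (auto simp: Obs_def)
            finally show ?thesis by (simp add: obs_def)
          qed
          then show ?thesis unfolding b monom_fun_def by (intro sum.cong refl arg_cong2[of _ _ _ _
              "(*)"] prod.cong) simp
        qed
        moreover have "E (P h') (P h') i0 j0 = z" unfolding p'(1) by (rule obs_cong[OF P' ij])
        ultimately show "(\<Sum>k\<le>K. C k (obs p) * z ^ k) = 0"
          using C(2)[rule_format, of h'] by simp
      qed
    qed (fact C(3) Ck)+
  qed
qed

section \<open>The main theorem\<close>

lemma param_matrix_entry:
  assumes "i < n" "j < m1 + m2"
  shows "param_matrix n m1 m2 r1 r2 r p $$ (i, j) = bilin (r1 + r2 - r) m1 r1 r2 p p i j"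
  using assms unfolding param_matrix_def Let_def bilin_def vcat_def
  by (auto simp: scalar_prod_def atLeast0LessThan intro!: sum.cong)

lemma finite_matrices_with_entries:
  assumes "\<And>i j. i < n \<Longrightarrow> j < m \<Longrightarrow> finite (Z i j :: real set)"
  shows "finite {V \<in> carrier_mat n m. \<forall>i<n. \<forall>j<m. V $$ (i, j) \<in> Z i j}"
proof -
  let ?S = "{V \<in> carrier_mat n m. \<forall>i<n. \<forall>j<m. V $$ (i, j) \<in> Z i j}"
  let ?F = "PiE ({..<n} \<times> {..<m}) (\<lambda>(i, j). Z i j)"
  have "finite ?F" using assms by (intro finite_PiE) auto
  moreover have "?S \<subseteq> (\<lambda>g. mat n m g) ` ?F"
  proof
    fix V assume V: "V \<in> ?S"
    let ?g = "\<lambda>u\<in>{..<n} \<times> {..<m}. V $$ u"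
    have "V = mat n m ?g" using V by (intro eq_matI) auto
    moreover have "?g \<in> ?F" using V by auto
    ultimately show "V \<in> (\<lambda>g. mat n m g) ` ?F" by blast
  qed
  ultimately show ?thesis by (meson finite_imageI finite_subset)
qed

lemma chart_cong:
  assumes "\<And>k. k < q \<Longrightarrow> R0 k = R0' k" "\<And>k. k < s1 \<Longrightarrow> R1 k = R1' k" "\<And>k. k < s2 \<Longrightarrow> R2 k = R2' k"
  shows "chart n q s1 s2 R0 R1 R2 = chart n q s1 s2 R0' R1' R2'"
proof -
  have 1: "rcat q R0 R1 k = rcat q R0' R1' k" if "k < q + s1" for k
    using assms(1,2) that by (auto simp: rcat_def)
  have 2: "rcat q R0 R2 k = rcat q R0' R2' k" if "k < q + s2" for k
    using assms(1,3) that by (auto simp: rcat_def)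
  have "inj_on (rcat q R0 R1) {..<q + s1} = inj_on (rcat q R0' R1') {..<q + s1}"
    using 1 by (intro inj_on_cong) simp
  moreover have "inj_on (rcat q R0 R2) {..<q + s2} = inj_on (rcat q R0' R2') {..<q + s2}"
    using 2 by (intro inj_on_cong) simp
  ultimately show ?thesis unfolding chart_def using 1 2 by simp
qed

lemma normalised_cong:
  assumes "\<And>k. k < q \<Longrightarrow> R0 k = R0' k" "\<And>k. k < s1 \<Longrightarrow> R1 k = R1' k" "\<And>k. k < s2 \<Longrightarrow> R2 k = R2' k"
  shows "normalised q s1 s2 R0 R1 R2 A0 A1 A2 = normalised q s1 s2 R0' R1' R2' A0 A1 A2"
  unfolding normalised_def using assms by simp

text \<open>\<open>U\<close> itself need not be in normal form: only its observed entries enter.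
  Every completion has a normal form on one of finitely many charts, and on each chart each entry
  takes finitely many values unless \<open>p\<close> lies in a null set; the union of these null
  sets is the exceptional set.\<close>

lemma rigid_imp_finitely_completable:
  fixes n m1 m2 r r1 r2 :: nat
  defines "q \<equiv> r1 + r2 - r" and "s1 \<equiv> r - r2" and "s2 \<equiv> r - r1"
  assumes r: "r1 = q + s1" "r2 = q + s2"
    and Om: "\<And>j. j < m1 + m2 \<Longrightarrow> Om j \<subseteq> {..<n}"
    and rig: "\<And>R0 R1 R2. chart n q s1 s2 R0 R1 R2 \<Longrightarrow>
      \<exists>A0 A1 A2 C1 C2. normalised q s1 s2 R0 R1 R2 A0 A1 A2 \<and>
        rigid n q s1 s2 R0 R1 R2 m1 m2 Om (\<lambda>j. Om (m1 + j)) A0 A1 A2 C1 C2"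
  shows "\<exists>N\<in>null_sets (param_measure n m1 m2 r1 r2 r). \<forall>p\<in>space (param_measure n m1 m2 r1 r2 r) - N.
     finitely_completable n m1 m2 r1 r2 r (param_matrix n m1 m2 r1 r2 r p) Om"
proof -
  let ?\<mu> = "param_measure n m1 m2 r1 r2 r"
  define Z where "Z = (\<lambda>(R0, R1, R2) (i0, j0) p. {bilin q m1 r1 r2 p' p' i0 j0 | p'. norm_params q s1 s2 R0 R1 R2 p' \<and>
       (\<forall>j<m1 + m2. \<forall>i\<in>Om j. bilin q m1 r1 r2 p' p' i j = bilin q m1 r1 r2 p p i j)})"
  \<comment> \<open>Pivot rows are taken extensional to keep the set of charts finite;
    \<open>chart\<close> and \<open>normalised\<close> look only at indices in range, so every chart
    can be restricted to one of these.\<close>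
  define CH where "CH = {(R0, R1, R2). R0 \<in> PiE {..<q} (\<lambda>_. {..<n}) \<and> R1 \<in> PiE {..<s1} (\<lambda>_. {..<n}) \<and>
     R2 \<in> PiE {..<s2} (\<lambda>_. {..<n}) \<and> chart n q s1 s2 R0 R1 R2}"
  have "finite CH"
    by (rule finite_subset[of _ "PiE {..<q} (\<lambda>_. {..<n}) \<times> PiE {..<s1} (\<lambda>_. {..<n}) \<times> PiE {..<s2} (\<lambda>_. {..<n})"])
      (auto simp: CH_def intro!: finite_PiE)
  have "\<exists>N. N \<in> null_sets ?\<mu> \<and> (\<forall>p\<in>space ?\<mu> - N. finite (Z c v p))"
    if cv: "c \<in> CH" "v \<in> {..<n} \<times> {..<m1 + m2}" for c v
  proof -
    obtain R0 R1 R2 i0 j0 where e: "c = (R0, R1, R2)" "v = (i0, j0)" by (metis prod_cases3 surj_pair)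
    have "chart n q s1 s2 R0 R1 R2" using cv by (simp add: e CH_def)
    from rig[OF this] obtain A0 A1 A2 C1 C2 where A: "normalised q s1 s2 R0 R1 R2 A0 A1 A2"
      "rigid n q s1 s2 R0 R1 R2 m1 m2 Om (\<lambda>j. Om (m1 + j)) A0 A1 A2 C1 C2" by (elim exE conjE)
    have ij: "i0 < n" "j0 < m1 + m2" using cv by (simp_all add: e)
    show ?thesis
      using chart_fibre_finite[OF r[unfolded q_def s1_def s2_def] A[unfolded q_def s1_def s2_def] Om ij]
      unfolding Z_def e q_def s1_def s2_def by (simp add: Bex_def)
  qed
  then obtain NN where NN: "\<And>c v. c \<in> CH \<Longrightarrow> v \<in> {..<n} \<times> {..<m1 + m2} \<Longrightarrow> NN c v \<in> null_sets ?\<mu>"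
     "\<And>c v p. c \<in> CH \<Longrightarrow> v \<in> {..<n} \<times> {..<m1 + m2} \<Longrightarrow> p \<in> space ?\<mu> - NN c v \<Longrightarrow> finite (Z c v p)"
    by metis
  define N where "N = (\<Union>c\<in>CH. \<Union>v\<in>{..<n} \<times> {..<m1 + m2}. NN c v)"
  have "N \<in> null_sets ?\<mu>"
    unfolding N_def using NN(1) \<open>finite CH\<close> by (intro null_sets.finite_UN) auto
  moreover have "finitely_completable n m1 m2 r1 r2 r (param_matrix n m1 m2 r1 r2 r p) Om"
    if p: "p \<in> space ?\<mu> - N" for p
  proof -
    let ?U = "param_matrix n m1 m2 r1 r2 r p"
    define W where "W = (\<lambda>i j. \<Union>c\<in>CH. Z c (i, j) p)"
    have "finite (W i j)" if "i < n" "j < m1 + m2" for i j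
      unfolding W_def using that p \<open>finite CH\<close> by (intro finite_UN_I NN(2)) (auto simp: N_def)
    then have "finite {V \<in> carrier_mat n (m1 + m2). \<forall>i<n. \<forall>j<m1 + m2. V $$ (i, j) \<in> W i j}"
      by (rule finite_matrices_with_entries)
    moreover have "completions n m1 m2 r1 r2 r ?U Om
        \<subseteq> {V \<in> carrier_mat n (m1 + m2). \<forall>i<n. \<forall>j<m1 + m2. V $$ (i, j) \<in> W i j}"
    proof
      fix V assume "V \<in> completions n m1 m2 r1 r2 r ?U Om"
      then have V: "V \<in> carrier_mat n (m1 + m2)" "\<forall>j<m1 + m2. \<forall>i\<in>Om j. i < n \<longrightarrow> V $$ (i, j) = ?U $$ (i, j)"
         "mrank n (view1 n m1 V) = r1" "mrank n (view2 n m1 m2 V) = r2" "mrank n V = r"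
        by (simp_all add: completions_def)
      from rank_normal_form[OF V(1,3,4,5), folded q_def s1_def s2_def]
      obtain R0 R1 R2 A0 A1 A2 X Y where ch: "chart n q s1 s2 R0 R1 R2"
          and nrm: "normalised q s1 s2 R0 R1 R2 A0 A1 A2"
          and X: "\<forall>i<n. \<forall>j<m1. V $$ (i, j) = (\<Sum>k<r1. vcat q A0 A1 i k * X j k)"
          and Y: "\<forall>i<n. \<forall>j<m2. V $$ (i, m1 + j) = (\<Sum>k<r2. vcat q A0 A2 i k * Y j k)"
        by (elim exE conjE)
      define p' :: "nat \<times> nat \<times> nat \<Rightarrow> real" where "p' = (\<lambda>(a, i, k). if a = 0 then A0 i k else if a
          = 1 then A1 i k
         else if a = 2 then A2 i k else if a = 3 then X k i else Y k i)"
      have p's: "(\<lambda>i k. p' (0, i, k)) = A0" "(\<lambda>i k. p' (1, i, k)) = A1" "(\<lambda>i k. p' (2, i, k)) = A2"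
        "\<And>k j. p' (3, k, j) = X j k" "\<And>k j. p' (4, k, j) = Y j k"
        by (simp_all add: p'_def fun_eq_iff)
      define c where "c = (restrict R0 {..<q}, restrict R1 {..<s1}, restrict R2 {..<s2})"
      have ch': "chart n q s1 s2 (restrict R0 {..<q}) (restrict R1 {..<s1}) (restrict R2 {..<s2})"
        by (rule iffD1[OF chart_cong ch]) simp_all
      have nrm': "norm_params q s1 s2 (restrict R0 {..<q}) (restrict R1 {..<s1}) (restrict R2 {..<s2}) p'"
        unfolding p's by (rule iffD1[OF normalised_cong nrm]) simp_all
      have "c \<in> CH"
        unfolding CH_def c_def using ch' chartD(1-3)[OF ch] by simp
      have Vp: "V $$ (i, j) = bilin q m1 r1 r2 p' p' i j" if "i < n" "j < m1 + m2" for i j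
      proof (cases "j < m1")
        case True
        then show ?thesis unfolding bilin_def p's using X that by simp
      next
        case False
        then have "V $$ (i, m1 + (j - m1)) = (\<Sum>k<r2. vcat q A0 A2 i k * Y (j - m1) k)"
          using Y[rule_format, of i "j - m1"] that by linarith
        then show ?thesis unfolding bilin_def p's using False by simp
      qed
      have obs: "bilin q m1 r1 r2 p' p' i j = bilin q m1 r1 r2 p p i j" if "j < m1 + m2" "i \<in> Om j" for i j
      proof -
        have "i < n" using Om that by blast
        then show ?thesis
          using V(2)[rule_format, OF that] Vp[OF _ that(1), of i] param_matrix_entry[OF _ that(1), of i n r1 r2 r p]
          by (simp add: q_def)
      qed
      have "V $$ (i, j) \<in> W i j" if ij: "i < n" "j < m1 + m2" for i j
      proof -
        have "V $$ (i, j) \<in> Z c (i, j) p"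
          unfolding Z_def c_def prod.case Vp[OF ij] using nrm' obs by blast
        then show ?thesis using \<open>c \<in> CH\<close> unfolding W_def by blast
      qed
      then show "V \<in> {V \<in> carrier_mat n (m1 + m2). \<forall>i<n. \<forall>j<m1 + m2. V $$ (i, j) \<in> W i j}"
        using V(1) by blast
    qed
    ultimately show ?thesis unfolding finitely_completable_def by (rule rev_finite_subset)
  qed
  ultimately show ?thesis by blast
qed

lemma groups_hall_ok_prob:
  fixes x :: real
  assumes k: "\<forall>j<m. l \<le> k j \<and> k j \<le> n" and n: "6 \<le> n" "6 * \<rho> \<le> n" and x: "0 < x" "x \<le> 1"
    and l: "9 * ln n - 3 * ln x + 6 \<le> real l" "2 * \<rho> < l" "l \<le> n" and N: "N = (n - \<rho>) div 2"
    and m: "d + b * N \<le> m"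
  shows "measure_pmf.prob (sampling n m k) {Om. \<exists>c<b. \<not> hall_ok n \<rho> N (\<lambda>t. Om (d + (c * N + t)))} \<le> real b * x"
proof -
  have "{Om. \<exists>c<b. \<not> hall_ok n \<rho> N (\<lambda>t. Om (d + (c * N + t)))}
      = (\<Union>c\<in>{..<b}. {Om. \<not> hall_ok n \<rho> N (\<lambda>t. Om (d + (c * N + t)))})"
    by blast
  also have "measure_pmf.prob (sampling n m k) \<dots>
      \<le> (\<Sum>c\<in>{..<b}. measure_pmf.prob (sampling n m k) {Om. \<not> hall_ok n \<rho> N (\<lambda>t. Om (d + (c * N + t)))})"
    by (rule measure_pmf.finite_measure_subadditive_finite) simp_all
  also have "\<dots> \<le> (\<Sum>c\<in>{..<b}. x)"
  proof (rule sum_mono)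
    fix c assume c: "c \<in> {..<b}"
    have "(\<lambda>t. d + (c * N + t)) ` {..<N} \<subseteq> {..<m}"
    proof
      fix j assume "j \<in> (\<lambda>t. d + (c * N + t)) ` {..<N}"
      then obtain t where t: "t < N" "j = d + (c * N + t)" by blast
      then show "j \<in> {..<m}" using block_index[of c b t N] c m by simp
    qed
    moreover have "inj_on (\<lambda>t. d + (c * N + t)) {..<N}" by (simp add: inj_on_def)
    moreover have "\<rho> < l" using l(2) by simp
    moreover have "0 < n" using n by simp
    ultimately have "measure_pmf.prob (sampling n m k) {Om. \<not> hall_ok n \<rho> N (\<lambda>t. Om (d + (c * N + t)))}
        \<le> (\<Sum>a = 1..n - l. real (n choose a) * real (N choose (N - (a - 1) div 2)) *
          (real (n - a) / real n) ^ (l * (N - (a - 1) div 2)))"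
      using l(3) N by (intro hall_ok_prob[OF k])
    also have "\<dots> \<le> x" by (rule tail_sum[OF n x l(1,2) N])
    finally show "measure_pmf.prob (sampling n m k) {Om. \<not> hall_ok n \<rho> N (\<lambda>t. Om (d + (c * N + t)))} \<le> x" .
  qed
  finally show ?thesis by simp
qed

text \<open>Only half of the columns allotted to the intersection of the column spaces are needed, and one
  of the two views contains that many.\<close>

lemma primary_view:
  fixes n q s1 s2 m1 m2 :: nat
  assumes n: "6 * (q + s1) \<le> n" "6 * (q + s2) \<le> n"
    and m: "s1 * (n - (q + s1)) \<le> m1" "s2 * (n - (q + s2)) \<le> m2" "q + s1 \<le> m1" "q + s2 \<le> m2"
      "s1 * (n - (q + s1)) + s2 * (n - (q + s2)) + q * (n - q) \<le> m1 + m2"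
  shows "((q + s1) * ((n - (q + s1)) div 2) \<le> m1 \<and> q + s2 * ((n - (q + s2)) div 2) \<le> m2) \<or>
    ((q + s2) * ((n - (q + s2)) div 2) \<le> m2 \<and> q + s1 * ((n - (q + s1)) div 2) \<le> m1)"
proof -
  have primary: "(q + s) * ((n - (q + s)) div 2) \<le> m"
    if "q * (n - q) + 2 * (s * (n - (q + s))) \<le> 2 * m" for s m :: nat
  proof -
    have "2 * ((q + s) * ((n - (q + s)) div 2)) = (q + s) * (2 * ((n - (q + s)) div 2))" by simp
    also have "\<dots> \<le> (q + s) * (n - (q + s))" by (intro mult_left_mono) auto
    also have "\<dots> = q * (n - (q + s)) + s * (n - (q + s))" by (rule distrib_right)
    also have "\<dots> \<le> q * (n - q) + 2 * (s * (n - (q + s)))" by (intro add_mono mult_left_mono) auto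
    finally show ?thesis using that by linarith
  qed
  \<comment> \<open>Halving the groups frees at least half of \<open>s * (n - (q + s))\<close>
    columns, which by \<open>6 * (q + s) \<le> n\<close> leaves room for the \<open>q\<close> single
    columns. For \<open>s = 0\<close> there are no groups, and the rank bound
    \<open>q + s \<le> m\<close> is what helps.\<close>
  have secondary: "q + s * ((n - (q + s)) div 2) \<le> m"
    if "6 * (q + s) \<le> n" "s * (n - (q + s)) \<le> m" "q + s \<le> m" for s m :: nat
  proof (cases "s = 0")
    case False
    define M where "M = n - (q + s)"
    define H where "H = M div 2"
    have "2 * H \<le> M" "5 * (q + s) \<le> M" using that(1) by (simp_all add: M_def H_def)
    then have "q \<le> 1 * (M - H)" by simp
    also have "\<dots> \<le> s * (M - H)" using False by (intro mult_right_mono) auto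
    finally have "q + s * H \<le> s * (M - H) + s * H" by simp
    also have "\<dots> = s * M" using \<open>2 * H \<le> M\<close> by (simp add: distrib_left[symmetric])
    finally show ?thesis using that(2) by (simp add: M_def H_def)
  qed (use that in simp)
  show ?thesis
  proof (cases "q * (n - q) + 2 * (s1 * (n - (q + s1))) \<le> 2 * m1")
    case True
    then show ?thesis using primary secondary n m by blast
  next
    \<comment> \<open>The first view then has less than its share,
      \<open>s1 * (n - (q + s1))\<close> plus half of \<open>q * (n - q)\<close>, so the bound on
      \<open>m1 + m2\<close> leaves the second view more than its corresponding share.\<close>
    case False
    then have "q * (n - q) + 2 * (s2 * (n - (q + s2))) \<le> 2 * m2" using m(5) by linarith
    then show ?thesis using primary secondary n m by blast
  qed
qed

theorem theorem3:
  fixes n m1 m2 r r1 r2 l :: nat and \<epsilon> :: real and k :: "nat \<Rightarrow> nat"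
  assumes "0 < n" "0 < m1" "0 < m2"
    and "1 \<le> r1" "1 \<le> r2" "r1 \<le> r" "r2 \<le> r" "r \<le> n" "r \<le> r1 + r2"
    and "0 < \<epsilon>" "\<epsilon> < 1"
    and "real n / 6 \<ge> real (max r1 (max r2 (r1 + r2 - r)))"
    and "m1 \<ge> (r - r2) * (n - r1)"
    and "m2 \<ge> (r - r1) * (n - r2)"
    and "m1 + m2 \<ge> (r - r2) * (n - r1) + (r - r1) * (n - r2) + (r1 + r2 - r) * (n - (r1 + r2 - r))"
    and "real l > max (9 * ln (real n / \<epsilon>)
                      + 3 * max (ln (3 * real (r - r2) / \<epsilon>))
                                (max (ln (3 * real (r - r1) / \<epsilon>)) (ln (3 * real (r1 + r2 - r) / \<epsilon>)))
                      + 6)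
                     (max (2 * real r1) (2 * real r2))"
    and "\<forall>j < m1 + m2. l \<le> k j \<and> k j \<le> n"
  shows "\<exists>N \<in> null_sets (param_measure n m1 m2 r1 r2 r).
           \<forall>p \<in> space (param_measure n m1 m2 r1 r2 r) - N.
             (let U = param_matrix n m1 m2 r1 r2 r p in
               mrank n (view1 n m1 U) = r1 \<longrightarrow> mrank n (view2 n m1 m2 U) = r2 \<longrightarrow> mrank n U = r \<longrightarrow>
               measure_pmf.prob (sampling n (m1 + m2) k)
                 {\<Omega>. finitely_completable n m1 m2 r1 r2 r U \<Omega>} \<ge> 1 - \<epsilon>)"
proof (cases "r1 \<le> m1 \<and> r2 \<le> m2")
  \<comment> \<open>A prescribed rank exceeds the number of columns of its view, so no
    \<open>U\<close> meets the rank conditions and the claim is vacuous.\<close>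
  case False
  have "mrank n (view1 n m1 U) \<le> m1" "mrank n (view2 n m1 m2 U) \<le> m2" for U
    by (rule vec_space.rank_le_nc, simp add: view1_def view2_def)+
  then have "\<not> (mrank n (view1 n m1 U) = r1 \<and> mrank n (view2 n m1 m2 U) = r2)" for U
    using False by metis
  then show ?thesis by (intro bexI[of _ "{}"]) (auto simp: Let_def)
next
  case rank_le: True
  define q where "q = r1 + r2 - r"
  define s1 where "s1 = r - r2"
  define s2 where "s2 = r - r1"
  have r: "r1 = q + s1" "r2 = q + s2" "q + s1 + s2 = r"
    using assms(6,7,9) by (simp_all add: q_def s1_def s2_def)
  have n: "6 * r1 \<le> n" "6 * r2 \<le> n"
    using assms(12) by linarith+
  have n6: "6 \<le> n" using n assms(4) by linarith
  define R where "R = max s1 (max s2 q)"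
  \<comment> \<open>The failure probability granted to one group. In either case there are
    \<open>r = q + s1 + s2 \<le> 3 * R\<close> groups, which is the origin of the factor 3 inside
    the logarithms.\<close>
  define x where "x = \<epsilon> / (3 * real R)"
  have R: "s1 \<le> R" "s2 \<le> R" "q \<le> R" "1 \<le> R"
    using r assms(4) unfolding R_def by linarith+
  have x: "0 < x" "x \<le> 1"
    using R(4) assms(10,11) by (simp_all add: x_def field_simps)
  have l2: "2 * r1 < l" "2 * r2 < l" using assms(16) by simp_all
  have ln_x: "ln (3 * real R / \<epsilon>) = - ln x"
    using R(4) assms(10) by (simp add: x_def ln_div ln_mult)
  have "9 * ln n - 3 * ln x + 6 \<le> real l"
  proof -
    have "ln (real n) \<le> ln (real n / \<epsilon>)"
      using n6 assms(10,11) by (simp add: field_simps)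
    \<comment> \<open>\<open>R\<close> is one of the three numbers, so its logarithm occurs in the
      maximum; this is unaffected by the value of \<open>ln 0\<close> when another of them is
      zero.\<close>
    moreover have "ln (3 * real R / \<epsilon>) \<le> max (ln (3 * real s1 / \<epsilon>)) (max (ln (3 * real s2 / \<epsilon>)) (ln (3 * real q / \<epsilon>)))"
      unfolding R_def by (auto simp: max_def)
    ultimately show ?thesis
      using assms(16) unfolding ln_x s1_def[symmetric] s2_def[symmetric] q_def[symmetric] by linarith
  qed
  note l = this
  have ln_le: "l \<le> n" using assms(2,17) by (meson add_pos_pos assms(3) le_trans)
  define N1 where "N1 = (n - r1) div 2"
  define N2 where "N2 = (n - r2) div 2"
  have N: "0 < N1" "2 * N1 \<le> n - r1" "0 < N2" "2 * N2 \<le> n - r2"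
    using n n6 unfolding N1_def N2_def by linarith+
  define goodA where "goodA = (\<lambda>Om. (\<forall>c<r1. hall_ok n r1 N1 (\<lambda>t. Om (c * N1 + t))) \<and>
     (\<forall>c<s2. hall_ok n r2 N2 (\<lambda>t. Om (m1 + (q + (c * N2 + t))))))"
  define goodB where "goodB = (\<lambda>Om. (\<forall>c<r2. hall_ok n r2 N2 (\<lambda>t. Om (m1 + (c * N2 + t)))) \<and>
     (\<forall>c<s1. hall_ok n r1 N1 (\<lambda>t. Om (q + (c * N1 + t)))))"
  \<comment> \<open>Which view has to determine its column space alone is decided by the dimensions,
    before the pattern is drawn.\<close>
  define caseA where "caseA \<longleftrightarrow> r1 * N1 \<le> m1 \<and> q + s2 * N2 \<le> m2"
  have caseB: "r2 * N2 \<le> m2 \<and> q + s1 * N1 \<le> m1" if "\<not> caseA"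
    using primary_view[of q s1 n s2 m1 m2] n rank_le assms(13,14,15) that
    unfolding caseA_def N1_def N2_def r(1,2)[symmetric] q_def[symmetric] s1_def[symmetric] s2_def[symmetric]
    by blast
  define good where "good = (if caseA then goodA else goodB)"
  let ?\<mu> = "param_measure n m1 m2 r1 r2 r"
  \<comment> \<open>There are finitely many good patterns, so the union of their null sets is null,
    and the exceptional set of \<open>U\<close> does not depend on the sample.\<close>
  define OM where "OM = {Om \<in> PiE_dflt {..<m1 + m2} {} (\<lambda>_. Pow {..<n}). (\<forall>j<m1 + m2. l \<le> card (Om j)) \<and>
      good Om}"
  have "finite OM"
    unfolding OM_def by (rule finite_subset[of _ "PiE_dflt {..<m1
        + m2} {} (\<lambda>_. Pow {..<n})"]) (auto intro!: finite_PiE_dflt)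
  \<comment> \<open>The two bounds \<open>2 * r1 < l\<close> and \<open>2 * r2 < l\<close> give
    \<open>r1 + r2 < l\<close>, so each column has enough observed rows for the joint independence
    of all \<open>r\<close> basis vectors.\<close>
  have rl: "r \<le> l" using l2 assms(9) by linarith
  have "\<exists>N. N \<in> null_sets ?\<mu> \<and> (\<forall>p\<in>space ?\<mu> - N.
     finitely_completable n m1 m2 r1 r2 r (param_matrix n m1 m2 r1 r2 r p) Om)" if Om: "Om \<in> OM" for Om
  proof -
    have sub: "Om j \<subseteq> {..<n}" "r \<le> card (Om j)" if "j < m1 + m2" for j
      using Om that rl unfolding OM_def PiE_dflt_def by (auto intro: order_trans)
    have "\<exists>N\<in>null_sets ?\<mu>. \<forall>p\<in>space ?\<mu> - N.
       finitely_completable n m1 m2 r1 r2 r (param_matrix n m1 m2 r1 r2 r p) Om"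
    proof (rule rigid_imp_finitely_completable[of r1 r2 r m1 m2 Om n, folded q_def s1_def s2_def, OF r(1,2) sub(1)])
      fix R0 R1 R2 assume ch: "chart n q s1 s2 R0 R1 R2"
      show "\<exists>A0 A1 A2 C1 C2. normalised q s1 s2 R0 R1 R2 A0 A1 A2 \<and>
        rigid n q s1 s2 R0 R1 R2 m1 m2 Om (\<lambda>j. Om (m1 + j)) A0 A1 A2 C1 C2"
      proof (cases caseA)
        case True
        then have g: "goodA Om" using Om by (simp add: OM_def good_def)
        show ?thesis
        proof (rule exists_rigid[OF ch])
          show "Om j \<subseteq> {..<n} \<and> q + s1 + s2 \<le> card (Om j)" if "j < m1" for j
            unfolding r(3) using sub[of j] that by simp
          show "Om (m1 + j) \<subseteq> {..<n} \<and> q + s1 + s2 \<le> card (Om (m1 + j))" if "j < m2" for j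
            unfolding r(3) using sub[of "m1 + j"] that by simp
          show "hall_ok n (q + s1) N1 (\<lambda>t. Om (c * N1 + t))" if "c < q + s1" for c
            using g that unfolding goodA_def r(1)[symmetric] by blast
          show "hall_ok n (q + s2) N2 (\<lambda>t. Om (m1 + (q + (c * N2 + t))))" if "c < s2" for c
            using g that unfolding goodA_def r(2)[symmetric] by blast
        qed (use N True in \<open>simp_all add: caseA_def r(1,2)[symmetric]\<close>)
      next
        case False
        then have g: "goodB Om" using Om by (simp add: OM_def good_def)
        have ch': "chart n q s2 s1 R0 R2 R1" using ch unfolding chart_def by blast
        have "\<exists>A0 A2 A1 C2 C1. normalised q s2 s1 R0 R2 R1 A0 A2 A1 \<and>
          rigid n q s2 s1 R0 R2 R1 m2 m1 (\<lambda>j. Om (m1 + j)) Om A0 A2 A1 C2 C1"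
        proof (rule exists_rigid[OF ch'])
          show "Om j \<subseteq> {..<n} \<and> q + s2 + s1 \<le> card (Om j)" if "j < m1" for j
            using sub[of j] that r(3) by (simp add: ac_simps)
          show "Om (m1 + j) \<subseteq> {..<n} \<and> q + s2 + s1 \<le> card (Om (m1 + j))" if "j < m2" for j
            using sub[of "m1 + j"] that r(3) by (simp add: ac_simps)
          show "hall_ok n (q + s2) N2 (\<lambda>t. Om (m1 + (c * N2 + t)))" if "c < q + s2" for c
            using g that unfolding goodB_def r(2)[symmetric] by blast
          show "hall_ok n (q + s1) N1 (\<lambda>t. Om (q + (c * N1 + t)))" if "c < s1" for c
            using g that unfolding goodB_def r(1)[symmetric] by blast
        qed (use N caseB[OF False] in \<open>simp_all add: r(1,2)[symmetric]\<close>)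
        then obtain A0 A2 A1 C2 C1 where A: "normalised q s2 s1 R0 R2 R1 A0 A2 A1"
          "rigid n q s2 s1 R0 R2 R1 m2 m1 (\<lambda>j. Om (m1 + j)) Om A0 A2 A1 C2 C1" by (elim exE conjE)
        have "normalised q s1 s2 R0 R1 R2 A0 A1 A2" using A(1) unfolding normalised_def by blast
        then show ?thesis using rigid_swap[OF A(2)] by (intro exI conjI)
      qed
    qed
    then show ?thesis by blast
  qed
  then obtain NN where NN: "\<And>Om. Om \<in> OM \<Longrightarrow> NN Om \<in> null_sets ?\<mu>"
    "\<And>Om p. Om \<in> OM \<Longrightarrow> p \<in> space ?\<mu> - NN Om \<Longrightarrow>
       finitely_completable n m1 m2 r1 r2 r (param_matrix n m1 m2 r1 r2 r p) Om"
    by metis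
  define NS where "NS = (\<Union>Om\<in>OM. NN Om)"
  have "NS \<in> null_sets ?\<mu>"
    unfolding NS_def using NN(1) \<open>finite OM\<close> by (intro null_sets.finite_UN) auto
  moreover
  let ?M = "sampling n (m1 + m2) k"
  have bad: "measure_pmf.prob ?M {Om. \<not> good Om} \<le> \<epsilon>"
  proof -
    have two: "measure_pmf.prob ?M {Om. \<not> good Om} \<le> (real a + real b) * x"
      if "measure_pmf.prob ?M S \<le> real a * x" "measure_pmf.prob ?M T \<le> real b * x" "{Om. \<not> good Om} = S \<union> T"
      for S T a b
    proof -
      have "measure_pmf.prob ?M (S \<union> T) \<le> measure_pmf.prob ?M S + measure_pmf.prob ?M T"
        by (rule measure_Un_le) simp_all
      then show ?thesis using that by (simp add: distrib_right)
    qed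
    have xR: "real a * x \<le> \<epsilon>" if "a \<le> r" for a
    proof -
      have "real a \<le> 3 * real R" using that R r(3) by linarith
      then have "real a * x \<le> 3 * real R * x" using x by (intro mult_right_mono) auto
      also have "\<dots> = \<epsilon>" using R(4) by (simp add: x_def)
      finally show ?thesis .
    qed
    note family = groups_hall_ok_prob[OF assms(17) n6 _ x l _ ln_le]
    show ?thesis
    proof (cases caseA)
      case True
      have "measure_pmf.prob ?M {Om. \<exists>c<r1. \<not> hall_ok n r1 N1 (\<lambda>t. Om (c * N1 + t))} \<le> real r1 * x"
        using family[OF n(1) l2(1) N1_def, of 0 r1] True by (simp add: caseA_def)
      moreover have "measure_pmf.prob ?M {Om. \<exists>c<s2. \<not> hall_ok n r2 N2 (\<lambda>t. Om (m1 + (q + (c * N2 + t))))}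
          \<le> real s2 * x"
        using family[OF n(2) l2(2) N2_def, of "m1 + q" s2] True by (simp add: caseA_def add.assoc)
      ultimately have "measure_pmf.prob ?M {Om. \<not> good Om} \<le> (real r1 + real s2) * x"
        by (rule two) (use True in \<open>auto simp: good_def goodA_def\<close>)
      moreover have "r1 + s2 \<le> r" using r by simp
      ultimately show ?thesis using xR[of "r1 + s2"] unfolding of_nat_add by linarith
    next
      case False
      have "measure_pmf.prob ?M {Om. \<exists>c<r2. \<not> hall_ok n r2 N2 (\<lambda>t. Om (m1 + (c * N2 + t)))} \<le> real r2 * x"
        using family[OF n(2) l2(2) N2_def, of m1 r2] caseB[OF False] by simp
      moreover have "measure_pmf.prob ?M {Om. \<exists>c<s1. \<not> hall_ok n r1 N1 (\<lambda>t. Om (q + (c * N1 + t)))}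
          \<le> real s1 * x"
        using family[OF n(1) l2(1) N1_def, of q s1] caseB[OF False] by simp
      ultimately have "measure_pmf.prob ?M {Om. \<not> good Om} \<le> (real r2 + real s1) * x"
        by (rule two) (use False in \<open>auto simp: good_def goodB_def\<close>)
      moreover have "r2 + s1 \<le> r" using r by simp
      ultimately show ?thesis using xR[of "r2 + s1"] unfolding of_nat_add by linarith
    qed
  qed
  have "measure_pmf.prob ?M {Om. finitely_completable n m1 m2 r1 r2 r (param_matrix n m1 m2 r1 r2 r p) Om} \<ge> 1 - \<epsilon>"
    if p: "p \<in> space ?\<mu> - NS" for p
  proof -
    have sub: "{Om. good Om} \<inter> set_pmf ?M
        \<subseteq> {Om. finitely_completable n m1 m2 r1 r2 r (param_matrix n m1 m2 r1 r2 r p) Om}"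
    proof
      fix Om assume Om: "Om \<in> {Om. good Om} \<inter> set_pmf ?M"
      then have supp: "Om j \<subseteq> {..<n} \<and> card (Om j) = k j" if "j < m1 + m2" for j
        using sampling_support[of Om n "m1 + m2" k j] assms(17) that by blast
      have "Om j = {}" if "\<not> j < m1 + m2" for j
        using Om that unfolding sampling_def by (auto simp: set_Pi_pmf PiE_dflt_def)
      then have "Om \<in> OM"
        using Om supp assms(17) unfolding OM_def PiE_dflt_def by auto
      then show "Om \<in> {Om. finitely_completable n m1 m2 r1 r2 r (param_matrix n m1 m2 r1 r2 r p) Om}"
        using NN(2) p by (auto simp: NS_def)
    qed
    have "1 - \<epsilon> \<le> 1 - measure_pmf.prob ?M {Om. \<not> good Om}" using bad by simp
    also have "\<dots> = measure_pmf.prob ?M {Om. good Om}"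
      using measure_pmf.prob_compl[of "{Om. \<not> good Om}" ?M]
          by (simp add: Compl_eq_Diff_UNIV[symmetric] Collect_neg_eq[symmetric])
    also have "\<dots> = measure_pmf.prob ?M ({Om. good Om} \<inter> set_pmf ?M)"
      by (rule measure_Int_set_pmf[symmetric])
    also have "\<dots> \<le> measure_pmf.prob ?M {Om. finitely_completable n m1 m2 r1 r2 r (param_matrix n m1 m2 r1 r2 r p) Om}"
      by (rule measure_pmf.finite_measure_mono[OF sub]) simp
    finally show ?thesis .
  qed
  ultimately show ?thesis by (auto simp: Let_def)
qed

end
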